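(* Let $G$ be a finitely generated group and $\mathcal{m}$ a probability measure on $G$ such that (A1) the support of $\mathcal{m}$ generates $G$, and (A2${}^+$) there exists $\delta>0$ with $\int (\mathrm{length}(g))^{1+\delta}\,d\mathcal{m}(g)<\infty$. Let $\rho: G\to \mathrm{SL}(2,\mathbb{M})$ be any group homomorphism. Then $$\frac{1}{\log|t|^{-1}}\,\chi(t)\longrightarrow \chi_{\mathsf{na}} \quad\text{as } t\to 0.$$
   Context: $\mathrm{length}(g)$ is the word length of $g$ with respect to a fixed finite symmetric generating set of $G$. $\mathbb{M}$ denotes the ring of holomorphic functions on the punctured unit disk $\mathbb{D}^*$ which extend meromorphically through $0$; a homomorphism $\rho:G\to\mathrm{SL}(2,\mathbb{M})$ is the same as a family of representations $\rho_t:G\to\mathrm{SL}(2,\mathbb{C})$, $t\in\mathbb{D}^*$, with $t\mapsto\rho_t(g)$ holomorphic on $\mathbb{D}^*$ and meromorphic at $0$ for each $g$. Let $\mathcal{m}^n$ be the image of $\mathcal{m}^{\otimes n}$ under $(g_1,\dots,g_n)\mapsto g_n\cdots g_1$. For $t\in\mathbb{D}^*$, $\chi(t)=\lim_{n\to\infty}\frac1n\int\log\|\rho_t(g)\|\,d\mathcal{m}^n(g)$, where $\|\cdot\|$ is any matrix norm on $\mathrm{SL}(2,\mathbb{C})$ (e.g. the operator norm for the max norm on $\mathbb{C}^2$). Let $\mathbb{L}=\mathbb{C}((t))$ with the $t$-adic absolute value $|f|_{\mathsf{na}}=\exp(-\mathrm{ord}_{t=0}f)$; viewing $\mathbb{M}\subset\mathbb{L}$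 (Laurent expansion at $0$), $\rho$ induces $\rho_{\mathsf{na}}:G\to\mathrm{SL}(2,\mathbb{L})$. For $A\in\mathrm{SL}(2,\mathbb{L})$ let $\|A\|_{\mathsf{na}}$ be the maximum of the $t$-adic absolute values of its entries, and $\chi_{\mathsf{na}}=\lim_{n\to\infty}\frac1n\int\log\|\rho_{\mathsf{na}}(g)\|_{\mathsf{na}}\,d\mathcal{m}^n(g)$. *)

theory Defs
  imports "HOL-Complex_Analysis.Complex_Analysis"
          "HOL-Probability.Probability_Mass_Function"
          "HOL-Algebra.Generated_Groups"
begin

definition word_length :: "('a, 'b) monoid_scheme \<Rightarrow> 'a set \<Rightarrow> 'a \<Rightarrow> nat" where
  "word_length G S g =
     (LEAST n. \<exists>xs. length xs = n \<and> set xs \<subseteq> S \<and> g = foldr (\<lambda>x y. x \<otimes>\<^bsub>G\<^esub> y) xs \<one>\<^bsub>G\<^esub>)"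

primrec conv_pow :: "('a, 'b) monoid_scheme \<Rightarrow> 'a pmf \<Rightarrow> nat \<Rightarrow> 'a pmf" where
  "conv_pow G m 0 = return_pmf \<one>\<^bsub>G\<^esub>"
| "conv_pow G m (Suc n) =
     bind_pmf (conv_pow G m n) (\<lambda>h. map_pmf (\<lambda>g. g \<otimes>\<^bsub>G\<^esub> h) m)"

definition punctured_disk :: "complex set" where
  "punctured_disk = ball 0 1 - {0}"

definition in_M :: "(complex \<Rightarrow> complex) \<Rightarrow> bool" where
  "in_M f \<longleftrightarrow> f holomorphic_on punctured_disk \<and> f meromorphic_on {0}"

definition SL2M_rep :: "('a, 'b) monoid_scheme \<Rightarrow> ('a \<Rightarrow> complex \<Rightarrow> complex^2^2) \<Rightarrow> bool" where
  "SL2M_rep G rho \<longleftrightarrow>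
     (\<forall>g\<in>carrier G. \<forall>i j. in_M (\<lambda>t. rho g t $ i $ j)) \<and>
     (\<forall>g\<in>carrier G. \<forall>t\<in>punctured_disk. det (rho g t) = 1) \<and>
     (\<forall>g\<in>carrier G. \<forall>h\<in>carrier G. \<forall>t\<in>punctured_disk.
         rho (g \<otimes>\<^bsub>G\<^esub> h) t = rho g t ** rho h t)"

text \<open>Lyapunov exponent chi(t) (matrix norm: the library norm on complex^2^2, i.e. Frobenius).\<close>
definition lyap :: "('a, 'b) monoid_scheme \<Rightarrow> 'a pmf \<Rightarrow> ('a \<Rightarrow> complex \<Rightarrow> complex^2^2) \<Rightarrow> complex \<Rightarrow> real" where
  "lyap G m rho t =
     lim (\<lambda>n. (\<integral>g. ln (norm (rho g t)) \<partial>measure_pmf (conv_pow G m n)) / real n)"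

text \<open>Laurent expansion at 0 (embedding M \<subseteq> C((t))).\<close>
definition laurent_at0 :: "(complex \<Rightarrow> complex) \<Rightarrow> complex fls" where
  "laurent_at0 f = (THE F. f has_laurent_expansion F)"

definition rho_na :: "('a \<Rightarrow> complex \<Rightarrow> complex^2^2) \<Rightarrow> 'a \<Rightarrow> complex fls^2^2" where
  "rho_na rho g = (\<chi> i j. laurent_at0 (\<lambda>t. rho g t $ i $ j))"

definition abs_na :: "complex fls \<Rightarrow> real" where
  "abs_na F = (if F = 0 then 0 else exp (- real_of_int (fls_subdegree F)))"

definition norm_na :: "complex fls^2^2 \<Rightarrow> real" where
  "norm_na A = Max {abs_na (A $ i $ j) | i j. True}"

definition lyap_na :: "('a, 'b) monoid_scheme \<Rightarrow> 'a pmf \<Rightarrow> ('a \<Rightarrow> complex \<Rightarrow> complex^2^2) \<Rightarrow> real" where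
  "lyap_na G m rho =
     lim (\<lambda>n. (\<integral>g. ln (norm_na (rho_na rho g)) \<partial>measure_pmf (conv_pow G m n)) / real n)"

end

theory Submission
  imports Defs
begin

text \<open>
  Write \<open>M g = log \<parallel>\<rho>\<^sub>n\<^sub>a g\<parallel>\<close>. For every \<open>g\<close>, \<open>log \<parallel>\<rho>\<^sub>t g\<parallel> / log (1/|t|)\<close> tends to \<open>M g\<close> and is
  bounded by a multiple of the word length, so subadditivity gives the upper bound. For the lower bound, suppose
  that \<open>\<chi>(t\<^sub>j) \<le> (\<chi>\<^sub>n\<^sub>a - \<epsilon>) log (1/|t\<^sub>j|)\<close> with \<open>t\<^sub>j \<rightarrow> 0\<close>. A restart argument provides directions \<open>v\<^sub>j\<close> along which
  the expected growth is too slow for all times up to \<open>j\<close>. On the logarithmic scale, pass to the limit along the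
  orbit of \<open>v\<^sub>j\<close> and identify points whose distance is smaller than every power of \<open>|t\<^sub>j|\<close>. Since a matrix
  contracts at most one of several separated directions, the defect \<open>\<beta>\<close> between \<open>\<chi>\<^sub>n\<^sub>a\<close> and the growth rate from
  a point is a nonnegative harmonic function on the limit orbit with total mass at most \<open>2 \<chi>\<^sub>n\<^sub>a\<close>. The maximum
  principle then forces the limit orbit to be finite. Orbits with three or more points make \<open>M\<close> bounded, and an
  orbit with two points gives a random walk on the line with reflections, which has zero speed. If the orbit is
  one point, then \<open>v\<^sub>j\<close> is invariant up to an error smaller than every power of \<open>|t\<^sub>j|\<close>, so the meromorphic functions
  \<open>det (\<rho>\<^sub>t g \<rho>\<^sub>t h - \<rho>\<^sub>t h \<rho>\<^sub>t g)\<close> vanish identically and each \<open>\<rho>\<^sub>t\<close> has an invariant line. For such reducible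
  families both exponents are the absolute value of the drift of the eigenvalue.
\<close>

section \<open>Expectations along the random walk\<close>

text \<open>For a fixed number n of steps the limit t to 0 is harmless (dominated convergence), and
  the exponent is an infimum over n; the lower bound is hard because n must grow while t moves. The
  restart argument trades the limit in n for statements about each fixed n, at the price of a
  starting direction that depends on j. Plain compactness of the projective line would then be too
  coarse, since it forgets distances that decay like powers of |t|. Instead the roots x powr (1 / L)
  are kept: under them constants disappear and sums turn into maxima, so estimates for 2x2 matrices
  become ultrametric. As the group is countable, a diagonal subsequence makes all these roots
  converge along one orbit, and no limit space or stationary measure has to be constructed. The
  commutator determinant leads back from a sequence of parameters to all t: a meromorphic function
  that is smaller than every power of |t| along a sequence tending to 0 has zero Laurent
  expansion.\<close>

lemma integral_bind_pmf_integrable: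
  fixes f :: "'a \<Rightarrow> real"
  assumes f: "integrable (measure_pmf (bind_pmf p q)) f"
  shows "(AE x in measure_pmf p. integrable (measure_pmf (q x)) f)" (is ?AE)
    and "integrable (measure_pmf p) (\<lambda>x. \<integral>y. f y \<partial>measure_pmf (q x))" (is ?int)
    and "(\<integral>y. f y \<partial>measure_pmf (bind_pmf p q)) = (\<integral>x. (\<integral>y. f y \<partial>measure_pmf (q x)) \<partial>measure_pmf p)" (is ?eq)
proof -
  \<comment> \<open>For nonnegative functions all three claims follow from the iterated integral in
    the extended reals, which needs no integrability in advance. The signed case splits
    \<open>f\<close> into \<open>?g\<close> and \<open>?h\<close>.\<close>
  have *: "(AE x in measure_pmf p. integrable (measure_pmf (q x)) f)
      \<and> integrable (measure_pmf p) (\<lambda>x. \<integral>y. f y \<partial>measure_pmf (q x))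
      \<and> (\<integral>y. f y \<partial>measure_pmf (bind_pmf p q)) = (\<integral>x. (\<integral>y. f y \<partial>measure_pmf (q x)) \<partial>measure_pmf p)" if nn: "\<And>x. f x \<ge> 0" and f: "integrable (measure_pmf (bind_pmf p q)) f" for f :: "'a \<Rightarrow> real"
  proof -
    have fin: "(\<integral>\<^sup>+x. (\<integral>\<^sup>+y. f y \<partial>q x) \<partial>p) < \<infinity>"
      using f nn unfolding integrable_iff_bounded by simp
    then have "AE x in measure_pmf p. (\<integral>\<^sup>+y. f y \<partial>q x) \<noteq> \<infinity>"
      by (intro nn_integral_noteq_infinite) auto
    then have 1: "AE x in measure_pmf p. integrable (measure_pmf (q x)) f"
      by (rule AE_mp) (auto intro!: AE_I2 simp: integrable_iff_bounded nn less_top)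
    then have 2: "AE x in measure_pmf p. (\<integral>\<^sup>+y. f y \<partial>q x) = ennreal (\<integral>y. f y \<partial>q x)"
      by (rule AE_mp) (auto intro!: AE_I2 nn_integral_eq_integral simp: nn)
    have 3: "(\<integral>\<^sup>+x. (\<integral>\<^sup>+y. f y \<partial>q x) \<partial>p) = (\<integral>\<^sup>+x. ennreal (\<integral>y. f y \<partial>q x) \<partial>p)"
      by (rule nn_integral_cong_AE[OF 2])
    have I: "integrable (measure_pmf p) (\<lambda>x. \<integral>y. f y \<partial>q x)"
      using fin unfolding 3 by (auto simp: integrable_iff_bounded nn)
    have "ennreal (\<integral>y. f y \<partial>bind_pmf p q) = ennreal (\<integral>x. (\<integral>y. f y \<partial>q x) \<partial>p)"
      using nn_integral_eq_integral[OF f] nn_integral_eq_integral[OF I] nn 3 by simp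
    then have "(\<integral>y. f y \<partial>bind_pmf p q) = (\<integral>x. (\<integral>y. f y \<partial>q x) \<partial>p)"
      by (subst (asm) ennreal_inj) (auto simp: nn)
    with 1 I show ?thesis by simp
  qed
  let ?g = "\<lambda>x. max 0 (f x)" and ?h = "\<lambda>x. max 0 (- f x)"
  have g: "integrable (measure_pmf (bind_pmf p q)) ?g" and h: "integrable (measure_pmf (bind_pmf p q)) ?h"
    using f by auto
  have fgh: "f = (\<lambda>x. ?g x - ?h x)" by auto
  note G = *[OF _ g, simplified] and H = *[OF _ h, simplified]
  have AEq: "AE x in measure_pmf p. (\<integral>y. f y \<partial>q x) = (\<integral>y. ?g y \<partial>q x) - (\<integral>y. ?h y \<partial>q x)"
    using conjunct1[OF G] conjunct1[OF H]
    by eventually_elim (subst fgh, rule Bochner_Integration.integral_diff)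
  show ?AE
    using conjunct1[OF G] conjunct1[OF H]
    by eventually_elim (subst fgh, rule Bochner_Integration.integrable_diff)
  show ?int
    by (rule integrable_cong_AE_imp[where g="\<lambda>x. (\<integral>y. ?g y \<partial>q x) - (\<integral>y. ?h y \<partial>q x)"])
       (use G H AEq in auto)
  have "(\<integral>y. f y \<partial>bind_pmf p q) = (\<integral>y. ?g y \<partial>bind_pmf p q) - (\<integral>y. ?h y \<partial>bind_pmf p q)"
    by (subst fgh, rule Bochner_Integration.integral_diff) (use g h in auto)
  also have "\<dots> = (\<integral>x. (\<integral>y. ?g y \<partial>q x) - (\<integral>y. ?h y \<partial>q x) \<partial>p)"
    using G H by simp
  also have "\<dots> = (\<integral>x. (\<integral>y. f y \<partial>q x) \<partial>p)"
    by (rule integral_cong_AE) (use AEq in auto)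
  finally show ?eq .
qed

text \<open>Fekete's lemma. That the limit is an infimum matters later: the bound at each finite n
  drives the upper estimate of the exponent.\<close>

lemma subadditive_ratio_tendsto:
  fixes a :: "nat \<Rightarrow> real"
  assumes sub: "\<And>m n. a (m + n) \<le> a m + a n" and nn: "\<And>n. a n \<ge> 0"
  obtains l where "(\<lambda>n. a n / real n) \<longlonglongrightarrow> l" "l \<ge> 0" "\<And>n. n \<ge> 1 \<Longrightarrow> l \<le> a n / real n"
proof -
  define l where "l = (INF n\<in>{1..}. a n / real n)"
  have bdd: "bdd_below ((\<lambda>n. a n / real n) ` {1..})"
    by (rule bdd_belowI2[where m=0]) (simp add: nn)
  have le: "l \<le> a n / real n" if "n \<ge> 1" for n
    unfolding l_def by (rule cINF_lower[OF bdd]) (use that in auto)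
  have l0: "l \<ge> 0" unfolding l_def by (rule cINF_greatest) (auto simp: nn)
  have mult: "a (q * k + r) \<le> real q * a k + a r" for q k r
  proof (induction q)
    case (Suc q)
    have "a (Suc q * k + r) \<le> a k + a (q * k + r)"
      using sub[of k "q * k + r"] by (simp add: add_ac)
    with Suc show ?case by (simp add: algebra_simps)
  qed simp
  have "(\<lambda>n. a n / real n) \<longlonglongrightarrow> l"
  proof (rule order_tendstoI)
    fix y assume "y < l"
    then show "\<forall>\<^sub>F n in sequentially. y < a n / real n"
      using le by (intro eventually_sequentiallyI[of 1]) (auto intro: less_le_trans)
  next
    fix y assume "l < y"
    then obtain k where k: "k \<ge> 1" "a k / real k < y"
      unfolding l_def using cINF_less_iff[OF _ bdd, of y] by auto
    define C where "C = (\<Sum>r<k. a r)"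
    have C: "a r \<le> C" if "r < k" for r
      unfolding C_def by (rule member_le_sum) (use that nn in auto)
    have bound: "a n / real n \<le> a k / real k + C / real n" if "n \<ge> 1" for n
    proof -
      have "a n \<le> real (n div k) * a k + a (n mod k)"
        using mult[of "n div k" k "n mod k"] by simp
      moreover have "real (n div k) \<le> real n / real k"
        by (metis floor_divide_of_nat_eq of_int_floor_le of_int_of_nat_eq)
      then have "real (n div k) * a k + a (n mod k) \<le> (real n / real k) * a k + C"
        using k nn by (intro add_mono mult_right_mono C) auto
      ultimately have "a n \<le> (real n / real k) * a k + C" by linarith
      then show ?thesis using that k by (simp add: field_simps)
    qed
    have "(\<lambda>n. a k / real k + C / real n) \<longlonglongrightarrow> a k / real k + 0"
      by (intro tendsto_intros lim_const_over_n)
    then have "\<forall>\<^sub>F n in sequentially. a k / real k + C / real n < y"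
      using k by (intro order_tendstoD) auto
    then show "\<forall>\<^sub>F n in sequentially. a n / real n < y"
      using eventually_ge_at_top[of 1]
      by eventually_elim (use bound in force)
  qed
  with that le l0 show thesis by blast
qed

text \<open>The weight \<open>b\<close> will be a multiple of the word length plus 1. The lower
  bound 1 makes constants multiples of \<open>b\<close>, so one weight controls all
  integrands.\<close>

locale weighted_walk = group G for G :: "('a, 'b) monoid_scheme" (structure) +
  fixes m :: "'a pmf" and b :: "'a \<Rightarrow> real"
  assumes supp: "set_pmf m \<subseteq> carrier G"
    and b_ge1: "\<And>g. g \<in> carrier G \<Longrightarrow> 1 \<le> b g"
    and b_mult: "\<And>g h. g \<in> carrier G \<Longrightarrow> h \<in> carrier G \<Longrightarrow> b (g \<otimes> h) \<le> b g + b h"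
    and b_int: "integrable (measure_pmf m) b"
begin

abbreviation E :: "nat \<Rightarrow> ('a \<Rightarrow> real) \<Rightarrow> real" where
  "E n f \<equiv> measure_pmf.expectation (conv_pow G m n) f"

text \<open>The integrands are unbounded. This class is closed under linear operations and
  translations and integrable for every convolution power, so it carries all integrability
  obligations.\<close>

definition dominated :: "('a \<Rightarrow> real) \<Rightarrow> bool" where
  "dominated f \<longleftrightarrow> (\<exists>c. \<forall>g\<in>carrier G. \<bar>f g\<bar> \<le> c * b g)"

lemma set_conv_pow: "set_pmf (conv_pow G m n) \<subseteq> carrier G"
  using supp by (induction n) auto

lemma conv_pow_add:
  "conv_pow G m (n + k) = bind_pmf (conv_pow G m n) (\<lambda>g. map_pmf (\<lambda>h. h \<otimes> g) (conv_pow G m k))"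
proof (induction k)
  case 0
  have "bind_pmf (conv_pow G m n) (\<lambda>g. return_pmf (\<one> \<otimes> g)) = bind_pmf (conv_pow G m n) return_pmf"
    by (intro bind_pmf_cong refl arg_cong[where f=return_pmf] l_one) (use set_conv_pow in blast)
  then show ?case by (simp add: bind_return_pmf')
next
  case (Suc k)
  show ?case
    unfolding add_Suc_right conv_pow.simps Suc bind_assoc_pmf bind_map_pmf map_bind_pmf map_pmf_comp
    by (intro bind_pmf_cong map_pmf_cong refl m_assoc[symmetric]) (use set_conv_pow supp in blast)+
qed

lemma conv_pow_1: "conv_pow G m 1 = m"
proof -
  have "map_pmf (\<lambda>g. g \<otimes> \<one>) m = map_pmf (\<lambda>g. g) m"
    by (intro map_pmf_cong refl) (use supp in auto)
  then show ?thesis by (simp add: bind_return_pmf)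
qed

declare conv_pow.simps(2) [simp del]

lemma dominated_b: "dominated b"
  unfolding dominated_def by (intro exI[of _ 1]) (use b_ge1 in fastforce)

lemma dominatedE:
  assumes "dominated f"
  obtains c where "c \<ge> 0" "\<And>g. g \<in> carrier G \<Longrightarrow> \<bar>f g\<bar> \<le> c * b g"
proof -
  obtain c where "\<And>g. g \<in> carrier G \<Longrightarrow> \<bar>f g\<bar> \<le> c * b g"
    using assms by (auto simp: dominated_def)
  moreover have "c \<ge> 0"
    using calculation[OF one_closed] b_ge1[OF one_closed] by (smt (verit) mult_neg_pos)
  ultimately show thesis using that by blast
qed

lemma dominatedI: "(\<And>g. g \<in> carrier G \<Longrightarrow> \<bar>f g\<bar> \<le> c * b g) \<Longrightarrow> dominated f"
  by (auto simp: dominated_def)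

lemma dominated_const: "dominated (\<lambda>_. c)"
  by (rule dominatedI[of _ "\<bar>c\<bar>"]) (metis abs_ge_zero b_ge1 mult_left_mono mult.right_neutral)

lemma dominated_add: 
  assumes "dominated f" "dominated h" shows "dominated (\<lambda>g. f g + h g)"
proof -
  obtain c d where "\<And>g. g \<in> carrier G \<Longrightarrow> \<bar>f g\<bar> \<le> c * b g" "\<And>g. g \<in> carrier G \<Longrightarrow> \<bar>h g\<bar> \<le> d * b g"
    using assms by (auto simp: dominated_def)
  then show ?thesis by (intro dominatedI[of _ "c + d"]) (force simp: algebra_simps)
qed

lemma dominated_cmult: 
  assumes "dominated f" shows "dominated (\<lambda>g. c * f g)"
proof -
  obtain d where "\<And>g. g \<in> carrier G \<Longrightarrow> \<bar>f g\<bar> \<le> d * b g"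
    using assms by (auto simp: dominated_def)
  then show ?thesis 
    by (intro dominatedI[of _ "\<bar>c\<bar> * d"]) (simp add: abs_mult mult_left_mono mult.assoc)
qed

lemma dominated_minus: "dominated f \<Longrightarrow> dominated (\<lambda>g. - f g)"
  by (auto simp: dominated_def)

lemma dominated_diff: "dominated f \<Longrightarrow> dominated h \<Longrightarrow> dominated (\<lambda>g. f g - h g)"
  using dominated_add[OF _ dominated_minus] by simp

lemma dominated_le:
  assumes "dominated h" "\<And>g. g \<in> carrier G \<Longrightarrow> \<bar>f g\<bar> \<le> h g" shows "dominated f"
  using assms unfolding dominated_def by (meson abs_ge_self order_trans)

lemma dominated_abs: "dominated f \<Longrightarrow> dominated (\<lambda>g. \<bar>f g\<bar>)"
  by (auto simp: dominated_def)

lemma dominated_translate: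
  assumes f: "dominated f" and x: "x \<in> carrier G"
  shows "dominated (\<lambda>g. f (g \<otimes> x))" "dominated (\<lambda>g. f (x \<otimes> g))"
proof -
  obtain c where c: "c \<ge> 0" "\<And>g. g \<in> carrier G \<Longrightarrow> \<bar>f g\<bar> \<le> c * b g"
    using dominatedE[OF f] by metis
  \<comment> \<open>As both weights are at least 1, the summand \<open>b x\<close> can be absorbed
    into a factor.\<close>
  have bound: "c * b k \<le> c * (1 + b x) * b g" if "g \<in> carrier G" "b k \<le> b g + b x" for g k
  proof -
    have "b g + b x \<le> (1 + b x) * b g"
      using b_ge1[OF that(1)] b_ge1[OF x] mult_left_mono[of 1 "b g" "b x"] by (simp add: algebra_simps)
    then show ?thesis using c that by (simp add: mult.assoc mult_left_mono)
  qed
  have *: "\<bar>f k\<bar> \<le> c * (1 + b x) * b g" if "g \<in> carrier G" "b k \<le> b g + b x" "k \<in> carrier G" for g k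
    using bound[OF that(1,2)] c(2)[OF that(3)] by linarith
  show "dominated (\<lambda>g. f (g \<otimes> x))"
    by (rule dominatedI[of _ "c * (1 + b x)"], rule *) (use b_mult x in auto)
  show "dominated (\<lambda>g. f (x \<otimes> g))"
    by (rule dominatedI[of _ "c * (1 + b x)"], rule *) (use b_mult x in \<open>auto simp: add.commute[of _ "b x"]\<close>)
qed

lemma integrable_b: "integrable (measure_pmf (conv_pow G m n)) b"
proof (induction n)
  case 0
  then show ?case by (simp add: integrable_measure_pmf_finite)
next
  case (Suc n)
  let ?p = "conv_pow G m n"
  have "(\<integral>\<^sup>+x. ennreal (norm (b x)) \<partial>conv_pow G m (Suc n)) = (\<integral>\<^sup>+h. (\<integral>\<^sup>+g. ennreal (norm (b (g \<otimes> h))) \<partial>m) \<partial>?p)"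
    by (simp add: conv_pow.simps(2))
  also have "\<dots> \<le> (\<integral>\<^sup>+h. (\<integral>\<^sup>+g. ennreal (norm (b g)) + ennreal (norm (b h)) \<partial>m) \<partial>?p)"
  proof (intro nn_integral_mono_AE AE_pmfI)
    fix h g assume "h \<in> set_pmf ?p" "g \<in> set_pmf m"
    then have "h \<in> carrier G" "g \<in> carrier G" using set_conv_pow supp by auto
    then have "norm (b (g \<otimes> h)) \<le> norm (b g) + norm (b h)"
      using b_mult[of g h] b_ge1[of g] b_ge1[of h] b_ge1[of "g \<otimes> h"] by simp
    then show "ennreal (norm (b (g \<otimes> h))) \<le> ennreal (norm (b g)) + ennreal (norm (b h))"
      by (simp flip: ennreal_plus)
  qed
  also have "\<dots> = (\<integral>\<^sup>+g. ennreal (norm (b g)) \<partial>m) + (\<integral>\<^sup>+h. ennreal (norm (b h)) \<partial>?p)"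
    by (simp add: nn_integral_add)
  also have "\<dots> < \<infinity>"
    using Suc b_int by (simp add: integrable_iff_bounded)
  finally show ?case by (simp add: integrable_iff_bounded)
qed

lemma integrable_dominated:
  assumes "dominated f" shows "integrable (measure_pmf (conv_pow G m n)) f"
proof -
  obtain c where c: "c \<ge> 0" "\<And>g. g \<in> carrier G \<Longrightarrow> \<bar>f g\<bar> \<le> c * b g"
    using dominatedE[OF assms] by metis
  show ?thesis
  proof (rule Bochner_Integration.integrable_bound[where f="\<lambda>g. c * b g"])
    show "AE g in measure_pmf (conv_pow G m n). norm (f g) \<le> norm (c * b g)"
      by (rule AE_pmfI) (use c(2) set_conv_pow[of n] in force)
  qed (use integrable_b in auto)
qed

lemma E_cong: "(\<And>g. g \<in> carrier G \<Longrightarrow> f g = h g) \<Longrightarrow> E n f = E n h"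
  by (rule integral_cong_AE) (use set_conv_pow in \<open>auto intro!: AE_pmfI\<close>)

lemma E_mono: 
  assumes "dominated f" "dominated h" "\<And>g. g \<in> carrier G \<Longrightarrow> f g \<le> h g" 
  shows "E n f \<le> E n h"
  by (rule integral_mono_AE) (use assms set_conv_pow integrable_dominated in \<open>auto intro!: AE_pmfI\<close>)

lemma E_nonneg: "(\<And>g. g \<in> carrier G \<Longrightarrow> 0 \<le> f g) \<Longrightarrow> 0 \<le> E n f"
  by (rule integral_nonneg_AE) (use set_conv_pow in \<open>auto intro!: AE_pmfI\<close>)

lemma E_plus: "dominated f \<Longrightarrow> dominated h \<Longrightarrow> E n (\<lambda>g. f g + h g) = E n f + E n h"
  by (rule Bochner_Integration.integral_add) (auto intro: integrable_dominated)

lemma E_diff: "dominated f \<Longrightarrow> dominated h \<Longrightarrow> E n (\<lambda>g. f g - h g) = E n f - E n h"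
  by (rule Bochner_Integration.integral_diff) (auto intro: integrable_dominated)

lemma E_sum: "(\<And>i. i \<in> T \<Longrightarrow> dominated (f i)) \<Longrightarrow> E n (\<lambda>g. \<Sum>i\<in>T. f i g) = (\<Sum>i\<in>T. E n (f i))"
  by (rule Bochner_Integration.integral_sum) (auto intro: integrable_dominated)

lemma E_abs: "\<bar>E n f\<bar> \<le> E n (\<lambda>g. \<bar>f g\<bar>)"
  by (rule integral_abs_bound)

lemma E_const: "E n (\<lambda>_. c) = c" by simp

text \<open>The walk runs by left multiplication, so that \<open>g\<close> is the product of the first \<open>n\<close> steps.\<close>
lemma E_add: 
  assumes "dominated f"
  shows "E (n + k) f = E n (\<lambda>g. E k (\<lambda>h. f (h \<otimes> g)))"
    and "integrable (measure_pmf (conv_pow G m n)) (\<lambda>g. E k (\<lambda>h. f (h \<otimes> g)))"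
  using integral_bind_pmf_integrable(2,3)[OF integrable_dominated[OF assms, of "n + k", unfolded conv_pow_add]]
  unfolding conv_pow_add by simp_all

text \<open>The form in which drift estimates are iterated: a bound on the next \<open>k\<close>
  steps that holds at each position \<open>g\<close> integrates to a bound for n + k steps.\<close>

lemma E_add_le:
  assumes f: "dominated f" and F: "dominated F" and le: "\<And>g. g \<in> carrier G \<Longrightarrow> E k (\<lambda>h. f (h \<otimes> g)) \<le> F g"
  shows "E (n + k) f \<le> E n F"
  unfolding E_add(1)[OF f]
proof (rule integral_mono_AE)
  show "AE g in measure_pmf (conv_pow G m n). E k (\<lambda>h. f (h \<otimes> g)) \<le> F g"
    by (rule AE_pmfI) (use le set_conv_pow in blast)
qed (use E_add(2)[OF f] F integrable_dominated in auto)

lemma E_subadditive: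
  assumes "dominated f" "\<And>g h. g \<in> carrier G \<Longrightarrow> h \<in> carrier G \<Longrightarrow> f (h \<otimes> g) \<le> f h + f g"
  shows "E (n + k) f \<le> E n f + E k f"
proof -
  have "E (n + k) f \<le> E n (\<lambda>g. E k f + f g)"
  proof (rule E_add_le)
    fix g assume g: "g \<in> carrier G"
    have "E k (\<lambda>h. f (h \<otimes> g)) \<le> E k (\<lambda>h. f h + f g)"
      by (rule E_mono) (use g assms dominated_translate dominated_add dominated_const in auto)
    then show "E k (\<lambda>h. f (h \<otimes> g)) \<le> E k f + f g"
      by (simp add: E_plus assms dominated_const)
  qed (use assms dominated_add dominated_const in auto)
  then show ?thesis by (simp add: E_plus assms dominated_const)
qed

lemma E_additive:
  assumes f: "dominated f" and "\<And>g h. g \<in> carrier G \<Longrightarrow> h \<in> carrier G \<Longrightarrow> f (h \<otimes> g) = f h + f g"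
  shows "E n f = real n * E 1 f"
proof (induction n)
  case 0
  show ?case using assms(2)[of \<one> \<one>] by simp
next
  case (Suc n)
  have "E (n + 1) f = E n (\<lambda>g. E 1 (\<lambda>h. f (h \<otimes> g)))"
    by (rule E_add(1)[OF f])
  also have "\<dots> = E n (\<lambda>g. E 1 f + f g)"
  proof (rule E_cong)
    fix g assume g: "g \<in> carrier G"
    have "E 1 (\<lambda>h. f (h \<otimes> g)) = E 1 (\<lambda>h. f h + f g)"
      by (rule E_cong) (use g assms in auto)
    then show "E 1 (\<lambda>h. f (h \<otimes> g)) = E 1 f + f g"
      by (simp only: E_plus[OF f dominated_const] E_const)
  qed
  also have "\<dots> = E 1 f + E n f"
    by (simp only: E_plus[OF dominated_const f] E_const)
  finally show ?case using Suc by (simp add: algebra_simps)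
qed

lemma E_ratio_tendsto:
  assumes "dominated f" "\<And>g h. g \<in> carrier G \<Longrightarrow> h \<in> carrier G \<Longrightarrow> f (h \<otimes> g) \<le> f h + f g"
    and "\<And>g. g \<in> carrier G \<Longrightarrow> 0 \<le> f g"
  obtains l where "(\<lambda>n. E n f / real n) \<longlonglongrightarrow> l" "l \<ge> 0" "\<And>n. n \<ge> 1 \<Longrightarrow> l \<le> E n f / real n"
  by (rule subadditive_ratio_tendsto[of "\<lambda>n. E n f"])
     (rule E_subadditive[OF assms(1,2)] E_nonneg[OF assms(3)] that; assumption)+

lemma E_dominated_convergence:
  assumes "dominated F" "\<And>g j. g \<in> carrier G \<Longrightarrow> \<bar>f j g\<bar> \<le> F g"
    and "\<And>g. g \<in> carrier G \<Longrightarrow> (\<lambda>j. f j g) \<longlonglongrightarrow> f' g"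
  shows "(\<lambda>j. E n (f j)) \<longlonglongrightarrow> E n f'"
proof (rule integral_dominated_convergence[where w=F])
  show "AE g in measure_pmf (conv_pow G m n). (\<lambda>j. f j g) \<longlonglongrightarrow> f' g"
    by (rule AE_pmfI) (use assms(3) set_conv_pow in blast)
  show "AE g in measure_pmf (conv_pow G m n). norm (f j g) \<le> F g" for j
    by (rule AE_pmfI) (use assms(2) set_conv_pow in auto)
qed (use assms integrable_dominated in auto)

end

section \<open>Drift estimates\<close>

text \<open>A smooth substitute for the absolute value, within distance \<open>R\<close> of it; its
  derivative is \<open>soft_sgn R\<close> and its second derivative is at most 1/R, so drift can be
  read off a first-order expansion.\<close>

definition soft_abs :: "real \<Rightarrow> real \<Rightarrow> real" where
  "soft_abs R x = sqrt (R\<^sup>2 + x\<^sup>2)"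

definition soft_sgn :: "real \<Rightarrow> real \<Rightarrow> real" where
  "soft_sgn R x = x / soft_abs R x"

text \<open>The second-order error at smoothing scale \<open>R\<close>. It is dominated by the first moment, and its expectation
  vanishes as \<open>R \<rightarrow> \<infinity>\<close>; this replaces second moments in the drift estimates.\<close>
definition soft_err :: "real \<Rightarrow> real \<Rightarrow> real" where
  "soft_err R y = min (y\<^sup>2 / R) (2 * \<bar>y\<bar>)"

context
  fixes R :: real
  assumes R: "R > 0"
begin

lemma soft_abs_ge: "R \<le> soft_abs R x" "\<bar>x\<bar> \<le> soft_abs R x"
  using R by (auto simp: soft_abs_def intro!: real_le_rsqrt)

lemma soft_abs_pos: "soft_abs R x > 0"
  using soft_abs_ge(1)[of x] R by linarith

lemma soft_abs_le: "soft_abs R x \<le> R + \<bar>x\<bar>"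
  unfolding soft_abs_def by (rule real_le_lsqrt) (use R in \<open>auto simp: power2_eq_square algebra_simps\<close>)

lemma soft_abs_uminus: "soft_abs R (- x) = soft_abs R x"
  by (simp add: soft_abs_def)

lemma soft_abs_mono: "0 \<le> x \<Longrightarrow> x \<le> y \<Longrightarrow> soft_abs R x \<le> soft_abs R y"
  by (simp add: soft_abs_def power_mono)

lemma soft_sgn_uminus: "soft_sgn R (- x) = - soft_sgn R x"
  by (simp add: soft_sgn_def soft_abs_def)

lemma abs_soft_sgn_le_1: "\<bar>soft_sgn R x\<bar> \<le> 1"
  using soft_abs_ge(2)[of x] soft_abs_pos[of x] by (simp add: soft_sgn_def abs_div)

lemma abs_soft_sgn_le: "\<bar>soft_sgn R x\<bar> \<le> \<bar>x\<bar> / R"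
  using soft_abs_ge(1)[of x] soft_abs_pos[of x] R 
  by (simp add: soft_sgn_def abs_div frac_le)

lemma soft_abs_Lipschitz: "\<bar>soft_abs R (x + y) - soft_abs R x\<bar> \<le> \<bar>y\<bar>"
proof -
  have "soft_abs R (x + y) \<le> soft_abs R x + \<bar>y\<bar>" for x y
    unfolding soft_abs_def
  proof (rule real_le_lsqrt)
    have "\<bar>x\<bar> * \<bar>y\<bar> \<le> sqrt (R\<^sup>2 + x\<^sup>2) * \<bar>y\<bar>"
      using soft_abs_ge(2)[of x] by (intro mult_right_mono) (auto simp: soft_abs_def)
    moreover have "x * y \<le> \<bar>x\<bar> * \<bar>y\<bar>" by (metis abs_ge_self abs_mult)
    ultimately show "R\<^sup>2 + (x + y)\<^sup>2 \<le> (sqrt (R\<^sup>2 + x\<^sup>2) + \<bar>y\<bar>)\<^sup>2"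
      by (simp add: power2_sum)
  qed simp
  from this[of x y] this[of "x + y" "- y"] show ?thesis by simp
qed

text \<open>Two bounds on the second-order error are combined: expanding a square gives the
  quadratic one for small increments, Lipschitz continuity the linear one for large
  increments.\<close>

lemma soft_abs_add_le: "soft_abs R (x + y) \<le> soft_abs R x + soft_sgn R x * y + soft_err R y"
proof -
  let ?f = "soft_abs R x"
  have f: "?f > 0" "R \<le> ?f" using soft_abs_pos soft_abs_ge by auto
  have sq: "?f\<^sup>2 = R\<^sup>2 + x\<^sup>2" by (simp add: soft_abs_def)
  have "0 \<le> (soft_abs R (x + y) - ?f)\<^sup>2" by simp
  then have "2 * ?f * soft_abs R (x + y) \<le> ?f\<^sup>2 + (R\<^sup>2 + (x + y)\<^sup>2)"
    by (simp add: power2_diff) (simp add: soft_abs_def ac_simps)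
  also have "\<dots> = 2 * ?f\<^sup>2 + 2 * x * y + y\<^sup>2"
    by (simp add: sq power2_sum)
  finally have "soft_abs R (x + y) \<le> ?f + x / ?f * y + y\<^sup>2 / (2 * ?f)"
    using f by (simp add: field_simps power2_eq_square)
  moreover have "y\<^sup>2 / (2 * ?f) \<le> y\<^sup>2 / R"
    using f R by (intro frac_le) auto
  ultimately have 1: "soft_abs R (x + y) \<le> ?f + soft_sgn R x * y + y\<^sup>2 / R"
    by (simp add: soft_sgn_def)
  have "\<bar>soft_sgn R x * y\<bar> \<le> \<bar>y\<bar>"
    using abs_soft_sgn_le_1[of x] by (simp add: abs_mult mult_left_le_one_le)
  with soft_abs_Lipschitz[of x y] have "soft_abs R (x + y) \<le> ?f + soft_sgn R x * y + 2 * \<bar>y\<bar>"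
    by linarith
  with 1 show ?thesis by (simp add: soft_err_def)
qed

lemma soft_sgn_Lipschitz: "\<bar>soft_sgn R (x + y) - soft_sgn R x\<bar> \<le> 2 * \<bar>y\<bar> / R"
proof -
  let ?f = "soft_abs R x" and ?g = "soft_abs R (x + y)"
  have f: "?f > 0" "R \<le> ?f" "\<bar>x\<bar> \<le> ?f" and g: "?g > 0" "R \<le> ?g" using soft_abs_pos soft_abs_ge by auto
  have "soft_sgn R (x + y) - soft_sgn R x = y / ?g + (x / ?f) * ((?f - ?g) / ?g)"
    using f g by (simp add: soft_sgn_def field_simps)
  also have "\<bar>\<dots>\<bar> \<le> \<bar>y / ?g\<bar> + \<bar>x / ?f\<bar> * \<bar>(?f - ?g) / ?g\<bar>"
    by (metis abs_mult abs_triangle_ineq)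
  also have "\<dots> \<le> \<bar>y\<bar> / R + 1 * (\<bar>y\<bar> / R)"
    using f g R soft_abs_Lipschitz[of x y]
    by (intro add_mono mult_mono) (auto simp: abs_div intro!: frac_le)
  finally show ?thesis by simp
qed

lemma soft_err_bounds: "0 \<le> soft_err R y" "soft_err R y \<le> 2 * \<bar>y\<bar>"
  using R by (auto simp: soft_err_def)

lemma soft_err_mono: "\<bar>x\<bar> \<le> \<bar>y\<bar> \<Longrightarrow> soft_err R x \<le> soft_err R y"
  unfolding soft_err_def using R by (intro min.mono divide_right_mono) (auto simp: abs_le_square_iff)

end

lemma soft_err_tendsto_0: "(\<lambda>j. soft_err (real (Suc j)) y) \<longlonglongrightarrow> 0"
proof (rule tendsto_sandwich[where f="\<lambda>_. 0" and h="\<lambda>j. y\<^sup>2 / real (Suc j)"])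
  show "(\<lambda>j. y\<^sup>2 / real (Suc j)) \<longlonglongrightarrow> 0"
    by (rule LIMSEQ_Suc[OF lim_const_over_n])
  show "\<forall>\<^sub>F j in sequentially. 0 \<le> soft_err (real (Suc j)) y"
    by (rule always_eventually) (simp add: soft_err_bounds del: of_nat_Suc)
  show "\<forall>\<^sub>F j in sequentially. soft_err (real (Suc j)) y \<le> y\<^sup>2 / real (Suc j)"
    by (rule always_eventually) (simp add: soft_err_def del: of_nat_Suc)
qed (rule tendsto_const)

context weighted_walk
begin

lemma dominated_soft_abs: "R > 0 \<Longrightarrow> dominated f \<Longrightarrow> dominated (\<lambda>g. soft_abs R (f g))"
  by (rule dominated_le[of "\<lambda>g. R + \<bar>f g\<bar>"])
     (auto intro!: dominated_add dominated_const dominated_abs simp: abs_of_pos soft_abs_pos soft_abs_le)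

lemma dominated_soft_err: "R > 0 \<Longrightarrow> dominated f \<Longrightarrow> dominated (\<lambda>g. soft_err R (f g))"
  by (rule dominated_le[of "\<lambda>g. 2 * \<bar>f g\<bar>"])
     (auto intro!: dominated_cmult dominated_abs simp: soft_err_bounds)

lemma dominated_soft_sgn: "R > 0 \<Longrightarrow> dominated (\<lambda>g. soft_sgn R (f g))"
  by (rule dominated_le[of "\<lambda>g. 1"]) (auto intro!: dominated_const abs_soft_sgn_le_1)

lemma E_soft_err_small:
  assumes "dominated f" "e > 0"
  obtains R where "R > 0" "E 1 (\<lambda>g. soft_err R (f g)) < e"
proof -
  have "(\<lambda>j. E 1 (\<lambda>g. soft_err (real (Suc j)) (f g))) \<longlonglongrightarrow> E 1 (\<lambda>g. 0)"
    by (rule E_dominated_convergence[of "\<lambda>g. 2 * \<bar>f g\<bar>"])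
       (use assms in \<open>auto intro!: dominated_cmult dominated_abs soft_err_tendsto_0 simp: soft_err_bounds abs_of_nonneg simp del: of_nat_Suc\<close>)
  then have "\<forall>\<^sub>F j in sequentially. E 1 (\<lambda>g. soft_err (real (Suc j)) (f g)) < e"
    using assms by (intro order_tendstoD(2)) auto
  then obtain j where "E 1 (\<lambda>g. soft_err (real (Suc j)) (f g)) < e"
    by (auto simp: eventually_sequentially)
  then show thesis by (intro that[of "real (Suc j)"]) auto
qed

text \<open>A Lindley-type recursion: \<open>D\<close> behaves like a reflected random walk with increments \<open>2 \<phi>\<close>.\<close>
lemma lindley_drift:
  assumes \<phi>: "dominated \<phi>" and D: "dominated D" and D0: "\<And>g. g \<in> carrier G \<Longrightarrow> 0 \<le> D g"
    and rec: "\<And>g h. g \<in> carrier G \<Longrightarrow> h \<in> carrier G \<Longrightarrow> D (h \<otimes> g) \<le> max (D g + 2 * \<phi> h) (D h)"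
    and e: "e > 0"
  obtains C where "\<And>n. E n D \<le> C + real n * (max 0 (2 * E 1 \<phi>) + e)"
proof -
  \<comment> \<open>\<open>q\<close> dominates both the increment and the value after a reset, so
    one error term serves both branches of the maximum.\<close>
  define q where "q h = D h + 2 * \<bar>\<phi> h\<bar>" for h
  have q: "dominated q"
    unfolding q_def by (intro dominated_add dominated_cmult dominated_abs \<phi> D)
  \<comment> \<open>Half of \<open>e\<close>, because the error is paid twice in
    \<open>step\<close>.\<close>
  obtain R where R: "R > 0" "E 1 (\<lambda>g. soft_err R (q g)) < e / 2"
    using E_soft_err_small[OF q, of "e / 2"] e by auto
  let ?f = "soft_abs R" and ?s = "soft_sgn R" and ?\<eta> = "\<lambda>h. soft_err R (q h)"
  have step: "?f (D (h \<otimes> g)) \<le> ?f (D g) + ?s (D g) * (2 * \<phi> h) + 2 * ?\<eta> h"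
    if g: "g \<in> carrier G" and h: "h \<in> carrier G" for g h
  proof -
    have q0: "0 \<le> q h" using D0[OF h] by (simp add: q_def)
    have \<eta>0: "0 \<le> ?\<eta> h" using soft_err_bounds R by auto
    show ?thesis
    proof (cases "D (h \<otimes> g) \<le> D g + 2 * \<phi> h")
      case True
      then have "?f (D (h \<otimes> g)) \<le> ?f (D g + 2 * \<phi> h)"
        using D0 g h R by (intro soft_abs_mono) auto
      also have "\<dots> \<le> ?f (D g) + ?s (D g) * (2 * \<phi> h) + soft_err R (2 * \<phi> h)"
        by (rule soft_abs_add_le[OF R(1)])
      also have "soft_err R (2 * \<phi> h) \<le> ?\<eta> h"
        by (rule soft_err_mono[OF R(1)]) (use D0[OF h] in \<open>auto simp: q_def\<close>)
      finally show ?thesis using \<eta>0 by linarith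
    next
      \<comment> \<open>Reset branch: \<open>D g\<close> is at most \<open>q h\<close>, so the sign
        term at \<open>D g\<close> is at most \<open>q h / R\<close> and the linear term is itself
        no larger than the error. Reinstating it costs the second copy of the error.\<close>
      case False
      with rec[OF g h] have le: "D (h \<otimes> g) \<le> D h" and lt: "D g + 2 * \<phi> h \<le> D h" by linarith+
      have Dg: "0 \<le> D g" "D g \<le> q h" using D0[OF g] lt by (auto simp: q_def)
      have "?f (D (h \<otimes> g)) \<le> ?f (q h)"
        using le D0[OF m_closed[OF h g]] R by (intro soft_abs_mono) (auto simp: q_def)
      also have "?f (q h) \<le> ?f 0 + ?\<eta> h"
        using soft_abs_add_le[OF R(1), of 0 "q h"] by (simp add: soft_sgn_def)
      also have "?f 0 \<le> ?f (D g)" using Dg R by (intro soft_abs_mono) auto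
      finally have 1: "?f (D (h \<otimes> g)) \<le> ?f (D g) + ?\<eta> h" by simp
      have "D g / R \<le> q h / R" using Dg R by (simp add: divide_right_mono)
      then have "\<bar>?s (D g)\<bar> \<le> q h / R" "\<bar>?s (D g)\<bar> \<le> 1"
        using abs_soft_sgn_le[OF R(1), of "D g"] abs_soft_sgn_le_1[OF R(1)] Dg by auto
      moreover have "\<bar>2 * \<phi> h\<bar> \<le> q h" using D0[OF h] by (simp add: q_def)
      ultimately have "\<bar>?s (D g)\<bar> * \<bar>2 * \<phi> h\<bar> \<le> q h / R * q h" "\<bar>?s (D g)\<bar> * \<bar>2 * \<phi> h\<bar> \<le> 1 * q h"
        using q0 R by (intro mult_mono; simp)+
      then have "\<bar>?s (D g) * (2 * \<phi> h)\<bar> \<le> ?\<eta> h"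
        using q0 by (simp add: soft_err_def abs_mult power2_eq_square)
      with 1 show ?thesis by linarith
    qed
  qed
  define \<kappa> where "\<kappa> = max 0 (2 * E 1 \<phi>) + e"
  have fD: "dominated (\<lambda>g. ?f (D g))" using dominated_soft_abs R D by blast
  have dn: "dominated ?\<eta>" using dominated_soft_err[OF R(1) q] .
  have ind: "E n (\<lambda>g. ?f (D g)) \<le> ?f (D \<one>) + real n * \<kappa>" for n
  proof (induction n)
    case (Suc n)
    have "E (n + 1) (\<lambda>g. ?f (D g)) \<le> E n (\<lambda>g. ?f (D g) + \<kappa>)"
    proof (rule E_add_le)
      fix g assume g: "g \<in> carrier G"
      have "E 1 (\<lambda>h. ?f (D (h \<otimes> g))) \<le> E 1 (\<lambda>h. ?f (D g) + ?s (D g) * (2 * \<phi> h) + 2 * ?\<eta> h)"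
        by (rule E_mono) (use step g fD dn \<phi> dominated_translate(1)[OF fD g] in \<open>auto intro!: dominated_add dominated_cmult dominated_const\<close>)
      also have "\<dots> = ?f (D g) + ?s (D g) * (2 * E 1 \<phi>) + 2 * E 1 ?\<eta>"
        by (subst E_plus, (intro dominated_add dominated_cmult dominated_const \<phi> dn)+,
            subst E_plus, (intro dominated_add dominated_cmult dominated_const \<phi> dn)+) (simp del: One_nat_def)
      \<comment> \<open>\<open>soft_sgn\<close> lies between 0 and 1 on nonnegative arguments, so
        only the positive part of the mean counts.\<close>
      also have "?s (D g) * (2 * E 1 \<phi>) \<le> max 0 (2 * E 1 \<phi>)"
      proof -
        have "0 \<le> ?s (D g)" "?s (D g) \<le> 1"
          using D0[OF g] soft_abs_pos[OF R(1), of "D g"] abs_soft_sgn_le_1[OF R(1), of "D g"]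
          by (auto simp: soft_sgn_def)
        then have "?s (D g) * (2 * E 1 \<phi>) \<le> ?s (D g) * max 0 (2 * E 1 \<phi>)"
          and "?s (D g) * max 0 (2 * E 1 \<phi>) \<le> 1 * max 0 (2 * E 1 \<phi>)"
          by (intro mult_left_mono mult_right_mono; simp)+
        then show ?thesis by linarith
      qed
      finally show "E 1 (\<lambda>h. ?f (D (h \<otimes> g))) \<le> ?f (D g) + \<kappa>"
        using R(2) unfolding \<kappa>_def by linarith
    qed (auto intro!: fD dominated_add dominated_const)
    also have "\<dots> = E n (\<lambda>g. ?f (D g)) + \<kappa>"
      by (simp only: E_plus[OF fD dominated_const] E_const)
    finally show ?case using Suc by (simp add: algebra_simps)
  qed simp
  have "E n D \<le> ?f (D \<one>) + real n * \<kappa>" for n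
    using E_mono[OF D fD, of n] soft_abs_ge(2)[OF R(1)] D0 ind[of n]
    by (meson abs_ge_self order_trans)
  then show thesis by (rule that[unfolded \<kappa>_def[symmetric]])
qed

text \<open>Here \<open>h\<close> acts on the line by \<open>x \<mapsto> \<epsilon> h * x + \<tau> h\<close>, so \<open>\<tau>\<close> is the position of the orbit of \<open>0\<close>, and
  the hypothesis on \<open>E 1 \<epsilon>\<close> says that reflections occur.\<close>
lemma dihedral_drift:
  assumes \<tau>: "dominated \<tau>" and sgn: "\<And>h. h \<in> carrier G \<Longrightarrow> \<epsilon> h = 1 \<or> \<epsilon> h = -1"
    and rec: "\<And>g h. g \<in> carrier G \<Longrightarrow> h \<in> carrier G \<Longrightarrow> \<tau> (h \<otimes> g) = \<epsilon> h * \<tau> g + \<tau> h"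
    and refl: "E 1 \<epsilon> < 1" and e: "e > 0"
  obtains C where "\<And>n. E n (\<lambda>g. \<bar>\<tau> g\<bar>) \<le> C + real n * e"
proof -
  have de: "dominated \<epsilon>" by (rule dominated_le[OF dominated_const[of 1]]) (use sgn in force)
  \<comment> \<open>Since \<open>\<epsilon> h\<close> is a sign, |\<epsilon> h x + \<tau> h| = |x +
    \<epsilon> h \<tau> h|; hence \<open>\<theta>\<close> times the mean sign of the position is the
    drift of the absolute value. \<open>A\<close> arises from summing the recursion of that mean
    sign, whose factor is \<open>E 1 \<epsilon>\<close>.\<close>
  define \<theta> where "\<theta> = E 1 (\<lambda>h. \<epsilon> h * \<tau> h)"
  define A where "A = \<bar>\<theta>\<bar> / (1 - E 1 \<epsilon>)"
  have A: "A \<ge> 0" using refl by (simp add: A_def)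
  have d\<tau>a: "dominated (\<lambda>h. \<bar>\<tau> h\<bar>)" using \<tau> by (rule dominated_abs)
  have B0: "E 1 (\<lambda>h. \<bar>\<tau> h\<bar>) \<ge> 0" by (rule E_nonneg) simp
  have d\<epsilon>\<tau>: "dominated (\<lambda>h. \<epsilon> h * \<tau> h)"
    by (rule dominated_le[OF d\<tau>a]) (use sgn in \<open>force simp: abs_mult\<close>)
  obtain R0 where R0: "R0 > 0" "E 1 (\<lambda>g. soft_err R0 (\<tau> g)) < e / 2"
    using E_soft_err_small[OF \<tau>, of "e / 2"] e by auto
  \<comment> \<open>Besides the second-order error, \<open>R\<close> must make the Lipschitz error
    of the sign small: the quotient is what \<open>A * s1 \<le> e / 2\<close> requires.\<close>
  define R where "R = max R0 (4 * A * E 1 (\<lambda>h. \<bar>\<tau> h\<bar>) / e + 1)"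
  have "4 * A * E 1 (\<lambda>h. \<bar>\<tau> h\<bar>) / e \<ge> 0" using A B0 e by simp
  then have R: "R > 0" "R0 \<le> R" "R \<ge> 4 * A * E 1 (\<lambda>h. \<bar>\<tau> h\<bar>) / e" using R0 by (auto simp: R_def)
  let ?f = "soft_abs R" and ?s = "soft_sgn R" and ?\<eta> = "\<lambda>h. soft_err R (\<tau> h)"
  have "E 1 ?\<eta> \<le> E 1 (\<lambda>g. soft_err R0 (\<tau> g))"
    unfolding soft_err_def using R R0
    by (intro E_mono dominated_soft_err[unfolded soft_err_def] min.mono divide_left_mono \<tau>) auto
  then have \<eta>: "E 1 ?\<eta> < e / 2" using R0 by linarith
  define s1 where "s1 = 2 * E 1 (\<lambda>h. \<bar>\<tau> h\<bar>) / R"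
  have s1: "A * s1 \<le> e / 2" 
    using R e unfolding s1_def by (simp add: field_simps)
  have df: "dominated (\<lambda>g. ?f (\<tau> g))" using dominated_soft_abs R \<tau> by blast
  have ds: "dominated (\<lambda>g. ?s (\<tau> g))" using dominated_soft_sgn R by blast
  have dn: "dominated ?\<eta>" using dominated_soft_err[OF R(1) \<tau>] .
  define S where "S n = E n (\<lambda>g. ?s (\<tau> g))" for n
  define F where "F n = E n (\<lambda>g. ?f (\<tau> g))" for n
  have S1: "\<bar>S n\<bar> \<le> 1" for n
  proof -
    have "\<bar>S n\<bar> \<le> E n (\<lambda>g. \<bar>?s (\<tau> g)\<bar>)" unfolding S_def by (rule E_abs)
    also have "\<dots> \<le> E n (\<lambda>_. 1)"
      by (rule E_mono) (use ds abs_soft_sgn_le_1[OF R(1)] in \<open>auto intro!: dominated_abs dominated_const\<close>)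
    finally show ?thesis by simp
  qed
  \<comment> \<open>A step multiplies the sign of the position by \<open>\<epsilon> h\<close>, up to
    an error of order |\<tau> h| / R; on average the sign is multiplied by
    \<open>E 1 \<epsilon>\<close>.\<close>
  have Sstep: "\<bar>S (Suc n) - E 1 \<epsilon> * S n\<bar> \<le> s1" for n
  proof -
    have "E 1 \<epsilon> * S n = E n (\<lambda>g. E 1 \<epsilon> * ?s (\<tau> g))" by (simp add: S_def)
    moreover have "S (Suc n) = E n (\<lambda>g. E 1 (\<lambda>h. ?s (\<tau> (h \<otimes> g))))"
      using E_add(1)[OF ds, of n 1] by (simp add: S_def)
    ultimately have "S (Suc n) - E 1 \<epsilon> * S n = E n (\<lambda>g. E 1 (\<lambda>h. ?s (\<tau> (h \<otimes> g))) - E 1 \<epsilon> * ?s (\<tau> g))"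
      using E_add(2)[OF ds, of n 1] integrable_dominated[OF dominated_cmult[OF ds]]
      by (simp del: One_nat_def)
    also have "\<bar>\<dots>\<bar> \<le> E n (\<lambda>g. \<bar>E 1 (\<lambda>h. ?s (\<tau> (h \<otimes> g))) - E 1 \<epsilon> * ?s (\<tau> g)\<bar>)"
      by (rule E_abs)
    also have "\<dots> \<le> E n (\<lambda>_. s1)"
    proof (rule E_mono[OF dominated_le[OF dominated_const[of s1]] dominated_const])
      fix g assume g: "g \<in> carrier G"
      have t: "dominated (\<lambda>h. ?s (\<tau> (h \<otimes> g)))" using dominated_translate(1)[OF ds g] .
      have "E 1 \<epsilon> * ?s (\<tau> g) = E 1 (\<lambda>h. ?s (\<tau> g) * \<epsilon> h)" by simp
      then have "E 1 (\<lambda>h. ?s (\<tau> (h \<otimes> g))) - E 1 \<epsilon> * ?s (\<tau> g) = E 1 (\<lambda>h. ?s (\<tau> (h \<otimes> g)) - ?s (\<tau> g) * \<epsilon> h)"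
        by (simp only: E_diff[OF t dominated_cmult[OF de]])
      also have "\<bar>\<dots>\<bar> \<le> E 1 (\<lambda>h. \<bar>?s (\<tau> (h \<otimes> g)) - ?s (\<tau> g) * \<epsilon> h\<bar>)" by (rule E_abs)
      also have "\<dots> \<le> E 1 (\<lambda>h. (2 / R) * \<bar>\<tau> h\<bar>)"
      proof (rule E_mono)
        fix h assume h: "h \<in> carrier G"
        have "?s (\<tau> g) * \<epsilon> h = ?s (\<epsilon> h * \<tau> g)" using sgn[OF h] soft_sgn_uminus[OF R(1)] by auto
        then show "\<bar>?s (\<tau> (h \<otimes> g)) - ?s (\<tau> g) * \<epsilon> h\<bar> \<le> (2 / R) * \<bar>\<tau> h\<bar>"
          using soft_sgn_Lipschitz[OF R(1), of "\<epsilon> h * \<tau> g" "\<tau> h"] rec[OF g h] by simp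
      qed (intro dominated_abs dominated_diff dominated_cmult t de \<tau>)+
      also have "\<dots> = s1" by (simp add: s1_def)
      finally show "\<bar>E 1 (\<lambda>h. ?s (\<tau> (h \<otimes> g))) - E 1 \<epsilon> * ?s (\<tau> g)\<bar> \<le> s1" .
      then show "\<bar>\<bar>E 1 (\<lambda>h. ?s (\<tau> (h \<otimes> g))) - E 1 \<epsilon> * ?s (\<tau> g)\<bar>\<bar> \<le> s1" by simp
    qed
    finally show ?thesis by simp
  qed
  have sumS: "\<bar>\<theta> * (\<Sum>k<n. S k)\<bar> \<le> 2 * A + real n * (e / 2)" for n
  proof -
    \<comment> \<open>Summing the recursion telescopes. As \<open>E 1 \<epsilon>\<close> is less
      than 1, the mean signs have a bounded sum apart from the error per step.\<close>
    have eq: "(1 - E 1 \<epsilon>) * (\<Sum>k<n. S k) = (S 0 - S n) + (\<Sum>k<n. S (Suc k) - E 1 \<epsilon> * S k)"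
    proof (induction n)
      case (Suc n)
      have "(1 - E 1 \<epsilon>) * (\<Sum>k<Suc n. S k) = (1 - E 1 \<epsilon>) * (\<Sum>k<n. S k) + (S n - E 1 \<epsilon> * S n)"
        by (simp add: algebra_simps)
      then show ?case unfolding Suc by simp
    qed simp
    have "\<bar>\<Sum>k<n. S (Suc k) - E 1 \<epsilon> * S k\<bar> \<le> (\<Sum>k<n. s1)"
      by (rule order_trans[OF sum_abs sum_mono[OF Sstep]])
    then have "\<bar>(1 - E 1 \<epsilon>) * (\<Sum>k<n. S k)\<bar> \<le> 2 + real n * s1"
      unfolding eq using S1[of 0] S1[of n] by simp
    then have "(1 - E 1 \<epsilon>) * \<bar>\<Sum>k<n. S k\<bar> \<le> 2 + real n * s1"
      using refl by (simp add: abs_mult del: One_nat_def)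
    then have "A * ((1 - E 1 \<epsilon>) * \<bar>\<Sum>k<n. S k\<bar>) \<le> A * (2 + real n * s1)"
      by (rule mult_left_mono[OF _ A])
    also have "A * ((1 - E 1 \<epsilon>) * \<bar>\<Sum>k<n. S k\<bar>) = \<bar>\<theta>\<bar> * \<bar>\<Sum>k<n. S k\<bar>"
      using refl by (simp add: A_def del: One_nat_def)
    also have "A * (2 + real n * s1) \<le> 2 * A + real n * (e / 2)"
      using mult_left_mono[OF s1, of "real n"] by (simp add: algebra_simps)
    finally show ?thesis by (simp add: abs_mult)
  qed
  have Fstep: "F (Suc n) \<le> F n + \<theta> * S n + e / 2" for n
  proof -
    have "E (n + 1) (\<lambda>g. ?f (\<tau> g)) \<le> E n (\<lambda>g. ?f (\<tau> g) + \<theta> * ?s (\<tau> g) + e / 2)"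
    proof (rule E_add_le)
      fix g assume g: "g \<in> carrier G"
      have "E 1 (\<lambda>h. ?f (\<tau> (h \<otimes> g))) \<le> E 1 (\<lambda>h. ?f (\<tau> g) + ?s (\<tau> g) * (\<epsilon> h * \<tau> h) + ?\<eta> h)"
      proof (rule E_mono)
        fix h assume h: "h \<in> carrier G"
        have "?f (\<tau> (h \<otimes> g)) = ?f (\<tau> g + \<epsilon> h * \<tau> h)"
          using sgn[OF h] rec[OF g h] soft_abs_uminus[OF R(1), of "\<tau> g - \<tau> h"] by auto
        also have "\<dots> \<le> ?f (\<tau> g) + ?s (\<tau> g) * (\<epsilon> h * \<tau> h) + soft_err R (\<epsilon> h * \<tau> h)"
          by (rule soft_abs_add_le[OF R(1)])
        also have "soft_err R (\<epsilon> h * \<tau> h) = ?\<eta> h"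
          using sgn[OF h] by (auto simp: soft_err_def)
        finally show "?f (\<tau> (h \<otimes> g)) \<le> ?f (\<tau> g) + ?s (\<tau> g) * (\<epsilon> h * \<tau> h) + ?\<eta> h" .
      qed (intro dominated_translate(1)[OF df g] dominated_add dominated_cmult dominated_const d\<epsilon>\<tau> dn)+
      also have "\<dots> = ?f (\<tau> g) + ?s (\<tau> g) * \<theta> + E 1 ?\<eta>"
        by (subst E_plus, (intro dominated_add dominated_cmult dominated_const d\<epsilon>\<tau> dn)+,
            subst E_plus, (intro dominated_add dominated_cmult dominated_const d\<epsilon>\<tau> dn)+) (simp add: \<theta>_def del: One_nat_def)
      finally show "E 1 (\<lambda>h. ?f (\<tau> (h \<otimes> g))) \<le> ?f (\<tau> g) + \<theta> * ?s (\<tau> g) + e / 2"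
        using \<eta> by (simp add: mult.commute)
    qed (intro df ds dominated_add dominated_cmult dominated_const)+
    also have "\<dots> = F n + \<theta> * S n + e / 2"
      unfolding F_def S_def
      by (subst E_plus, (intro dominated_add dominated_cmult dominated_const ds df)+,
            subst E_plus, (intro dominated_add dominated_cmult dominated_const ds df)+) simp
    finally show ?thesis by (simp add: F_def)
  qed
  have "F n \<le> F 0 + \<theta> * (\<Sum>k<n. S k) + real n * (e / 2)" for n
  proof (induction n)
    case (Suc n)
    with Fstep[of n] show ?case by (simp add: distrib_left distrib_right add_divide_distrib)
  qed simp
  then have "F n \<le> F 0 + 2 * A + real n * e" for n
    using sumS[of n] by (smt (verit) field_sum_of_halves distrib_left)
  moreover have "E n (\<lambda>g. \<bar>\<tau> g\<bar>) \<le> F n" for n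
    unfolding F_def by (intro E_mono d\<tau>a df soft_abs_ge(2)[OF R(1)])
  ultimately show thesis using that[of "F 0 + 2 * A"] by (meson order_trans)
qed

end

section \<open>Linear algebra in the plane\<close>

text \<open>The area form: preserved by SL(2), and for unit vectors its modulus is the sine of the
  angle between the two lines, so it measures distance in the projective line.\<close>

definition wedge :: "complex^2 \<Rightarrow> complex^2 \<Rightarrow> complex" where
  "wedge p q = p$1 * q$2 - p$2 * q$1"

text \<open>Orthogonal to \<open>q\<close> for the Hermitian product and of the same length; its
  wedge with \<open>q\<close> is as large as \<open>norm_wedge_le\<close> allows, so it completes
  \<open>q\<close> to a basis without loss of constants.\<close>

definition perp :: "complex^2 \<Rightarrow> complex^2" where
  "perp q = (\<chi> i. if i = 1 then - cnj (q$2) else cnj (q$1))"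

lemma norm_matrix_vector_mult_le:
  fixes A :: "'a::{real_normed_field}^'n^'m"
  shows "norm (A *v x) \<le> norm A * norm x"
proof -
  have "norm ((A *v x) $ i) \<le> norm (A $ i) * norm x" for i
  proof -
    have "norm ((A *v x) $ i) \<le> (\<Sum>j\<in>UNIV. norm (A $ i $ j) * norm (x $ j))"
      unfolding matrix_vector_mult_def by (simp add: sum_norm_le norm_mult)
    also have "\<dots> \<le> norm (A $ i) * norm x"
      using L2_set_mult_ineq[of "\<lambda>j. norm (A $ i $ j)" "\<lambda>j. norm (x $ j)" UNIV] by (simp add: norm_vec_def)
    finally show ?thesis .
  qed
  then have "norm (A *v x) \<le> L2_set (\<lambda>i. norm (A $ i) * norm x) UNIV"
    unfolding norm_vec_def[of "A *v x"] by (intro L2_set_mono) auto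
  also have "\<dots> = norm A * norm x"
    by (simp add: L2_set_left_distrib[symmetric] norm_vec_def[of A])
  finally show ?thesis .
qed

lemma norm_matrix_mult_le:
  fixes A :: "'a::{real_normed_field}^'n^'m" and B :: "'a^'k^'n"
  shows "norm (A ** B) \<le> norm A * norm B"
proof -
  have row: "norm (c *s u) = norm c * norm u" for c and u :: "'a^'k"
    by (simp add: norm_vec_def L2_set_right_distrib norm_mult)
  have "norm ((A ** B) $ i) \<le> norm (A $ i) * norm B" for i
  proof -
    have "(A ** B) $ i = (\<Sum>j\<in>UNIV. A $ i $ j *s B $ j)"
      by (simp add: vec_eq_iff matrix_matrix_mult_def)
    then have "norm ((A ** B) $ i) \<le> (\<Sum>j\<in>UNIV. norm (A $ i $ j) * norm (B $ j))"
      by (simp add: sum_norm_le row)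
    also have "\<dots> \<le> norm (A $ i) * norm B"
      using L2_set_mult_ineq[of "\<lambda>j. norm (A $ i $ j)" "\<lambda>j. norm (B $ j)" UNIV]
      by (simp add: norm_vec_def[of "A $ i"] norm_vec_def[of B])
    finally show ?thesis .
  qed
  then have "norm (A ** B) \<le> L2_set (\<lambda>i. norm (A $ i) * norm B) UNIV"
    unfolding norm_vec_def[of "A ** B"] by (intro L2_set_mono) auto
  also have "\<dots> = norm A * norm B"
    by (simp add: L2_set_left_distrib[symmetric] norm_vec_def[of A])
  finally show ?thesis .
qed

lemma norm_smult_vec: "norm (c *s u) = cmod c * norm (u :: complex^2)"
  by (simp add: norm_vec_def L2_set_right_distrib norm_mult)

lemma norm_complex2: "norm (p :: complex^2) = sqrt ((cmod (p$1))\<^sup>2 + (cmod (p$2))\<^sup>2)"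
  by (simp add: norm_vec_def L2_set_def sum_2)

lemma wedge_matrix_vector_mult: "wedge (A *v p) (A *v q) = det A * wedge p q"
  by (simp add: wedge_def det_2 matrix_vector_mult_def sum_2 algebra_simps)

lemma wedge_self [simp]: "wedge p p = 0" by (simp add: wedge_def)

lemma wedge_commute: "wedge p q = - wedge q p" by (simp add: wedge_def)

lemma cmod_wedge_commute: "cmod (wedge p q) = cmod (wedge q p)"
  by (subst wedge_commute) simp

lemma norm_wedge_le: "cmod (wedge p q) \<le> norm p * norm q"
proof -
  have "cmod (wedge p q) \<le> cmod (p$1) * cmod (q$2) + cmod (p$2) * cmod (q$1)"
    unfolding wedge_def by (metis norm_mult norm_triangle_ineq4)
  also have "\<dots> = (\<Sum>i\<in>UNIV. norm (p $ i) * norm ((\<chi> i::2. if i = 1 then q$2 else q$1) $ i))"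
    by (simp add: sum_2)
  also have "\<dots> \<le> norm p * norm (\<chi> i::2. if i = 1 then q$2 else q$1)"
    unfolding norm_vec_def by (rule order_trans[OF _ L2_set_mult_ineq]) (simp add: abs_mult)
  also have "norm (\<chi> i::2. if i = 1 then q$2 else q$1) = norm q"
    by (simp add: norm_complex2 add.commute)
  finally show ?thesis .
qed

text \<open>Cramer's rule for three vectors in the plane. Applying a matrix and taking norms gives
  the three-point inequalities behind the later ultrametric estimates.\<close>

lemma wedge_plucker: "wedge p q *s r = wedge r q *s p + wedge p r *s q"
  by (simp add: vec_eq_iff forall_2 wedge_def algebra_simps)

lemma matrix_vector_mult_combination:
  fixes A :: "'a::field^'n^'m"
  shows "A *v (c *s x + d *s y) = c *s (A *v x) + d *s (A *v y)"
  by (simp add: matrix_vector_right_distrib vector_scalar_commute)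

lemma norm_plucker:
  fixes A :: "complex^2^2"
  shows "cmod (wedge p q) * norm (A *v r) \<le> cmod (wedge r q) * norm (A *v p) + cmod (wedge p r) * norm (A *v q)"
proof -
  have "wedge p q *s (A *v r) = wedge r q *s (A *v p) + wedge p r *s (A *v q)"
    using arg_cong[OF wedge_plucker[of p q r], of "(*v) A"]
    by (simp add: matrix_vector_mult_combination vector_scalar_commute)
  then have "norm (wedge p q *s (A *v r)) \<le> norm (wedge r q *s (A *v p)) + norm (wedge p r *s (A *v q))"
    by (simp add: norm_triangle_ineq)
  then show ?thesis by (simp add: norm_smult_vec)
qed

lemma wedge_perp: "cmod (wedge q (perp q)) = (norm q)\<^sup>2"
proof -
  have "wedge q (perp q) = complex_of_real ((cmod (q$1))\<^sup>2 + (cmod (q$2))\<^sup>2)"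
    by (simp add: wedge_def perp_def flip: complex_norm_square)
  then have "cmod (wedge q (perp q)) = (cmod (q$1))\<^sup>2 + (cmod (q$2))\<^sup>2"
    by (metis norm_of_real abs_of_nonneg sum_power2_ge_zero)
  then show ?thesis by (simp add: norm_complex2)
qed

lemma norm_perp [simp]: "norm (perp q) = norm q"
  by (simp add: norm_complex2 perp_def add.commute)

text \<open>Compares the stretching of nearby directions: when \<open>p\<close> is expanded in
  \<open>q\<close> and \<open>perp q\<close>, only the second component, governed by
  \<open>wedge p q\<close>, can see the full norm of \<open>A\<close>.\<close>

lemma norm_perp_plucker:
  fixes A :: "complex^2^2"
  shows "norm q * norm (A *v p) \<le> norm p * norm (A *v q) + cmod (wedge p q) * norm A"
proof (cases "q = 0")
  case False
  have "(norm q)\<^sup>2 * norm (A *v p) \<le> cmod (wedge p (perp q)) * norm (A *v q) + cmod (wedge q p) * norm (A *v perp q)"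
    using norm_plucker[of q "perp q" A p] by (simp add: wedge_perp)
  also have "\<dots> \<le> (norm p * norm q) * norm (A *v q) + cmod (wedge q p) * (norm A * norm q)"
    using norm_wedge_le[of p "perp q"] norm_matrix_vector_mult_le[of A "perp q"]
    by (intro add_mono mult_mono) auto
  finally have "norm q * (norm q * norm (A *v p)) \<le> norm q * (norm p * norm (A *v q) + cmod (wedge p q) * norm A)"
    by (simp add: power2_eq_square algebra_simps cmod_wedge_commute[of q p])
  then show ?thesis using False by simp
qed simp

text \<open>Area is preserved, so a strong contraction of \<open>x\<close> would force
  \<open>perp x\<close> to be stretched beyond the norm of \<open>A\<close>.\<close>

lemma norm_matrix_vector_ge:
  assumes "det (A :: complex^2^2) = 1" shows "norm x \<le> norm A * norm (A *v x)"
proof (cases "x = 0")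
  case False
  have "(norm x)\<^sup>2 = cmod (wedge (A *v x) (A *v perp x))"
    using assms by (simp add: wedge_matrix_vector_mult wedge_perp)
  also have "\<dots> \<le> norm (A *v x) * (norm A * norm x)"
    using norm_matrix_vector_mult_le[of A "perp x"]
    by (intro order_trans[OF norm_wedge_le] mult_left_mono) auto
  finally have "norm x * norm x \<le> norm x * (norm A * norm (A *v x))"
    by (simp add: power2_eq_square mult_ac)
  then show ?thesis using False by simp
qed simp

lemma norm_le_columns: "norm (A :: complex^2^2) \<le> norm (A *v axis 1 1) + norm (A *v axis 2 1)"
proof -
  have "(norm A)\<^sup>2 = (norm (A *v axis 1 1))\<^sup>2 + (norm (A *v axis 2 1))\<^sup>2"
    by (simp add: norm_vec_def L2_set_def sum_2 matrix_vector_mult_def axis_def)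
  also have "\<dots> \<le> (norm (A *v axis 1 1) + norm (A *v axis 2 1))\<^sup>2"
    by (simp add: power2_sum)
  finally show ?thesis by (rule power2_le_imp_le) simp
qed

text \<open>Quantitative form of the principle that two separated directions cannot both be
  contracted: each basis vector is a combination of \<open>p\<close> and \<open>q\<close> whose
  coefficients are controlled by \<open>wedge p q\<close>.\<close>

lemma norm_matrix_wedge_le:
  fixes A :: "complex^2^2"
  shows "norm A * cmod (wedge p q) \<le> 2 * (norm q * norm (A *v p) + norm p * norm (A *v q))"
proof -
  have *: "cmod (wedge p q) * norm (A *v axis i 1) \<le> norm q * norm (A *v p) + norm p * norm (A *v q)" for i :: 2
  proof -
    have "cmod (wedge (axis i 1) q) \<le> norm q" "cmod (wedge p (axis i 1)) \<le> norm p"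
      using norm_wedge_le[of "axis i 1" q] norm_wedge_le[of p "axis i 1"] by (auto simp: norm_axis_1)
    then show ?thesis
      by (intro order_trans[OF norm_plucker] add_mono mult_right_mono) auto
  qed
  have "norm A * cmod (wedge p q) \<le> (norm (A *v axis 1 1) + norm (A *v axis 2 1)) * cmod (wedge p q)"
    by (intro mult_right_mono norm_le_columns) auto
  with *[of 1] *[of 2] show ?thesis by (simp add: algebra_simps)
qed

lemma norm_matrix_ge_1:
  assumes "det (A :: complex^2^2) = 1" shows "1 \<le> norm A"
proof -
  have "1 = cmod (wedge (A$1) (A$2))" using assms by (simp add: det_2 wedge_def)
  also have "\<dots> \<le> norm (A$1) * norm (A$2)" by (rule norm_wedge_le)
  also have "\<dots> \<le> norm A * norm A" by (intro mult_mono Finite_Cartesian_Product.norm_nth_le) auto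
  finally show ?thesis using power2_le_imp_le[of 1 "norm A"] by (simp add: power2_eq_square)
qed

text \<open>Split the image of \<open>B\<close> along \<open>v\<close> and its orthogonal complement.\<close>
lemma norm_matrix_mult_split_le:
  fixes A B :: "complex^2^2"
  assumes "norm v = 1" "det B = 1" "B *v u = v"
  shows "norm (A ** B) \<le> 2 * (norm B * norm (A *v v) + norm A * norm u)"
proof -
  have *: "norm ((A ** B) *v axis i 1) \<le> norm B * norm (A *v v) + norm A * norm u" for i :: 2
  proof -
    let ?r = "B *v axis i 1"
    have w: "wedge ?r v = wedge (axis i 1) u"
      using wedge_matrix_vector_mult[of B "axis i 1" u] assms by simp
    have "norm v * norm (A *v ?r) \<le> norm ?r * norm (A *v v) + cmod (wedge ?r v) * norm A"
      by (rule norm_perp_plucker)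
    also have "\<dots> \<le> norm B * norm (A *v v) + norm u * norm A"
      using norm_matrix_vector_mult_le[of B "axis i 1"] norm_wedge_le[of "axis i 1" u] w
      by (intro add_mono mult_right_mono) (auto simp: norm_axis_1)
    finally show ?thesis using assms by (simp add: matrix_vector_mul_assoc mult.commute)
  qed
  from *[of 1] *[of 2] norm_le_columns[of "A ** B"] show ?thesis by simp
qed

lemma wedge_eq_0_parallel:
  assumes "wedge p q = 0" "q \<noteq> 0" obtains k where "p = k *s q"
proof (cases "q$1 = 0")
  case True
  then have "q$2 \<noteq> 0" using assms(2) by (auto simp: vec_eq_iff forall_2)
  with True assms(1) show ?thesis by (intro that[of "p$2 / q$2"]) (auto simp: wedge_def vec_eq_iff forall_2)
next
  case False
  with assms(1) show ?thesis by (intro that[of "p$1 / q$1"]) (auto simp: wedge_def vec_eq_iff forall_2 field_simps)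
qed

text \<open>A common eigenvector lies in the kernel of the commutator. If both matrices nearly
  preserve the line of \<open>v\<close>, the commutator nearly kills \<open>v\<close>, while it
  stretches \<open>perp v\<close> by at most its norm.\<close>

lemma norm_commutator_det_le:
  fixes A B :: "complex^2^2"
  assumes v: "norm v = 1"
  shows "cmod (det (A ** B - B ** A)) \<le> 8 * norm A * norm B * (norm B * cmod (wedge (A *v v) v) + norm A * cmod (wedge (B *v v) v))"
proof -
  let ?C = "A ** B - B ** A" and ?w = "perp v"
  define k where "k = wedge v ?w"
  define a b \<alpha> \<beta> where "a = wedge v (A *v v)" and "b = wedge v (B *v v)" 
    and "\<alpha> = wedge (A *v v) ?w" and "\<beta> = wedge (B *v v) ?w"
  have k1: "cmod k = 1" using v by (simp add: k_def wedge_perp)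
  have A: "k *s (A *v v) = \<alpha> *s v + a *s ?w" and B: "k *s (B *v v) = \<beta> *s v + b *s ?w"
    unfolding k_def a_def b_def \<alpha>_def \<beta>_def by (rule wedge_plucker)+
  have AB: "k *s (A *v (B *v v)) = \<beta> *s (A *v v) + b *s (A *v ?w)"
    using arg_cong[OF B, of "(*v) A"] by (simp add: matrix_vector_mult_combination vector_scalar_commute)
  have BA: "k *s (B *v (A *v v)) = \<alpha> *s (B *v v) + a *s (B *v ?w)"
    using arg_cong[OF A, of "(*v) B"] by (simp add: matrix_vector_mult_combination vector_scalar_commute)
  \<comment> \<open>The terms with \<open>\<alpha>\<close> times \<open>\<beta>\<close> along
    \<open>v\<close> cancel between the two products; what remains carries a factor \<open>a\<close>
    or \<open>b\<close>.\<close>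
  have "k *s (k *s (?C *v v)) = \<beta> *s (k *s (A *v v)) + (k * b) *s (A *v ?w) - (\<alpha> *s (k *s (B *v v)) + (k * a) *s (B *v ?w))"
    using arg_cong[OF AB, of "\<lambda>x. k *s x"] arg_cong[OF BA, of "\<lambda>x. k *s x"]
    by (simp add: matrix_vector_mult_diff_rdistrib matrix_vector_mul_assoc vec.scale_right_diff_distrib vec.scale_right_distrib mult.commute)
  also have "\<dots> = (\<beta> * a) *s ?w + (k * b) *s (A *v ?w) - ((\<alpha> * b) *s ?w + (k * a) *s (B *v ?w))"
    unfolding A B by (simp add: vec.scale_right_distrib mult.commute)
  finally have "norm (?C *v v) = norm \<dots>"
    using k1 by (metis mult_1 norm_smult_vec)
  also have "\<dots> \<le> norm ((\<beta> * a) *s ?w) + norm ((k * b) *s (A *v ?w)) + (norm ((\<alpha> * b) *s ?w) + norm ((k * a) *s (B *v ?w)))"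
    by (intro order_trans[OF norm_triangle_ineq4] add_mono norm_triangle_ineq)
  also have "\<dots> = cmod \<beta> * cmod a + cmod b * norm (A *v ?w) + (cmod \<alpha> * cmod b + cmod a * norm (B *v ?w))"
    using v k1 by (simp add: norm_smult_vec norm_mult)
  also have "\<dots> \<le> norm B * cmod a + cmod b * norm A + (norm A * cmod b + cmod a * norm B)"
  proof -
    have "cmod \<alpha> \<le> norm A" "cmod \<beta> \<le> norm B" "norm (A *v ?w) \<le> norm A" "norm (B *v ?w) \<le> norm B"
      using norm_wedge_le[of "A *v v" ?w] norm_wedge_le[of "B *v v" ?w] v
        norm_matrix_vector_mult_le[of A v] norm_matrix_vector_mult_le[of B v]
        norm_matrix_vector_mult_le[of A ?w] norm_matrix_vector_mult_le[of B ?w]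
      by (auto simp: \<alpha>_def \<beta>_def)
    then show ?thesis by (intro add_mono mult_left_mono mult_right_mono) auto
  qed
  finally have Cv: "norm (?C *v v) \<le> 2 * (norm B * cmod a + norm A * cmod b)" by (simp add: algebra_simps)
  have Cn: "norm ?C \<le> 2 * (norm A * norm B)"
    using norm_triangle_ineq4[of "A ** B" "B ** A"] norm_matrix_mult_le[of A B] norm_matrix_mult_le[of B A]
    by (simp add: mult.commute)
  have "cmod (det ?C) = cmod (wedge (?C *v v) (?C *v ?w))"
    using k1 by (simp add: wedge_matrix_vector_mult norm_mult k_def)
  also have "\<dots> \<le> norm (?C *v v) * (norm ?C * norm ?w)"
    by (intro order_trans[OF norm_wedge_le] mult_left_mono norm_matrix_vector_mult_le) auto
  also have "\<dots> \<le> (2 * (norm B * cmod a + norm A * cmod b)) * (2 * (norm A * norm B) * 1)"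
    using v by (intro mult_mono Cv Cn) auto
  finally have "cmod (det ?C) \<le> 4 * norm A * norm B * (norm B * cmod a + norm A * cmod b)"
    by (simp add: mult_ac)
  also have "\<dots> \<le> 8 * norm A * norm B * (norm B * cmod a + norm A * cmod b)"
    by (intro mult_right_mono) auto
  finally show ?thesis unfolding a_def b_def by (simp add: cmod_wedge_commute[of v])
qed

text \<open>The determinant of the commutator is, up to a nonzero factor, the resultant of the two quadratic
  forms \<open>x \<mapsto> wedge (A *v x) x\<close> and \<open>x \<mapsto> wedge (B *v x) x\<close>; hence it vanishes iff \<open>A\<close> and \<open>B\<close> share an
  eigenline.\<close>
lemma commutator_det_eq_0:
  fixes A :: "complex^2^2"
  assumes "\<exists>x. wedge (A *v x) x \<noteq> 0"
  obtains v w where "v \<noteq> 0" "w \<noteq> 0"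
    "\<And>B. det (A ** B - B ** A) = 0 \<Longrightarrow> wedge (B *v v) v = 0 \<or> wedge (B *v w) w = 0"
proof -
  define p q r s where "p = A$1$1" and "q = A$1$2" and "r = A$2$1" and "s = A$2$2"
  \<comment> \<open>\<open>d\<close> is a root of the discriminant of the characteristic polynomial,
    so \<open>l\<close> and \<open>n\<close> are the eigenvalues of \<open>A\<close>; the vectors
    passed on in each case are eigenvectors of \<open>A\<close>, possibly parallel.\<close>
  define d where "d = csqrt ((p - s)\<^sup>2 + 4 * q * r)"
  define l n where "l = (p + s + d) / 2" and "n = (p + s - d) / 2"
  have d2: "d * d = (p - s)\<^sup>2 + 4 * q * r" unfolding d_def by (metis power2_csqrt power2_eq_square)
  have ln: "l + n = p + s" "l * n = p * s - q * r"
    using d2 by (simp_all add: l_def n_def field_simps power2_eq_square) 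
  define e11 e12 e21 e22 :: "complex^2^2 \<Rightarrow> complex"
    where "e11 B = B$1$1" and "e12 B = B$1$2" and "e21 B = B$2$1" and "e22 B = B$2$2" for B
  note e_defs = e11_def e12_def e21_def e22_def
  have detC: "det (A ** B - B ** A) = - (q * e21 B - r * e12 B)\<^sup>2
      - (p * e12 B + q * e22 B - e11 B * q - e12 B * s) * (r * e11 B + s * e21 B - e21 B * p - e22 B * r)" for B
    unfolding det_2 vector_minus_component matrix_matrix_mult_def vec_lambda_beta sum_2 p_def q_def r_def s_def e_defs
    by (simp add: power2_eq_square algebra_simps)
  have wB: "wedge (B *v x) x = e11 B * x$1 * x$2 + e12 B * (x$2)\<^sup>2 - e21 B * (x$1)\<^sup>2 - e22 B * x$1 * x$2" for B x
    by (simp add: wedge_def matrix_vector_mult_def sum_2 e_defs power2_eq_square algebra_simps)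
  consider "q \<noteq> 0" | "q = 0" "r \<noteq> 0" | "q = 0" "r = 0" by blast
  then show thesis
  proof cases
    case 1
    define v w :: "complex^2" where "v = vector [q, l - p]" and "w = vector [q, n - p]"
    have "wedge (B *v v) v * wedge (B *v w) w = - q\<^sup>2 * det (A ** B - B ** A)" for B
      unfolding wB detC v_def w_def vector_2 using ln by algebra
    moreover have "v \<noteq> 0" "w \<noteq> 0" using 1 by (auto simp: v_def w_def vec_eq_iff forall_2)
    ultimately show thesis using that[of v w] by (metis mult_eq_0_iff)
  next
    case 2
    define v w :: "complex^2" where "v = vector [l - s, r]" and "w = vector [n - s, r]"
    have "wedge (B *v v) v * wedge (B *v w) w = - r\<^sup>2 * det (A ** B - B ** A)" for B
      unfolding wB detC v_def w_def vector_2 using ln by algebra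
    moreover have "v \<noteq> 0" "w \<noteq> 0" using 2 by (auto simp: v_def w_def vec_eq_iff forall_2)
    ultimately show thesis using that[of v w] by (metis mult_eq_0_iff)
  next
    case 3
    obtain x where "wedge (A *v x) x \<noteq> 0" using assms by blast
    then have "p \<noteq> s" using 3 unfolding wB by (auto simp: p_def q_def r_def s_def e_defs)
    moreover have "det (A ** B - B ** A) = (p - s)\<^sup>2 * (e12 B * e21 B)" for B
      unfolding detC using 3 by (simp add: power2_eq_square algebra_simps)
    ultimately show thesis
      by (intro that[of "vector [1, 0]" "vector [0, 1]"]) (auto simp: wB vector_2 vec_eq_iff forall_2)
  qed
qed

text \<open>A nonscalar matrix in \<open>\<Gamma>\<close> leaves two candidate lines, and every
  element fixes one of them. The rest is the argument that a group is not the union of two proper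
  subgroups: if \<open>B1\<close> moves \<open>v\<close> and \<open>B2\<close> moves
  \<open>w\<close>, then \<open>B1 ** B2\<close> moves both.\<close>

lemma invariant_line_exists:
  fixes \<Gamma> :: "(complex^2^2) set"
  assumes mult: "\<And>A B. A \<in> \<Gamma> \<Longrightarrow> B \<in> \<Gamma> \<Longrightarrow> A ** B \<in> \<Gamma>"
    and det1: "\<And>A. A \<in> \<Gamma> \<Longrightarrow> det A = 1"
    and comm: "\<And>A B. A \<in> \<Gamma> \<Longrightarrow> B \<in> \<Gamma> \<Longrightarrow> det (A ** B - B ** A) = 0"
  obtains v where "norm v = 1" "\<And>A. A \<in> \<Gamma> \<Longrightarrow> wedge (A *v v) v = 0"
proof -
  have "\<exists>v. v \<noteq> 0 \<and> (\<forall>A\<in>\<Gamma>. wedge (A *v v) v = 0)"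
  proof (cases "\<forall>A\<in>\<Gamma>. \<forall>x. wedge (A *v x) x = 0")
    case True
    then show ?thesis by (intro exI[of _ "axis 1 1"]) (auto simp: axis_eq_0_iff)
  next
    case False
    then obtain A where A: "A \<in> \<Gamma>" "\<exists>x. wedge (A *v x) x \<noteq> 0" by blast
    obtain v w where vw: "v \<noteq> 0" "w \<noteq> 0"
      "\<And>B. det (A ** B - B ** A) = 0 \<Longrightarrow> wedge (B *v v) v = 0 \<or> wedge (B *v w) w = 0"
      using commutator_det_eq_0[OF A(2)] by blast
    have fx: "wedge (B *v v) v = 0 \<or> wedge (B *v w) w = 0" if "B \<in> \<Gamma>" for B
      using vw(3) comm A that by blast
    show ?thesis
    proof (rule ccontr)
      assume "\<not> ?thesis"
      then obtain B1 B2 where B1: "B1 \<in> \<Gamma>" "wedge (B1 *v v) v \<noteq> 0" and B2: "B2 \<in> \<Gamma>" "wedge (B2 *v w) w \<noteq> 0"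
        using vw(1,2) by blast
      obtain k1 where k1: "B1 *v w = k1 *s w"
        using fx[OF B1(1)] B1(2) wedge_eq_0_parallel vw(2) by metis
      obtain k2 where k2: "B2 *v v = k2 *s v"
        using fx[OF B2(1)] B2(2) wedge_eq_0_parallel vw(1) by metis
      have nz: "B *v x \<noteq> 0" if "B \<in> \<Gamma>" "x \<noteq> 0" for B x
        using det1[OF that(1)] wedge_matrix_vector_mult[of B x "perp x"] wedge_perp[of x] that(2)
        by (auto simp: wedge_def)
      have kz: "k1 \<noteq> 0" "k2 \<noteq> 0" using nz[OF B1(1) vw(2)] nz[OF B2(1) vw(1)] k1 k2 by auto
      have sm: "wedge (k *s x) y = k * wedge x y" "wedge x (k *s y) = k * wedge x y" for k x y
        by (simp_all add: wedge_def algebra_simps)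
      have "wedge ((B1 ** B2) *v v) v = k2 * wedge (B1 *v v) v"
        by (simp add: matrix_vector_mul_assoc[symmetric] k2 vector_scalar_commute sm)
      then have "wedge (B1 *v (B2 *v w)) w = 0"
        using fx[OF mult[OF B1(1) B2(1)]] B1(2) kz by (simp add: matrix_vector_mul_assoc)
      then have "wedge (B1 *v (B2 *v w)) (B1 *v w) = 0" by (simp add: k1 sm)
      then show False using B2(2) det1[OF B1(1)] by (simp add: wedge_matrix_vector_mult)
    qed
  qed
  then obtain v where v: "v \<noteq> 0" "\<And>A. A \<in> \<Gamma> \<Longrightarrow> wedge (A *v v) v = 0" by blast
  let ?c = "complex_of_real (inverse (norm v))"
  have "wedge (A *v (?c *s v)) (?c *s v) = ?c * ?c * wedge (A *v v) v" for A
    by (simp add: wedge_def vector_scalar_commute algebra_simps)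
  then show thesis
    using v by (intro that[of "?c *s v"]) (auto simp: norm_smult_vec norm_inverse)
qed

text \<open>On the scale of roots the constant tends to 1 and a sum becomes a maximum. Roots are
  used rather than logarithms because the terms may vanish, and \<open>0 powr\<close> anything is
  0.\<close>

lemma root_limit_le_max:
  fixes a b c L :: "nat \<Rightarrow> real"
  assumes L: "filterlim L at_top sequentially"
    and le: "\<And>j. a j \<le> C * (b j + c j)" and nn: "\<And>j. 0 \<le> a j" "\<And>j. 0 \<le> b j" "\<And>j. 0 \<le> c j"
    and C: "C > 0"
    and lim: "(\<lambda>j. a j powr (1 / L j)) \<longlonglongrightarrow> \<alpha>" "(\<lambda>j. b j powr (1 / L j)) \<longlonglongrightarrow> \<beta>" "(\<lambda>j. c j powr (1 / L j)) \<longlonglongrightarrow> \<gamma>"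
  shows "\<alpha> \<le> max \<beta> \<gamma>"
proof -
  have inv: "(\<lambda>j. 1 / L j) \<longlonglongrightarrow> 0"
    using L by (intro tendsto_divide_0[OF tendsto_const] filterlim_at_top_imp_at_infinity)
  have "(\<lambda>j. (2 * C) powr (1 / L j) * max (b j powr (1 / L j)) (c j powr (1 / L j))) \<longlonglongrightarrow> (2 * C) powr 0 * max \<beta> \<gamma>"
    using C by (intro tendsto_mult tendsto_max lim tendsto_powr tendsto_const inv) auto
  moreover have "\<forall>\<^sub>F j in sequentially. a j powr (1 / L j) \<le> (2 * C) powr (1 / L j) * max (b j powr (1 / L j)) (c j powr (1 / L j))"
    using filterlim_at_top_dense[THEN iffD1, OF L, rule_format, of 0]
  proof eventually_elim
    case (elim j)
    have "a j \<le> 2 * C * max (b j) (c j)"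
    proof -
      have "b j + c j \<le> 2 * max (b j) (c j)" by simp
      then have "C * (b j + c j) \<le> C * (2 * max (b j) (c j))"
        by (rule mult_left_mono) (use C in simp)
      also have "\<dots> = 2 * C * max (b j) (c j)" by (simp only: mult.assoc mult.left_commute)
      finally show ?thesis using le[of j] by linarith
    qed
    then have "a j powr (1 / L j) \<le> (2 * C * max (b j) (c j)) powr (1 / L j)"
      using nn elim by (intro powr_mono2) auto
    also have "\<dots> = (2 * C) powr (1 / L j) * max (b j) (c j) powr (1 / L j)"
      using nn[of j] C by (simp add: powr_mult)
    also have "max (b j) (c j) powr (1 / L j) = max (b j powr (1 / L j)) (c j powr (1 / L j))"
      using nn[of j] elim by (auto simp: max_def intro!: powr_mono2 antisym)
    finally show ?case .
  qed
  ultimately show ?thesis using C lim(1) by (auto dest: tendsto_le[OF sequentially_bot])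
qed

section \<open>Degenerating families of representations\<close>

text \<open>Otherwise every direction has a time up to \<open>K\<close> by which it has grown at
  rate \<gamma> on average. Restarting there from the image direction and concatenating gives
  expected growth at least n \<gamma> - C at all times n, which contradicts l < \<gamma>.\<close>

lemma (in weighted_walk) bad_direction_exists:
  fixes B :: "'a \<Rightarrow> complex^2^2"
  assumes det1: "\<And>g. g \<in> carrier G \<Longrightarrow> det (B g) = 1"
    and hom: "\<And>g h. g \<in> carrier G \<Longrightarrow> h \<in> carrier G \<Longrightarrow> B (g \<otimes> h) = B g ** B h"
    and dom: "dominated (\<lambda>g. ln (norm (B g)))"
    and lim: "(\<lambda>n. E n (\<lambda>g. ln (norm (B g))) / real n) \<longlonglongrightarrow> l" and l: "l < \<gamma>"
  obtains v where "norm v = 1" "\<And>n. 1 \<le> n \<Longrightarrow> n \<le> K \<Longrightarrow> E n (\<lambda>g. ln (norm (B g *v v))) < real n * \<gamma>"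
proof (rule ccontr)
  note thesisI = that
  assume contra: "\<not> thesis"
  have good: "\<exists>n. 1 \<le> n \<and> n \<le> K \<and> real n * \<gamma> \<le> E n (\<lambda>g. ln (norm (B g *v v)))" if v: "norm v = 1" for v
  proof (rule ccontr)
    assume H: "\<not> ?thesis"
    have "E n (\<lambda>g. ln (norm (B g *v v))) < real n * \<gamma>" if "1 \<le> n" "n \<le> K" for n
      using H that by (meson not_le)
    then show False using contra thesisI[OF v] by blast
  qed
  let ?N = "\<lambda>g. ln (norm (B g))"
  have N0: "0 \<le> ?N g" if "g \<in> carrier G" for g
    using norm_matrix_ge_1[OF det1[OF that]] by simp
  have pos: "0 < norm (B g *v v)" if "g \<in> carrier G" "norm v = 1" for g v
    using norm_matrix_vector_ge[OF det1[OF that(1)], of v] that(2) by (cases "B g *v v = 0") auto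
  have bd: "\<bar>ln (norm (B g *v v))\<bar> \<le> ?N g" if g: "g \<in> carrier G" and v: "norm v = 1" for g v
  proof -
    have n: "norm (B g) > 0" using norm_matrix_ge_1[OF det1[OF g]] by linarith
    have "norm (B g *v v) \<le> norm (B g)" using norm_matrix_vector_mult_le[of "B g" v] v by simp
    moreover have "1 / norm (B g) \<le> norm (B g *v v)"
      using norm_matrix_vector_ge[OF det1[OF g], of v] v n by (simp add: field_simps)
    ultimately have "ln (norm (B g *v v)) \<le> ?N g" "ln (1 / norm (B g)) \<le> ln (norm (B g *v v))"
      using pos[OF g v] n by (subst ln_le_cancel_iff; simp)+
    then show ?thesis using n by (simp add: ln_div)
  qed
  have dv: "dominated (\<lambda>g. ln (norm (B g *v v)))" if "norm v = 1" for v
    by (rule dominated_le[OF dom bd]) (use that in auto)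
  \<comment> \<open>Pays for the last, incomplete block, where only the trivial lower bound
    \<open>- E n ?N\<close> is available.\<close>
  define C where "C = (\<Sum>n\<le>K. E n ?N + real n * \<bar>\<gamma>\<bar>)"
  have C: "E n ?N + real n * \<bar>\<gamma>\<bar> \<le> C" if "n \<le> K" for n
    unfolding C_def by (rule member_le_sum) (use that N0 in \<open>auto intro!: add_nonneg_nonneg E_nonneg\<close>)
  have claim: "real n * \<gamma> - C \<le> E n (\<lambda>g. ln (norm (B g *v v)))" if "norm v = 1" for n v
    using that
  proof (induction n arbitrary: v rule: less_induct)
    case (less n)
    note v = less.prems
    show ?case
    proof (cases "n \<le> K")
      case True
      have "\<bar>E n (\<lambda>g. ln (norm (B g *v v)))\<bar> \<le> E n (\<lambda>g. \<bar>ln (norm (B g *v v))\<bar>)" by (rule E_abs)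
      also have "\<dots> \<le> E n ?N"
        by (rule E_mono) (use v dv dom bd in \<open>auto intro!: dominated_abs\<close>)
      finally have "- E n ?N \<le> E n (\<lambda>g. ln (norm (B g *v v)))" by linarith
      moreover have "real n * \<gamma> \<le> real n * \<bar>\<gamma>\<bar>" by (intro mult_left_mono) auto
      ultimately show ?thesis using C[OF True] by linarith
    next
      case False
      obtain k where k: "1 \<le> k" "k \<le> K" "real k * \<gamma> \<le> E k (\<lambda>g. ln (norm (B g *v v)))"
        using good[OF v] by blast
      let ?f = "\<lambda>g. ln (norm (B g *v v))" and ?r = "real (n - k) * \<gamma> - C"
      \<comment> \<open>The good time \<open>k\<close> is a fixed number depending on
        \<open>v\<close>; the direction \<open>?w\<close> reached after it is random, which is why
        the induction runs over all directions. Signs are reversed so that an upper bound can be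
        integrated.\<close>
      have "E (k + (n - k)) (\<lambda>g. - ?f g) \<le> E k (\<lambda>g. - ?r - ?f g)"
      proof (rule E_add_le)
        fix g assume g: "g \<in> carrier G"
        let ?c = "complex_of_real (norm (B g *v v))"
        let ?w = "inverse ?c *s (B g *v v)"
        have p: "norm (B g *v v) > 0" using pos[OF g v] .
        have w: "norm ?w = 1" using p by (simp add: norm_smult_vec norm_inverse)
        have Bw: "B g *v v = ?c *s ?w" using p by simp
        have eq: "?f (h \<otimes> g) = ln (norm (B h *v ?w)) + ?f g" if h: "h \<in> carrier G" for h
        proof -
          have "B (h \<otimes> g) *v v = ?c *s (B h *v ?w)"
            by (metis Bw hom[OF h g] matrix_vector_mul_assoc vector_scalar_commute)
          then have "norm (B (h \<otimes> g) *v v) = norm (B g *v v) * norm (B h *v ?w)"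
            by (simp add: norm_smult_vec)
          then show ?thesis using p pos[OF h w] by (simp add: ln_mult)
        qed
        have "E (n - k) (\<lambda>h. - ?f (h \<otimes> g)) = E (n - k) (\<lambda>h. - (ln (norm (B h *v ?w)) + ?f g))"
          by (rule E_cong) (simp add: eq)
        also have "\<dots> = - (E (n - k) (\<lambda>h. ln (norm (B h *v ?w))) + ?f g)"
          by (simp only: E_plus[OF dv[OF w] dominated_const] E_const Bochner_Integration.integral_minus)
        also have "\<dots> \<le> - ?r - ?f g"
          using less.IH[OF _ w, of "n - k"] k False by simp
        finally show "E (n - k) (\<lambda>h. - ?f (h \<otimes> g)) \<le> - ?r - ?f g" .
      qed (intro dominated_minus dominated_diff dominated_const dv v)+
      also have "\<dots> = - ?r - E k ?f"
        by (simp only: E_diff[OF dominated_const dv[OF v]] E_const)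
      finally have "?r + E k ?f \<le> E n ?f"
        using k False by simp
      moreover have "real n * \<gamma> = real k * \<gamma> + real (n - k) * \<gamma>"
        using k False by (simp add: of_nat_diff algebra_simps)
      ultimately show ?thesis using k by linarith
    qed
  qed
  have v1: "norm (axis 1 1 :: complex^2) = 1" by (simp add: norm_axis_1)
  have ge: "\<gamma> - C / real n \<le> E n ?N / real n" if "n \<ge> 1" for n
  proof -
    have "E n (\<lambda>g. ln (norm (B g *v axis 1 1))) \<le> E n ?N"
      by (rule E_mono[OF dv[OF v1] dom]) (use bd[OF _ v1] in force)
    with claim[OF v1, of n] have "real n * \<gamma> - C \<le> E n ?N" by linarith
    then have "(real n * \<gamma> - C) / real n \<le> E n ?N / real n" by (rule divide_right_mono) simp
    then show ?thesis using that by (simp add: diff_divide_distrib)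
  qed
  have "(\<lambda>n. \<gamma> - C / real n) \<longlonglongrightarrow> \<gamma> - 0"
    by (intro tendsto_intros lim_const_over_n)
  then have "\<gamma> - 0 \<le> l"
    using lim by (rule LIMSEQ_le) (use ge in blast)
  with l show False by simp
qed

text \<open>In the application \<open>A j\<close> is the representation at a parameter t_j tending
  to 0, \<open>L j\<close> is log(1/|t_j|) and \<open>M\<close> is the logarithm of the
  nonarchimedean norm. A sequence allows passage to subsequences, and countability lets one
  subsequence serve all group elements.\<close>

locale degeneration = weighted_walk G m b for G :: "('a, 'b) monoid_scheme" (structure) and m b +
  fixes A :: "nat \<Rightarrow> 'a \<Rightarrow> complex^2^2" and L :: "nat \<Rightarrow> real" and M :: "'a \<Rightarrow> real"
  assumes gen: "generate G (set_pmf m) = carrier G"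
    and cnt: "countable (carrier G)"
    and L_top: "filterlim L at_top sequentially"
    and L_pos: "\<And>j. L j > 0"
    and A_det: "\<And>j g. g \<in> carrier G \<Longrightarrow> det (A j g) = 1"
    and A_mult: "\<And>j g h. g \<in> carrier G \<Longrightarrow> h \<in> carrier G \<Longrightarrow> A j (g \<otimes> h) = A j g ** A j h"
    and A_bound: "\<And>j g. g \<in> carrier G \<Longrightarrow> ln (norm (A j g)) \<le> L j * b g"
    and A_lim: "\<And>g. g \<in> carrier G \<Longrightarrow> (\<lambda>j. ln (norm (A j g)) / L j) \<longlonglongrightarrow> M g"
begin

text \<open>Multiplicativity makes this matrix idempotent, and its determinant makes it
  invertible.\<close>

lemma A_one: "A j \<one> = mat 1"
proof -
  have "invertible (A j \<one>)" using A_det[of \<one> j] by (simp add: invertible_det_nz)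
  then obtain B where B: "B ** A j \<one> = mat 1" by (auto simp: invertible_def)
  have "A j \<one> ** A j \<one> = A j \<one>" using A_mult[of \<one> \<one> j] by simp
  then have "B ** (A j \<one> ** A j \<one>) = B ** A j \<one>" by simp
  then show ?thesis by (simp add: matrix_mul_assoc B)
qed

lemma A_vec: "g \<in> carrier G \<Longrightarrow> h \<in> carrier G \<Longrightarrow> A j (g \<otimes> h) *v x = A j g *v (A j h *v x)"
  by (simp add: A_mult matrix_vector_mul_assoc)

lemma A_norm_ge1: "g \<in> carrier G \<Longrightarrow> 1 \<le> norm (A j g)"
  using norm_matrix_ge_1 A_det by blast

lemma A_nz: "g \<in> carrier G \<Longrightarrow> A j g \<noteq> 0"
  using A_norm_ge1[of g j] by auto

lemma A_vec_bounds:
  assumes "g \<in> carrier G"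
  shows "norm (A j g *v x) \<le> norm (A j g) * norm x" "norm x \<le> norm (A j g) * norm (A j g *v x)"
  using norm_matrix_vector_mult_le norm_matrix_vector_ge[OF A_det[OF assms]] by auto

lemma A_vec_pos: "g \<in> carrier G \<Longrightarrow> x \<noteq> 0 \<Longrightarrow> 0 < norm (A j g *v x)"
  using A_vec_bounds(2)[of g x j] by (cases "A j g *v x = 0") auto

lemma ln_A_ge0: "g \<in> carrier G \<Longrightarrow> 0 \<le> ln (norm (A j g))"
  using A_norm_ge1 by simp

lemma ln_A_mult: 
  assumes "g \<in> carrier G" "h \<in> carrier G" 
  shows "ln (norm (A j (g \<otimes> h))) \<le> ln (norm (A j g)) + ln (norm (A j h))"
proof -
  have p: "norm (A j g) > 0" "norm (A j h) > 0" "norm (A j (g \<otimes> h)) > 0"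
    using A_norm_ge1 assms by (meson m_closed less_le_trans zero_less_one)+
  have "ln (norm (A j (g \<otimes> h))) \<le> ln (norm (A j g) * norm (A j h))"
    using p norm_matrix_mult_le[of "A j g" "A j h"] A_mult[OF assms] by (subst ln_le_cancel_iff) auto
  then show ?thesis using p by (simp add: ln_mult)
qed

lemma abs_ln_A_vec:
  assumes g: "g \<in> carrier G" and x: "x \<noteq> 0"
  shows "\<bar>ln (norm (A j g *v x)) - ln (norm x)\<bar> \<le> ln (norm (A j g))"
proof -
  have p: "norm (A j g) > 0" "norm (A j g *v x) > 0" "norm x > 0"
    using A_norm_ge1[OF g, of j] A_vec_pos[OF g x, of j] x by auto
  have "ln (norm (A j g *v x)) \<le> ln (norm (A j g) * norm x)" "ln (norm x) \<le> ln (norm (A j g) * norm (A j g *v x))"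
    using A_vec_bounds[OF g, where j=j and x=x] p by (auto intro: ln_mono)
  then show ?thesis using p by (simp add: ln_mult abs_le_iff)
qed

lemma M_bounds: 
  assumes "g \<in> carrier G" shows "0 \<le> M g" "M g \<le> b g"
proof -
  have 1: "0 \<le> ln (norm (A j g)) / L j" "ln (norm (A j g)) / L j \<le> b g" for j
    using ln_A_ge0[OF assms, of j] A_bound[OF assms, of j] L_pos[of j] by (auto simp: field_simps)
  show "0 \<le> M g" by (rule LIMSEQ_le_const[OF A_lim[OF assms]]) (use 1 in auto)
  show "M g \<le> b g" by (rule LIMSEQ_le_const2[OF A_lim[OF assms]]) (use 1 in auto)
qed

lemma dominated_M: "dominated M"
  by (rule dominated_le[OF dominated_b]) (use M_bounds in auto)

lemma dominated_ln_A: "dominated (\<lambda>g. ln (norm (A j g)))"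
  by (rule dominatedI[of _ "L j"]) (use A_bound ln_A_ge0 in auto)

lemma M_mult: 
  assumes "g \<in> carrier G" "h \<in> carrier G" shows "M (g \<otimes> h) \<le> M g + M h"
proof (rule LIMSEQ_le[OF A_lim[OF m_closed[OF assms]]])
  show "(\<lambda>j. ln (norm (A j g)) / L j + ln (norm (A j h)) / L j) \<longlonglongrightarrow> M g + M h"
    by (intro tendsto_add A_lim assms)
  show "\<exists>N. \<forall>j\<ge>N. ln (norm (A j (g \<otimes> h))) / L j \<le> ln (norm (A j g)) / L j + ln (norm (A j h)) / L j"
    using ln_A_mult[OF assms] L_pos
    by (auto simp: add_divide_distrib[symmetric] intro!: exI[of _ 0] divide_right_mono less_imp_le[OF L_pos])
qed

definition chi :: real where "chi = lim (\<lambda>n. E n M / real n)"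

lemma chi_lim: "(\<lambda>n. E n M / real n) \<longlonglongrightarrow> chi"
  and chi_ge0: "0 \<le> chi"
proof -
  obtain l where l: "(\<lambda>n. E n M / real n) \<longlonglongrightarrow> l" "0 \<le> l"
    using E_ratio_tendsto[OF dominated_M] M_mult M_bounds(1) by metis
  then show "(\<lambda>n. E n M / real n) \<longlonglongrightarrow> chi" "0 \<le> chi"
    unfolding chi_def by (auto simp: limI)
qed

lemma chi_le:
  assumes "\<And>n. E n M \<le> C + real n * c" shows "chi \<le> c"
proof -
  have "(\<lambda>n. C / real n + c) \<longlonglongrightarrow> 0 + c"
    by (intro tendsto_intros lim_const_over_n)
  moreover have "E n M / real n \<le> C / real n + c" if "n \<ge> 1" for n
    using assms[of n] that by (simp add: field_simps)
  ultimately show ?thesis using LIMSEQ_le[OF chi_lim, of "\<lambda>n. C / real n + c" "0 + c"] by auto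
qed

lemma root_norm_lim: "g \<in> carrier G \<Longrightarrow> (\<lambda>j. norm (A j g) powr (1 / L j)) \<longlonglongrightarrow> exp (M g)"
  using tendsto_exp[OF A_lim] A_nz by (simp add: powr_def)

lemma subseq: 
  assumes "strict_mono r" shows "degeneration G m b (\<lambda>j. A (r j)) (\<lambda>j. L (r j)) M"
proof unfold_locales
  show "filterlim (\<lambda>j. L (r j)) at_top sequentially"
    using filterlim_compose[OF L_top filterlim_subseq[OF assms]] .
  show "(\<lambda>j. ln (norm (A (r j) g)) / L (r j)) \<longlonglongrightarrow> M g" if "g \<in> carrier G" for g
    using LIMSEQ_subseq_LIMSEQ[OF A_lim[OF that] assms] by (simp add: o_def)
qed (use gen cnt L_pos A_det A_mult A_bound in auto)

lemma direction_subseq: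
  assumes v: "\<And>j. norm (v j) = 1"
  obtains r \<phi> where "strict_mono (r :: nat \<Rightarrow> nat)"
    "\<And>g. g \<in> carrier G \<Longrightarrow> (\<lambda>j. ln (norm (A (r j) g *v v (r j))) / L (r j)) \<longlonglongrightarrow> \<phi> g"
proof -
  have vz: "v j \<noteq> 0" for j using v[of j] by auto
  \<comment> \<open>Dividing by the weight bounds the family by one constant on the whole group, as
    the diagonal argument requires.\<close>
  let ?f = "\<lambda>j g. (ln (norm (A j g *v v j)) / L j) / b g"
  have "norm (?f j g) \<le> 1" if g: "g \<in> carrier G" for j g
  proof -
    have "\<bar>ln (norm (A j g *v v j))\<bar> \<le> L j * b g"
      using abs_ln_A_vec[OF g vz[of j], of j] A_bound[OF g, of j] v by simp
    then show ?thesis using L_pos[of j] b_ge1[OF g] by (simp add: abs_div field_simps)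
  qed
  then obtain r where r: "strict_mono (r :: nat \<Rightarrow> nat)" "\<And>g. g \<in> carrier G \<Longrightarrow> \<exists>l. (\<lambda>j. ?f (r j) g) \<longlonglongrightarrow> l"
    using function_convergent_subsequence[OF cnt, of ?f 1] by blast
  have "(\<lambda>j. ln (norm (A (r j) g *v v (r j))) / L (r j)) \<longlonglongrightarrow> lim (\<lambda>j. ln (norm (A (r j) g *v v (r j))) / L (r j))"
    if g: "g \<in> carrier G" for g
  proof -
    obtain l where "(\<lambda>j. ?f (r j) g) \<longlonglongrightarrow> l" using r(2)[OF g] by blast
    then have "(\<lambda>j. b g * ?f (r j) g) \<longlonglongrightarrow> b g * l" by (rule tendsto_mult_left)
    then have "(\<lambda>j. ln (norm (A (r j) g *v v (r j))) / L (r j)) \<longlonglongrightarrow> b g * l"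
      using b_ge1[OF g] by simp
    then show ?thesis by (simp add: limI)
  qed
  then show thesis by (rule that[OF r(1)])
qed

text \<open>In the limit the eigenvalue on the invariant line gives a homomorphism \<open>\<phi>\<close>, and \<open>M + \<phi>\<close> satisfies the
  recursion of \<open>lindley_drift\<close>.\<close>
lemma chi_le_invariant_line:
  assumes v: "\<And>j. norm (v j) = 1" and inv: "\<And>j g. g \<in> carrier G \<Longrightarrow> wedge (A j g *v v j) (v j) = 0"
    and lam: "\<And>j. (\<lambda>n. E n (\<lambda>g. ln (norm (A j g))) / real n) \<longlonglongrightarrow> l j" "\<And>j. l j \<le> \<gamma> * L j"
  shows "chi \<le> \<gamma>"
proof -
  have vz: "v j \<noteq> 0" for j using v[of j] by auto
  let ?p = "\<lambda>j g. ln (norm (A j g *v v j))"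
  have add: "?p j (h \<otimes> g) = ?p j h + ?p j g" if g: "g \<in> carrier G" and h: "h \<in> carrier G" for j g h
  proof -
    obtain k where k: "A j g *v v j = k *s v j" using wedge_eq_0_parallel[OF inv[OF g] vz] by blast
    have "A j (h \<otimes> g) *v v j = k *s (A j h *v v j)" by (simp add: A_vec[OF h g] k vector_scalar_commute)
    then have "norm (A j (h \<otimes> g) *v v j) = norm (A j g *v v j) * norm (A j h *v v j)"
      using k v by (simp add: norm_smult_vec)
    then show ?thesis using A_vec_pos[OF g vz] A_vec_pos[OF h vz] by (simp add: ln_mult)
  qed
  have bd: "\<bar>?p j g\<bar> \<le> ln (norm (A j g))" if "g \<in> carrier G" for j g
    using abs_ln_A_vec[OF that vz, of j] v by simp
  have dp: "dominated (?p j)" for j by (rule dominated_le[OF dominated_ln_A bd])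
  obtain r \<phi> where r: "strict_mono (r :: nat \<Rightarrow> nat)"
    and \<phi>: "\<And>g. g \<in> carrier G \<Longrightarrow> (\<lambda>j. ?p (r j) g / L (r j)) \<longlonglongrightarrow> \<phi> g"
    by (rule direction_subseq[where v=v, OF v]) (rule that)
  interpret s: degeneration G m b "\<lambda>j. A (r j)" "\<lambda>j. L (r j)" M by (rule subseq[OF r])
  have \<phi>M: "\<bar>\<phi> g\<bar> \<le> M g" if g: "g \<in> carrier G" for g
    by (rule LIMSEQ_le[OF tendsto_rabs[OF \<phi>[OF g]] s.A_lim[OF g]])
       (use bd[OF g] L_pos in \<open>auto simp: abs_div abs_of_pos intro!: exI[of _ 0] divide_right_mono less_imp_le[OF L_pos]\<close>)
  have d\<phi>: "dominated \<phi>" by (rule dominated_le[OF dominated_M \<phi>M])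
  have \<phi>add: "\<phi> (h \<otimes> g) = \<phi> h + \<phi> g" if g: "g \<in> carrier G" and h: "h \<in> carrier G" for g h
  proof (rule LIMSEQ_unique[OF \<phi>[OF m_closed[OF h g]]])
    show "(\<lambda>j. ?p (r j) (h \<otimes> g) / L (r j)) \<longlonglongrightarrow> \<phi> h + \<phi> g"
      using tendsto_add[OF \<phi>[OF h] \<phi>[OF g]] by (simp add: add[OF g h] add_divide_distrib)
  qed
  have root\<phi>: "(\<lambda>j. norm (A (r j) g *v v (r j)) powr (1 / L (r j))) \<longlonglongrightarrow> exp (\<phi> g)" if g: "g \<in> carrier G" for g
    using tendsto_exp[OF \<phi>[OF g]] A_vec_pos[OF g vz] by (simp add: powr_def less_imp_neq[symmetric])
  \<comment> \<open>On the invariant line the expectation after n steps is exactly n times the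
    one-step value, which is therefore bounded by the exponent before j tends to infinity.\<close>
  have small: "\<bar>E 1 \<phi>\<bar> \<le> \<gamma>"
  proof -
    have "\<bar>E 1 (?p j)\<bar> \<le> l j" for j
    proof (rule LIMSEQ_le_const[OF lam(1)], intro exI[of _ 1] allI impI)
      fix n :: nat assume n: "1 \<le> n"
      have "real n * \<bar>E 1 (?p j)\<bar> = \<bar>E n (?p j)\<bar>"
        using E_additive[OF dp add, of n j] by (simp add: abs_mult)
      also have "\<dots> \<le> E n (\<lambda>g. \<bar>?p j g\<bar>)" by (rule E_abs)
      also have "\<dots> \<le> E n (\<lambda>g. ln (norm (A j g)))"
        by (rule E_mono[OF dominated_abs[OF dp] dominated_ln_A bd])
      finally show "\<bar>E 1 (?p j)\<bar> \<le> E n (\<lambda>g. ln (norm (A j g))) / real n"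
        using n by (simp add: field_simps)
    qed
    then have le: "\<bar>E 1 (\<lambda>g. ?p (r j) g / L (r j))\<bar> \<le> \<gamma>" for j
      using lam(2)[of "r j"] L_pos[of "r j"]
      by (simp add: abs_div field_simps) (meson order_trans)
    have "(\<lambda>j. E 1 (\<lambda>g. ?p (r j) g / L (r j))) \<longlonglongrightarrow> E 1 \<phi>"
    proof (rule E_dominated_convergence[OF dominated_b _ \<phi>])
      fix g j assume g: "g \<in> carrier G"
      show "\<bar>?p (r j) g / L (r j)\<bar> \<le> b g"
        using bd[OF g, of "r j"] A_bound[OF g, of "r j"] L_pos[of "r j"] by (simp add: abs_div field_simps)
    qed
    then show ?thesis using le by (intro LIMSEQ_le_const2[OF tendsto_rabs]) auto
  qed
  \<comment> \<open>The limit of \<open>norm_matrix_mult_split_le\<close> bounds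
    \<open>M (h \<otimes> g)\<close> by the larger of \<open>M g + \<phi> h\<close> and
    \<open>M h - \<phi> g\<close>; adding \<open>\<phi> (h \<otimes> g)\<close> turns these into
    \<open>D g + 2 * \<phi> h\<close> and \<open>D h\<close>.\<close>
  define D where "D g = M g + \<phi> g" for g
  have dD: "dominated D" unfolding D_def by (intro dominated_add dominated_M d\<phi>)
  have D0: "0 \<le> D g" if "g \<in> carrier G" for g using \<phi>M[OF that] by (simp add: D_def abs_le_iff)
  have rec: "D (h \<otimes> g) \<le> max (D g + 2 * \<phi> h) (D h)" if g: "g \<in> carrier G" and h: "h \<in> carrier G" for g h
  proof -
    let ?g' = "inv g"
    have g': "?g' \<in> carrier G" using g by simp
    have "\<phi> \<one> = 0" using \<phi>add[of \<one> \<one>] by simp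
    then have inv\<phi>: "\<phi> ?g' = - \<phi> g" using \<phi>add[OF g' g] g by simp
    have "exp (M (h \<otimes> g)) \<le> max (exp (M g) * exp (\<phi> h)) (exp (M h) * exp (\<phi> ?g'))"
    proof (rule root_limit_le_max[OF s.L_top])
      show "norm (A (r j) (h \<otimes> g)) \<le> 2 * (norm (A (r j) g) * norm (A (r j) h *v v (r j)) + norm (A (r j) h) * norm (A (r j) ?g' *v v (r j)))" for j
        unfolding A_mult[OF h g]
      proof (rule norm_matrix_mult_split_le[OF v A_det[OF g]])
        show "A (r j) g *v (A (r j) ?g' *v v (r j)) = v (r j)"
          using A_vec[OF g g', of "r j" "v (r j)"] g by (simp add: A_one)
      qed
      show "(\<lambda>j. norm (A (r j) (h \<otimes> g)) powr (1 / L (r j))) \<longlonglongrightarrow> exp (M (h \<otimes> g))"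
        using s.root_norm_lim g h by simp
      show "(\<lambda>j. (norm (A (r j) g) * norm (A (r j) h *v v (r j))) powr (1 / L (r j))) \<longlonglongrightarrow> exp (M g) * exp (\<phi> h)"
        using tendsto_mult[OF s.root_norm_lim[OF g] root\<phi>[OF h]] by (simp add: powr_mult)
      show "(\<lambda>j. (norm (A (r j) h) * norm (A (r j) ?g' *v v (r j))) powr (1 / L (r j))) \<longlonglongrightarrow> exp (M h) * exp (\<phi> ?g')"
        using tendsto_mult[OF s.root_norm_lim[OF h] root\<phi>[OF g']] by (simp add: powr_mult)
    qed auto
    then have "M (h \<otimes> g) \<le> max (M g + \<phi> h) (M h - \<phi> g)"
      by (simp add: exp_add[symmetric] le_max_iff_disj inv\<phi>)
    then show ?thesis unfolding D_def \<phi>add[OF g h] by linarith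
  qed
  have "chi \<le> \<bar>E 1 \<phi>\<bar> + e" if e: "e > 0" for e
  proof -
    obtain C where C: "\<And>n. E n D \<le> C + real n * (max 0 (2 * E 1 \<phi>) + e)"
      by (rule lindley_drift[OF d\<phi> dD D0 rec e]) (assumption+, rule that)
    show ?thesis
    proof (rule chi_le[of C])
      fix n
      have "E n D = E n M + real n * E 1 \<phi>"
        unfolding D_def E_plus[OF dominated_M d\<phi>] by (subst E_additive[OF d\<phi> \<phi>add, of n]) auto
      then have "E n M \<le> C + (real n * (max 0 (2 * E 1 \<phi>) + e) - real n * E 1 \<phi>)"
        using C[of n] by linarith
      also have "real n * (max 0 (2 * E 1 \<phi>) + e) - real n * E 1 \<phi> = real n * (max 0 (2 * E 1 \<phi>) + e - E 1 \<phi>)"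
        by (rule right_diff_distrib[symmetric])
      also have "max 0 (2 * E 1 \<phi>) + e - E 1 \<phi> = \<bar>E 1 \<phi>\<bar> + e" by linarith
      finally show "E n M \<le> C + real n * (\<bar>E 1 \<phi>\<bar> + e)" .
    qed
  qed
  then show ?thesis using small by (meson field_le_epsilon order_trans)
qed

end

section \<open>Orbits of directions\<close>

text \<open>\<open>\<phi>\<close> and \<open>D\<close> are the logarithmic limits of the norms and of the mutual positions along the orbit of the
  directions \<open>v j\<close>. The relation \<open>D x y = 0\<close> says that the directions of \<open>x\<close> and \<open>y\<close> are closer than any
  power of \<open>exp (- L j)\<close>.\<close>
locale degenerate_orbit = degeneration G m b A L M
  for G :: "('a, 'b) monoid_scheme" (structure) and m b A L M +
  fixes v :: "nat \<Rightarrow> complex^2" and \<phi> :: "'a \<Rightarrow> real" and D :: "'a \<Rightarrow> 'a \<Rightarrow> real"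
  assumes v: "\<And>j. norm (v j) = 1"
    and \<phi>_lim: "\<And>g. g \<in> carrier G \<Longrightarrow> (\<lambda>j. ln (norm (A j g *v v j)) / L j) \<longlonglongrightarrow> \<phi> g"
    and D_lim: "\<And>x y. x \<in> carrier G \<Longrightarrow> y \<in> carrier G \<Longrightarrow>
      (\<lambda>j. cmod (wedge (A j x *v v j) (A j y *v v j)) powr (1 / L j)) \<longlonglongrightarrow> D x y"
begin

text \<open>The norm cocycle: in the limit, the logarithmic stretching by \<open>g\<close> at the
  direction to which \<open>x\<close> carries \<open>v j\<close>.\<close>

definition \<sigma> :: "'a \<Rightarrow> 'a \<Rightarrow> real" where "\<sigma> g x = \<phi> (g \<otimes> x) - \<phi> x"

lemma v_nz: "v j \<noteq> 0" using v[of j] by auto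

lemma Av_nz: "g \<in> carrier G \<Longrightarrow> A j g *v v j \<noteq> 0"
  using A_vec_pos[OF _ v_nz[of j], of g j] by auto

lemma root_\<phi>_lim: "g \<in> carrier G \<Longrightarrow> (\<lambda>j. norm (A j g *v v j) powr (1 / L j)) \<longlonglongrightarrow> exp (\<phi> g)"
  using tendsto_exp[OF \<phi>_lim[of g]] Av_nz[of g] by (simp add: powr_def)

lemma \<phi>_one: "\<phi> \<one> = 0"
  using LIMSEQ_unique[OF \<phi>_lim[OF one_closed]] by (simp add: A_one v)

lemma abs_\<sigma>_le:
  assumes g: "g \<in> carrier G" and x: "x \<in> carrier G" shows "\<bar>\<sigma> g x\<bar> \<le> M g"
proof (rule LIMSEQ_le[OF _ A_lim[OF g]])
  show "(\<lambda>j. \<bar>ln (norm (A j (g \<otimes> x) *v v j)) / L j - ln (norm (A j x *v v j)) / L j\<bar>) \<longlonglongrightarrow> \<bar>\<sigma> g x\<bar>"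
    unfolding \<sigma>_def by (intro tendsto_rabs tendsto_diff \<phi>_lim m_closed g x)
  have "\<bar>ln (norm (A j (g \<otimes> x) *v v j)) / L j - ln (norm (A j x *v v j)) / L j\<bar> \<le> ln (norm (A j g)) / L j" for j
    using abs_ln_A_vec[OF g Av_nz[OF x], of j j] L_pos[of j]
    by (simp add: A_vec[OF g x] diff_divide_distrib[symmetric] abs_div divide_right_mono)
  then show "\<exists>N. \<forall>j\<ge>N. \<bar>ln (norm (A j (g \<otimes> x) *v v j)) / L j - ln (norm (A j x *v v j)) / L j\<bar> \<le> ln (norm (A j g)) / L j"
    by blast
qed

lemma dominated_\<sigma>: "x \<in> carrier G \<Longrightarrow> dominated (\<lambda>g. \<sigma> g x)"
  by (rule dominated_le[OF dominated_M]) (rule abs_\<sigma>_le)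

lemma \<sigma>_mult: "g \<in> carrier G \<Longrightarrow> h \<in> carrier G \<Longrightarrow> x \<in> carrier G \<Longrightarrow> \<sigma> (h \<otimes> g) x = \<sigma> h (g \<otimes> x) + \<sigma> g x"
  by (simp add: \<sigma>_def m_assoc)

lemma \<sigma>_one: "g \<in> carrier G \<Longrightarrow> \<sigma> g \<one> = \<phi> g"
  by (simp add: \<sigma>_def \<phi>_one)

lemma D_nonneg: "x \<in> carrier G \<Longrightarrow> y \<in> carrier G \<Longrightarrow> 0 \<le> D x y"
  by (rule LIMSEQ_le_const[OF D_lim]) auto

lemma D_self: "x \<in> carrier G \<Longrightarrow> D x x = 0"
  using LIMSEQ_unique[OF D_lim[of x x]] by simp

lemma D_commute: "x \<in> carrier G \<Longrightarrow> y \<in> carrier G \<Longrightarrow> D x y = D y x"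
  using LIMSEQ_unique[OF D_lim[of x y]] D_lim[of y x] by (simp add: cmod_wedge_commute)

lemma D_translate: 
  assumes "g \<in> carrier G" "x \<in> carrier G" "y \<in> carrier G" shows "D (g \<otimes> x) (g \<otimes> y) = D x y"
proof (rule LIMSEQ_unique[OF _ D_lim[OF assms(2,3)]])
  show "(\<lambda>j. cmod (wedge (A j x *v v j) (A j y *v v j)) powr (1 / L j)) \<longlonglongrightarrow> D (g \<otimes> x) (g \<otimes> y)"
    using D_lim[of "g \<otimes> x" "g \<otimes> y"] assms by (simp add: A_vec wedge_matrix_vector_mult A_det)
qed

text \<open>Divided by exp(\<phi> x + \<phi> y + \<phi> z), this is the ultrametric inequality for
  the normalized distance of lines; it is the limit of \<open>norm_plucker\<close>.\<close>

lemma D_ultra: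
  assumes x: "x \<in> carrier G" and y: "y \<in> carrier G" and z: "z \<in> carrier G"
  shows "D x z * exp (\<phi> y) \<le> max (D y z * exp (\<phi> x)) (D x y * exp (\<phi> z))"
proof (rule root_limit_le_max[OF L_top, where C=1])
  let ?x = "\<lambda>j. A j x *v v j" and ?y = "\<lambda>j. A j y *v v j" and ?z = "\<lambda>j. A j z *v v j"
  show "cmod (wedge (?x j) (?z j)) * norm (?y j) \<le> 1 * (cmod (wedge (?y j) (?z j)) * norm (?x j) + cmod (wedge (?x j) (?y j)) * norm (?z j))" for j
    using norm_plucker[of "?x j" "?z j" "mat 1" "?y j"] by simp
  show "(\<lambda>j. (cmod (wedge (?x j) (?z j)) * norm (?y j)) powr (1 / L j)) \<longlonglongrightarrow> D x z * exp (\<phi> y)"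
    using tendsto_mult[OF D_lim[OF x z] root_\<phi>_lim[OF y]] by (simp add: powr_mult)
  show "(\<lambda>j. (cmod (wedge (?y j) (?z j)) * norm (?x j)) powr (1 / L j)) \<longlonglongrightarrow> D y z * exp (\<phi> x)"
    using tendsto_mult[OF D_lim[OF y z] root_\<phi>_lim[OF x]] by (simp add: powr_mult)
  show "(\<lambda>j. (cmod (wedge (?x j) (?y j)) * norm (?z j)) powr (1 / L j)) \<longlonglongrightarrow> D x y * exp (\<phi> z)"
    using tendsto_mult[OF D_lim[OF x y] root_\<phi>_lim[OF z]] by (simp add: powr_mult)
qed auto

lemma M_D_le:
  assumes g: "g \<in> carrier G" and x: "x \<in> carrier G" and y: "y \<in> carrier G"
  shows "exp (M g) * D x y \<le> max (exp (\<phi> y) * exp (\<phi> (g \<otimes> x))) (exp (\<phi> x) * exp (\<phi> (g \<otimes> y)))"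
proof (rule root_limit_le_max[OF L_top, where C=2])
  let ?x = "\<lambda>j. A j x *v v j" and ?y = "\<lambda>j. A j y *v v j"
    and ?gx = "\<lambda>j. A j (g \<otimes> x) *v v j" and ?gy = "\<lambda>j. A j (g \<otimes> y) *v v j"
  show "norm (A j g) * cmod (wedge (?x j) (?y j)) \<le> 2 * (norm (?y j) * norm (?gx j) + norm (?x j) * norm (?gy j))" for j
    using norm_matrix_wedge_le[of "A j g" "?x j" "?y j"] by (simp add: A_vec g x y)
  show "(\<lambda>j. (norm (A j g) * cmod (wedge (?x j) (?y j))) powr (1 / L j)) \<longlonglongrightarrow> exp (M g) * D x y"
    using tendsto_mult[OF root_norm_lim[OF g] D_lim[OF x y]] by (simp add: powr_mult)
  show "(\<lambda>j. (norm (?y j) * norm (?gx j)) powr (1 / L j)) \<longlonglongrightarrow> exp (\<phi> y) * exp (\<phi> (g \<otimes> x))"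
    using tendsto_mult[OF root_\<phi>_lim[OF y] root_\<phi>_lim[OF m_closed[OF g x]]] by (simp add: powr_mult)
  show "(\<lambda>j. (norm (?x j) * norm (?gy j)) powr (1 / L j)) \<longlonglongrightarrow> exp (\<phi> x) * exp (\<phi> (g \<otimes> y))"
    using tendsto_mult[OF root_\<phi>_lim[OF x] root_\<phi>_lim[OF m_closed[OF g y]]] by (simp add: powr_mult)
qed auto

text \<open>Limit of \<open>norm_perp_plucker\<close>, whose error term carries the factor
  \<open>D x y\<close> and disappears. By symmetry, growth depends only on the class of a
  direction.\<close>

lemma \<sigma>_close_le:
  assumes g: "g \<in> carrier G" and x: "x \<in> carrier G" and y: "y \<in> carrier G" and D0: "D x y = 0"
  shows "\<sigma> g x \<le> \<sigma> g y"
proof -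
  let ?x = "\<lambda>j. A j x *v v j" and ?y = "\<lambda>j. A j y *v v j"
    and ?gx = "\<lambda>j. A j (g \<otimes> x) *v v j" and ?gy = "\<lambda>j. A j (g \<otimes> y) *v v j"
  have "exp (\<phi> y) * exp (\<phi> (g \<otimes> x)) \<le> max (exp (\<phi> x) * exp (\<phi> (g \<otimes> y))) (D x y * exp (M g))"
  proof (rule root_limit_le_max[OF L_top, where C=1])
    show "norm (?y j) * norm (?gx j) \<le> 1 * (norm (?x j) * norm (?gy j) + cmod (wedge (?x j) (?y j)) * norm (A j g))" for j
      using norm_perp_plucker[of "?y j" "A j g" "?x j"] by (simp add: A_vec g x y)
    show "(\<lambda>j. (norm (?y j) * norm (?gx j)) powr (1 / L j)) \<longlonglongrightarrow> exp (\<phi> y) * exp (\<phi> (g \<otimes> x))"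
      using tendsto_mult[OF root_\<phi>_lim[OF y] root_\<phi>_lim[OF m_closed[OF g x]]] by (simp add: powr_mult)
    show "(\<lambda>j. (norm (?x j) * norm (?gy j)) powr (1 / L j)) \<longlonglongrightarrow> exp (\<phi> x) * exp (\<phi> (g \<otimes> y))"
      using tendsto_mult[OF root_\<phi>_lim[OF x] root_\<phi>_lim[OF m_closed[OF g y]]] by (simp add: powr_mult)
    show "(\<lambda>j. (cmod (wedge (?x j) (?y j)) * norm (A j g)) powr (1 / L j)) \<longlonglongrightarrow> D x y * exp (M g)"
      using tendsto_mult[OF D_lim[OF x y] root_norm_lim[OF g]] by (simp add: powr_mult)
  qed auto
  also have "\<dots> = exp (\<phi> x) * exp (\<phi> (g \<otimes> y))" using D0 by simp
  finally show ?thesis by (simp add: exp_add[symmetric] \<sigma>_def)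
qed

lemma \<sigma>_close:
  assumes "g \<in> carrier G" "x \<in> carrier G" "y \<in> carrier G" "D x y = 0"
  shows "\<sigma> g x = \<sigma> g y"
  using \<sigma>_close_le[of g x y] \<sigma>_close_le[of g y x] assms D_commute by (metis antisym)

lemma D_trans:
  assumes "x \<in> carrier G" "y \<in> carrier G" "z \<in> carrier G" "D x y = 0" "D y z = 0"
  shows "D x z = 0"
proof -
  have "D x z * exp (\<phi> y) \<le> 0" using D_ultra[OF assms(1-3)] assms(4,5) by simp
  then show ?thesis using D_nonneg[OF assms(1,3)] by (simp add: mult_le_0_iff)
qed

definition indep :: "'a set \<Rightarrow> bool" where
  "indep T \<longleftrightarrow> finite T \<and> T \<subseteq> carrier G \<and> (\<forall>x\<in>T. \<forall>y\<in>T. x \<noteq> y \<longrightarrow> D x y \<noteq> 0)"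

text \<open>The logarithm of \<open>M_D_le\<close>, available because \<open>D x y\<close> is
  positive. What matters is that the loss depends on the pair of directions and not on
  \<open>g\<close>.\<close>

lemma M_le_max_\<sigma>:
  assumes g: "g \<in> carrier G" and x: "x \<in> carrier G" and y: "y \<in> carrier G" and D0: "D x y \<noteq> 0"
  shows "M g \<le> max (\<sigma> g x) (\<sigma> g y) + (\<phi> x + \<phi> y - ln (D x y))"
proof -
  have D: "D x y > 0" using D_nonneg[OF x y] D0 by simp
  have "exp (M g + ln (D x y)) \<le> max (exp (\<phi> y + \<phi> (g \<otimes> x))) (exp (\<phi> x + \<phi> (g \<otimes> y)))"
    using M_D_le[OF g x y] D by (simp add: exp_add)
  then have "M g + ln (D x y) \<le> max (\<phi> y + \<phi> (g \<otimes> x)) (\<phi> x + \<phi> (g \<otimes> y))"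
    by (simp add: le_max_iff_disj)
  then show ?thesis by (auto simp: \<sigma>_def)
qed

text \<open>Only the direction least stretched by \<open>g\<close> can have a large defect, and that
  is at most \<open>2 * M g\<close>; paired with it, every other direction loses a bounded
  amount.\<close>

lemma indep_sum_le:
  assumes T: "indep T"
  obtains C where "\<And>g. g \<in> carrier G \<Longrightarrow> (\<Sum>x\<in>T. M g - \<sigma> g x) \<le> 2 * M g + C"
proof -
  have fin: "finite T" and sub: "T \<subseteq> carrier G" and sep: "\<And>x y. x \<in> T \<Longrightarrow> y \<in> T \<Longrightarrow> x \<noteq> y \<Longrightarrow> D x y \<noteq> 0"
    using T by (auto simp: indep_def)
  define K where "K x y = \<bar>\<phi> x + \<phi> y - ln (D x y)\<bar>" for x y
  define C where "C = (\<Sum>x\<in>T. \<Sum>y\<in>T. K x y)"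
  have K: "K x y \<le> C" if "x \<in> T" "y \<in> T" for x y
  proof -
    have "K x y \<le> (\<Sum>y\<in>T. K x y)" by (rule member_le_sum) (use that fin in \<open>auto simp: K_def\<close>)
    also have "\<dots> \<le> C" unfolding C_def
      by (rule member_le_sum) (use that fin in \<open>auto simp: K_def intro!: sum_nonneg\<close>)
    finally show ?thesis .
  qed
  have "(\<Sum>x\<in>T. M g - \<sigma> g x) \<le> 2 * M g + real (card T) * C" if g: "g \<in> carrier G" for g
  proof (cases "T = {}")
    case False
    have "Min (\<sigma> g ` T) \<in> \<sigma> g ` T" using fin False by simp
    then obtain x0 where x0: "x0 \<in> T" "\<sigma> g x0 = Min (\<sigma> g ` T)" by auto
    then have min: "\<sigma> g x0 \<le> \<sigma> g x" if "x \<in> T" for x using fin that by simp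
    have C0: "C \<ge> 0" using K[OF x0(1) x0(1)] by (simp add: K_def)
    have "(\<Sum>x\<in>T. M g - \<sigma> g x) = (M g - \<sigma> g x0) + (\<Sum>x\<in>T - {x0}. M g - \<sigma> g x)"
      by (rule sum.remove[OF fin x0(1)])
    also have "(\<Sum>x\<in>T - {x0}. M g - \<sigma> g x) \<le> (\<Sum>x\<in>T - {x0}. C)"
    proof (rule sum_mono)
      fix x assume x: "x \<in> T - {x0}"
      have "M g \<le> max (\<sigma> g x) (\<sigma> g x0) + (\<phi> x + \<phi> x0 - ln (D x x0))"
        using M_le_max_\<sigma>[of g x x0] g x x0 sub sep by auto
      moreover have "\<phi> x + \<phi> x0 - ln (D x x0) \<le> C" using K[of x x0] x x0 by (auto simp: K_def)
      ultimately show "M g - \<sigma> g x \<le> C" using min[of x] x by auto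
    qed
    also have "(\<Sum>x\<in>T - {x0}. C) \<le> real (card T) * C"
      using C0 by (auto intro!: mult_right_mono card_mono fin)
    also have "M g - \<sigma> g x0 \<le> 2 * M g" using abs_\<sigma>_le[of g x0] g x0 sub by auto
    finally show ?thesis by simp
  qed (use M_bounds(1)[OF g] in simp)
  then show thesis by (rule that)
qed

text \<open>Averages over \<open>k i\<close> steps converge along a diagonal subsequence. Splitting
  off the first step expresses n + 1 steps by the one-step average of n steps; splitting off the
  last shows that n and n + 1 steps differ by a bounded amount. Both errors vanish after division by
  n.\<close>

lemma harmonic_limit:
  obtains k :: "nat \<Rightarrow> nat" and \<zeta> where "strict_mono k"
    "\<And>x. x \<in> carrier G \<Longrightarrow> (\<lambda>i. E (k i) (\<lambda>g. \<sigma> g x) / real (k i)) \<longlonglongrightarrow> \<zeta> x"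
    "\<And>x. x \<in> carrier G \<Longrightarrow> \<zeta> x = E 1 (\<lambda>h. \<zeta> (h \<otimes> x))"
    "\<exists>B. \<forall>x\<in>carrier G. \<bar>\<zeta> x\<bar> \<le> B"
proof -
  define u where "u n x = E n (\<lambda>g. \<sigma> g x)" for n x
  have ub: "\<bar>u n x\<bar> \<le> E n M" if x: "x \<in> carrier G" for n x
  proof -
    have "\<bar>u n x\<bar> \<le> E n (\<lambda>g. \<bar>\<sigma> g x\<bar>)" unfolding u_def by (rule E_abs)
    also have "\<dots> \<le> E n M"
      by (rule E_mono[OF dominated_abs[OF dominated_\<sigma>[OF x]] dominated_M]) (rule abs_\<sigma>_le[OF _ x])
    finally show ?thesis .
  qed
  obtain B where B: "\<And>n. \<bar>E n M / real n\<bar> \<le> B"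
    using convergent_imp_Bseq[of "\<lambda>n. E n M / real n"] chi_lim unfolding Bseq_def convergent_def by auto
  have bd: "\<bar>u n x / real n\<bar> \<le> B" if "x \<in> carrier G" for n x
  proof -
    have "\<bar>u n x / real n\<bar> \<le> \<bar>E n M / real n\<bar>"
      using ub[OF that, of n] by (simp add: abs_div divide_right_mono)
    then show ?thesis using B[of n] by linarith
  qed
  obtain k where k: "strict_mono (k :: nat \<Rightarrow> nat)" "\<And>x. x \<in> carrier G \<Longrightarrow> \<exists>l. (\<lambda>i. u (k i) x / real (k i)) \<longlonglongrightarrow> l"
    by (rule function_convergent_subsequence[OF cnt, of "\<lambda>n x. u n x / real n" B]) (use bd in auto)
  define \<zeta> where "\<zeta> x = lim (\<lambda>i. u (k i) x / real (k i))" for x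
  have \<zeta>: "(\<lambda>i. u (k i) x / real (k i)) \<longlonglongrightarrow> \<zeta> x" if "x \<in> carrier G" for x
    using k(2)[OF that] unfolding \<zeta>_def by (auto simp: limI)
  have \<zeta>B: "\<bar>\<zeta> x\<bar> \<le> B" if "x \<in> carrier G" for x
    by (rule LIMSEQ_le_const2[OF tendsto_rabs[OF \<zeta>[OF that]]]) (use bd[OF that] in auto)
  have harm: "\<zeta> x = E 1 (\<lambda>h. \<zeta> (h \<otimes> x))" if x: "x \<in> carrier G" for x
  proof -
    have domu: "dominated (\<lambda>h. u n (h \<otimes> x))" for n
      by (rule dominated_le[OF dominated_const[of "E n M"]]) (use ub x in auto)
    have first: "u (1 + n) x = E 1 (\<lambda>h. u n (h \<otimes> x)) + u 1 x" for n
    proof -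
      have "u (1 + n) x = E 1 (\<lambda>h. E n (\<lambda>g. \<sigma> (g \<otimes> h) x))"
        unfolding u_def by (rule E_add(1)[OF dominated_\<sigma>[OF x]])
      also have "\<dots> = E 1 (\<lambda>h. u n (h \<otimes> x) + \<sigma> h x)"
      proof (rule E_cong)
        fix h assume h: "h \<in> carrier G"
        have "E n (\<lambda>g. \<sigma> (g \<otimes> h) x) = E n (\<lambda>g. \<sigma> g (h \<otimes> x) + \<sigma> h x)"
          by (rule E_cong) (simp add: \<sigma>_mult h x)
        then show "E n (\<lambda>g. \<sigma> (g \<otimes> h) x) = u n (h \<otimes> x) + \<sigma> h x"
          by (simp only: E_plus[OF dominated_\<sigma>[OF m_closed[OF h x]] dominated_const] E_const u_def)
      qed
      also have "\<dots> = E 1 (\<lambda>h. u n (h \<otimes> x)) + u 1 x"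
        unfolding u_def[of 1] by (rule E_plus[OF domu dominated_\<sigma>[OF x]])
      finally show ?thesis .
    qed
    have last: "\<bar>u (n + 1) x - u n x\<bar> \<le> E 1 M" for n
    proof -
      have bd1: "\<bar>E 1 (\<lambda>h. \<sigma> h (g \<otimes> x))\<bar> \<le> E 1 M" if "g \<in> carrier G" for g
        using ub[of "g \<otimes> x" 1] that x by (simp add: u_def)
      have domg: "dominated (\<lambda>g. E 1 (\<lambda>h. \<sigma> h (g \<otimes> x)))"
        by (rule dominated_le[OF dominated_const[of "E 1 M"]]) (use bd1 in auto)
      have "u (n + 1) x = E n (\<lambda>g. E 1 (\<lambda>h. \<sigma> (h \<otimes> g) x))"
        unfolding u_def by (rule E_add(1)[OF dominated_\<sigma>[OF x]])
      also have "\<dots> = E n (\<lambda>g. E 1 (\<lambda>h. \<sigma> h (g \<otimes> x)) + \<sigma> g x)"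
      proof (rule E_cong)
        fix g assume g: "g \<in> carrier G"
        have "E 1 (\<lambda>h. \<sigma> (h \<otimes> g) x) = E 1 (\<lambda>h. \<sigma> h (g \<otimes> x) + \<sigma> g x)"
          by (rule E_cong) (simp add: \<sigma>_mult g x)
        then show "E 1 (\<lambda>h. \<sigma> (h \<otimes> g) x) = E 1 (\<lambda>h. \<sigma> h (g \<otimes> x)) + \<sigma> g x"
          by (simp only: E_plus[OF dominated_\<sigma>[OF m_closed[OF g x]] dominated_const] E_const)
      qed
      also have "\<dots> = E n (\<lambda>g. E 1 (\<lambda>h. \<sigma> h (g \<otimes> x))) + u n x"
        by (simp only: E_plus[OF domg dominated_\<sigma>[OF x]] u_def)
      finally have "\<bar>u (n + 1) x - u n x\<bar> = \<bar>E n (\<lambda>g. E 1 (\<lambda>h. \<sigma> h (g \<otimes> x)))\<bar>" by simp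
      also have "\<dots> \<le> E n (\<lambda>g. \<bar>E 1 (\<lambda>h. \<sigma> h (g \<otimes> x))\<bar>)" by (rule E_abs)
      also have "\<dots> \<le> E n (\<lambda>g. E 1 M)"
        by (rule E_mono[OF dominated_abs[OF domg] dominated_const bd1])
      finally show ?thesis by simp
    qed
    have diff: "\<bar>E 1 (\<lambda>h. u n (h \<otimes> x)) - u n x\<bar> \<le> 2 * E 1 M" for n
      using first[of n] last[of n] ub[OF x, of 1] by (simp add: add.commute[of n])
    have l1: "(\<lambda>i. E 1 (\<lambda>h. u (k i) (h \<otimes> x) / real (k i))) \<longlonglongrightarrow> E 1 (\<lambda>h. \<zeta> (h \<otimes> x))"
      by (rule E_dominated_convergence[OF dominated_const[of B]]) (use bd \<zeta> x in auto)
    have "(\<lambda>i. 2 * E 1 M / real (k i)) \<longlonglongrightarrow> 0"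
      using LIMSEQ_subseq_LIMSEQ[OF lim_const_over_n k(1), of "2 * E 1 M"] by (simp add: o_def)
    then have "(\<lambda>i. E 1 (\<lambda>h. u (k i) (h \<otimes> x) / real (k i)) - u (k i) x / real (k i)) \<longlonglongrightarrow> 0"
    proof (rule Lim_null_comparison[rotated], intro always_eventually allI)
      fix i
      have "E 1 (\<lambda>h. u (k i) (h \<otimes> x) / real (k i)) - u (k i) x / real (k i) = (E 1 (\<lambda>h. u (k i) (h \<otimes> x)) - u (k i) x) / real (k i)"
        by (simp add: diff_divide_distrib)
      then show "norm (E 1 (\<lambda>h. u (k i) (h \<otimes> x) / real (k i)) - u (k i) x / real (k i)) \<le> 2 * E 1 M / real (k i)"
        using diff[of "k i"] by (simp add: abs_div divide_right_mono del: One_nat_def)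
    qed
    then have "E 1 (\<lambda>h. \<zeta> (h \<otimes> x)) - \<zeta> x = 0"
      by (rule LIMSEQ_unique[OF tendsto_diff[OF l1 \<zeta>[OF x]]])
    then show ?thesis by simp
  qed
  show thesis by (rule that[OF k(1) \<zeta>[unfolded u_def] harm]) (use \<zeta>B in auto)
qed

end

section \<open>The number of points of the limit orbit\<close>

context degenerate_orbit
begin

lemma D_trans':
  assumes "x \<in> carrier G" "y \<in> carrier G" "z \<in> carrier G" "D y x = 0" "D y z = 0"
  shows "D x z = 0"
  using D_trans[OF assms(1-3) _ assms(5)] D_commute[OF assms(1,2)] assms(4) by simp

text \<open>Representatives of the classes of \<open>D x y = 0\<close>; the cardinality is the
  number of points of the limit orbit.\<close>

definition transversal :: "'a set \<Rightarrow> bool" where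
  "transversal T \<longleftrightarrow> indep T \<and> (\<forall>y\<in>carrier G. \<exists>x\<in>T. D x y = 0)"

text \<open>The defect \<open>\<beta>\<close> of the growth rate is a nonnegative harmonic function on the orbit whose sum over
  pairwise separated directions is bounded. Hence it attains its maximum on a finite set of
  directions, which is invariant by the maximum principle.\<close>
lemma finite_orbit:
  assumes \<gamma>: "\<gamma> < chi" "\<And>n. 1 \<le> n \<Longrightarrow> E n \<phi> \<le> real n * \<gamma>"
  obtains T where "transversal T"
proof -
  obtain k :: "nat \<Rightarrow> nat" and \<zeta> where k: "strict_mono k"
    and \<zeta>: "\<And>x. x \<in> carrier G \<Longrightarrow> (\<lambda>i. E (k i) (\<lambda>g. \<sigma> g x) / real (k i)) \<longlonglongrightarrow> \<zeta> x"
    and harm: "\<And>x. x \<in> carrier G \<Longrightarrow> \<zeta> x = E 1 (\<lambda>h. \<zeta> (h \<otimes> x))"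
    and bdd: "\<exists>B. \<forall>x\<in>carrier G. \<bar>\<zeta> x\<bar> \<le> B"
    by (rule harmonic_limit) (rule that)
  define \<beta> where "\<beta> x = chi - \<zeta> x" for x
  have chik: "(\<lambda>i. E (k i) M / real (k i)) \<longlonglongrightarrow> chi"
    using LIMSEQ_subseq_LIMSEQ[OF chi_lim k] by (simp add: o_def)
  have k0: "(\<lambda>i. C / real (k i)) \<longlonglongrightarrow> 0" for C
    using LIMSEQ_subseq_LIMSEQ[OF lim_const_over_n k, of C] by (simp add: o_def)
  have \<beta>lim: "(\<lambda>i. E (k i) (\<lambda>g. M g - \<sigma> g x) / real (k i)) \<longlonglongrightarrow> \<beta> x" if x: "x \<in> carrier G" for x
    using tendsto_diff[OF chik \<zeta>[OF x]]
    by (simp add: \<beta>_def E_diff[OF dominated_M dominated_\<sigma>[OF x]] diff_divide_distrib)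
  have \<beta>0: "0 \<le> \<beta> x" if x: "x \<in> carrier G" for x
  proof (rule LIMSEQ_le_const[OF \<beta>lim[OF x]], intro exI allI impI)
    fix i
    have "0 \<le> M g - \<sigma> g x" if "g \<in> carrier G" for g using abs_\<sigma>_le[OF that x] by linarith
    then show "0 \<le> E (k i) (\<lambda>g. M g - \<sigma> g x) / real (k i)"
      by (intro divide_nonneg_nonneg E_nonneg) auto
  qed
  have \<beta>sum: "sum \<beta> T \<le> 2 * chi" if T: "indep T" for T
  proof -
    have sub: "T \<subseteq> carrier G" using T by (simp add: indep_def)
    obtain C where C: "\<And>g. g \<in> carrier G \<Longrightarrow> (\<Sum>x\<in>T. M g - \<sigma> g x) \<le> 2 * M g + C"
      by (rule indep_sum_le[OF T]) (rule that)
    have d: "dominated (\<lambda>g. M g - \<sigma> g x)" if "x \<in> T" for x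
      using that sub by (intro dominated_diff dominated_M dominated_\<sigma>) auto
    have dsum: "dominated (\<lambda>g. \<Sum>x\<in>T. M g - \<sigma> g x)"
    proof -
      have "finite T" using T by (simp add: indep_def)
      then show ?thesis using d
        by (induction T rule: finite_induct) (auto intro!: dominated_add simp: dominated_const)
    qed
    have le: "(\<Sum>x\<in>T. E n (\<lambda>g. M g - \<sigma> g x) / real n) \<le> 2 * (E n M / real n) + C / real n" for n
    proof -
      have "(\<Sum>x\<in>T. E n (\<lambda>g. M g - \<sigma> g x)) = E n (\<lambda>g. \<Sum>x\<in>T. M g - \<sigma> g x)"
        by (rule E_sum[symmetric]) (rule d)
      also have "\<dots> \<le> E n (\<lambda>g. 2 * M g + C)"
        by (rule E_mono[OF dsum dominated_add[OF dominated_cmult[OF dominated_M] dominated_const] C])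
      also have "\<dots> = 2 * E n M + C"
        by (simp add: E_plus[OF dominated_cmult[OF dominated_M] dominated_const])
      finally have "(\<Sum>x\<in>T. E n (\<lambda>g. M g - \<sigma> g x)) / real n \<le> (2 * E n M + C) / real n"
        by (rule divide_right_mono) simp
      then show ?thesis by (simp add: sum_divide_distrib add_divide_distrib)
    qed
    have "sum \<beta> T \<le> 2 * chi + 0"
    proof (rule LIMSEQ_le)
      show "(\<lambda>i. \<Sum>x\<in>T. E (k i) (\<lambda>g. M g - \<sigma> g x) / real (k i)) \<longlonglongrightarrow> sum \<beta> T"
        by (rule tendsto_sum) (use \<beta>lim sub in auto)
      show "(\<lambda>i. 2 * (E (k i) M / real (k i)) + C / real (k i)) \<longlonglongrightarrow> 2 * chi + 0"
        by (intro tendsto_add tendsto_mult_left chik k0)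
    qed (use le in blast)
    then show ?thesis by simp
  qed
  have \<beta>close: "\<beta> x = \<beta> y" if "x \<in> carrier G" "y \<in> carrier G" "D x y = 0" for x y
  proof -
    have "E n (\<lambda>g. \<sigma> g x) = E n (\<lambda>g. \<sigma> g y)" for n
      by (rule E_cong) (rule \<sigma>_close[OF _ that])
    then show ?thesis using LIMSEQ_unique[OF \<zeta>[OF that(1)]] \<zeta>[OF that(2)] by (simp add: \<beta>_def)
  qed
  \<comment> \<open>Slow growth from the base point is what makes the defect nontrivial.\<close>
  have \<beta>1: "0 < \<beta> \<one>"
  proof -
    have "E n (\<lambda>g. \<sigma> g \<one>) = E n \<phi>" for n by (rule E_cong) (rule \<sigma>_one)
    then have "(\<lambda>i. E (k i) \<phi> / real (k i)) \<longlonglongrightarrow> \<zeta> \<one>" using \<zeta>[OF one_closed] by simp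
    moreover have "E (k i) \<phi> / real (k i) \<le> \<gamma>" if "i \<ge> 1" for i
    proof -
      have "1 \<le> k i" using seq_suble[OF k, of i] that by simp
      then show ?thesis using \<gamma>(2)[of "k i"] by (simp add: field_simps)
    qed
    ultimately have "\<zeta> \<one> \<le> \<gamma>" by (intro LIMSEQ_le_const2) auto
    then show ?thesis using \<gamma>(1) by (simp add: \<beta>_def)
  qed
  \<comment> \<open>Each member of such a set has mass at least \<open>\<beta> \<one>\<close>, so
    the bound on sums limits the cardinality; a set of maximal cardinality meets every class of at
    least this mass.\<close>
  define P where "P T \<longleftrightarrow> indep T \<and> (\<forall>x\<in>T. \<beta> \<one> \<le> \<beta> x)" for T
  have cardP: "card T \<le> nat \<lfloor>2 * chi / \<beta> \<one>\<rfloor>" if "P T" for T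
  proof -
    have "real (card T) * \<beta> \<one> \<le> sum \<beta> T"
      using that by (intro sum_bounded_below) (auto simp: P_def)
    also have "\<dots> \<le> 2 * chi" using that \<beta>sum by (auto simp: P_def)
    finally have "real (card T) \<le> 2 * chi / \<beta> \<one>" using \<beta>1 by (simp add: field_simps)
    then show ?thesis by linarith
  qed
  have P1: "P {\<one>}" by (simp add: P_def indep_def)
  obtain T where T: "P T" and Tmax: "\<And>T'. P T' \<Longrightarrow> card T' \<le> card T"
    using ex_has_greatest_nat[of P "{\<one>}" card "Suc (nat \<lfloor>2 * chi / \<beta> \<one>\<rfloor>)", OF P1] cardP le_imp_less_Suc by blast
  have Tf: "finite T" and Tc: "T \<subseteq> carrier G" using T by (auto simp: P_def indep_def)
  have cover: "\<exists>x\<in>T. D x y = 0" if y: "y \<in> carrier G" "\<beta> \<one> \<le> \<beta> y" for y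
  proof (rule ccontr)
    assume H: "\<not> ?thesis"
    then have "y \<notin> T" using D_self[OF y(1)] by blast
    moreover have "D x y \<noteq> 0 \<and> D y x \<noteq> 0" if "x \<in> T" for x
      using H that D_commute[of x y] Tc y(1) by auto
    then have "P (insert y T)"
      using T y unfolding P_def indep_def by auto
    ultimately show False using Tmax[of "insert y T"] Tf by simp
  qed
  have Tne: "T \<noteq> {}" using cover[OF one_closed] by auto
  define s where "s = Max (\<beta> ` T)"
  have sT: "s \<in> \<beta> ` T" unfolding s_def using Tf Tne by simp
  have s_ge: "\<beta> \<one> \<le> s" using sT T by (auto simp: P_def)
  have s_max: "\<beta> y \<le> s" if y: "y \<in> carrier G" for y
  proof (cases "\<beta> \<one> \<le> \<beta> y")
    case True
    then obtain x where x: "x \<in> T" "D x y = 0" using cover[OF y] by blast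
    then have "\<beta> y = \<beta> x" using \<beta>close[of x y] y Tc by auto
    also have "\<dots> \<le> s" unfolding s_def using Tf x by simp
    finally show ?thesis .
  qed (use s_ge in simp)
  define F where "F = {x \<in> carrier G. \<beta> x = s}"
  define T' where "T' = {x \<in> T. \<beta> x = s}"
  have T'f: "finite T'" "T' \<subseteq> F" using Tf Tc by (auto simp: T'_def F_def)
  have sep: "x = y" if "x \<in> T'" "y \<in> T'" "D x y = 0" for x y
    using T that by (auto simp: P_def indep_def T'_def)
  have coverF: "\<exists>x\<in>T'. D x y = 0" if "y \<in> F" for y
  proof -
    have y: "y \<in> carrier G" "\<beta> y = s" using that by (auto simp: F_def)
    then obtain x where "x \<in> T" "D x y = 0" using cover[of y] s_ge by auto
    then show ?thesis using \<beta>close[of x y] y Tc by (auto simp: T'_def)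
  qed
  \<comment> \<open>Maximum principle: the value at \<open>x\<close> is maximal and equals the mean
    over one step, so every step in the support attains it.\<close>
  have fwd: "h \<otimes> x \<in> F" if h: "h \<in> set_pmf m" and x: "x \<in> F" for h x
  proof -
    have xc: "x \<in> carrier G" and hc: "h \<in> carrier G" using x h supp by (auto simp: F_def)
    obtain B where B: "\<And>x. x \<in> carrier G \<Longrightarrow> \<bar>\<zeta> x\<bar> \<le> B" using bdd by blast
    have dz: "dominated (\<lambda>h. \<zeta> (h \<otimes> x))"
      by (rule dominated_le[OF dominated_const[of B]]) (use B xc in auto)
    have db: "dominated (\<lambda>h. s - \<beta> (h \<otimes> x))"
      unfolding \<beta>_def by (intro dominated_diff dominated_const dz)
    have "E 1 (\<lambda>h. s - \<beta> (h \<otimes> x)) = s - (chi - E 1 (\<lambda>h. \<zeta> (h \<otimes> x)))"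
      unfolding \<beta>_def
      by (simp only: E_diff[OF dominated_const dominated_diff[OF dominated_const dz]] E_diff[OF dominated_const dz] E_const)
    also have "\<dots> = 0" using harm[OF xc] x by (simp add: F_def \<beta>_def)
    finally have "(\<integral>h. s - \<beta> (h \<otimes> x) \<partial>measure_pmf m) = 0" by (simp only: conv_pow_1)
    moreover have "integrable (measure_pmf m) (\<lambda>h. s - \<beta> (h \<otimes> x))"
      using integrable_dominated[OF db, of 1] by (simp only: conv_pow_1)
    moreover have "AE h in measure_pmf m. 0 \<le> s - \<beta> (h \<otimes> x)"
      by (rule AE_pmfI) (use s_max supp xc in auto)
    ultimately have "AE h in measure_pmf m. s - \<beta> (h \<otimes> x) = 0"
      by (simp add: integral_nonneg_eq_0_iff_AE)
    then have "s - \<beta> (h \<otimes> x) = 0" using h by (simp add: AE_measure_pmf_iff)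
    then show ?thesis using hc xc by (simp add: F_def)
  qed
  \<comment> \<open>Generating the group also involves inverses. Translation by \<open>h\<close>
    maps the finitely many maximal classes injectively into themselves, hence permutes them, so each
    has a preimage among them.\<close>
  have bwd: "inv h \<otimes> y \<in> F" if h: "h \<in> set_pmf m" and y: "y \<in> F" for h y
  proof -
    have hc: "h \<in> carrier G" and yc: "y \<in> carrier G" using h y supp by (auto simp: F_def)
    have T'c: "x \<in> carrier G" if "x \<in> T'" for x using that T'f by (auto simp: F_def)
    have "\<forall>x\<in>T'. \<exists>z\<in>T'. D z (h \<otimes> x) = 0" using coverF fwd[OF h] T'f by blast
    then obtain \<pi> where \<pi>: "\<And>x. x \<in> T' \<Longrightarrow> \<pi> x \<in> T' \<and> D (\<pi> x) (h \<otimes> x) = 0" by metis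
    have "inj_on \<pi> T'"
    proof (rule inj_onI)
      fix x x' assume x: "x \<in> T'" "x' \<in> T'" "\<pi> x = \<pi> x'"
      have "D (h \<otimes> x) (h \<otimes> x') = 0"
      proof (rule D_trans')
        show "D (\<pi> x) (h \<otimes> x) = 0" "D (\<pi> x) (h \<otimes> x') = 0"
          using \<pi>[OF x(1)] \<pi>[OF x(2)] unfolding x(3) by blast+
        show "\<pi> x \<in> carrier G" using \<pi>[OF x(1)] T'c by blast
      qed (use T'c x(1,2) hc in auto)
      then show "x = x'" using sep[OF x(1,2)] T'c[OF x(1)] T'c[OF x(2)] D_translate[OF hc] by simp
    qed
    then have surj: "\<pi> ` T' = T'" using \<pi> T'f(1) by (intro endo_inj_surj) auto
    obtain z where z: "z \<in> T'" "D z y = 0" using coverF[OF y] by blast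
    have "z \<in> \<pi> ` T'" using z(1) by (simp only: surj)
    then obtain x where x: "x \<in> T'" "\<pi> x = z" by (elim imageE) (rule that; simp)
    have "D (h \<otimes> x) y = 0"
      using D_trans'[OF m_closed[OF hc T'c[OF x(1)]] T'c[OF z(1)] yc] \<pi>[OF x(1)] z(2) unfolding x(2) by blast
    moreover have "h \<otimes> (inv h \<otimes> y) = y" using hc yc by (simp add: m_assoc[symmetric])
    ultimately have "D x (inv h \<otimes> y) = 0"
      using D_translate[OF hc, of x "inv h \<otimes> y"] T'c[OF x(1)] hc yc by simp
    then have "\<beta> (inv h \<otimes> y) = \<beta> x" using \<beta>close[of x "inv h \<otimes> y"] T'c[OF x(1)] hc yc by simp
    then show ?thesis using x hc yc by (simp add: F_def T'_def)
  qed
  have inv: "\<forall>x\<in>F. g \<otimes> x \<in> F" if "g \<in> generate G (set_pmf m)" for g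
    using that
  proof (induction rule: generate.induct)
    case one
    then show ?case by (auto simp: F_def)
  next
    case (eng h1 h2)
    then have "h1 \<in> carrier G" "h2 \<in> carrier G" using gen by auto
    then show ?case using eng by (auto simp: F_def m_assoc)
  qed (use fwd bwd in auto)
  \<comment> \<open>The group acts transitively on itself, so a nonempty invariant set is
    everything.\<close>
  have all: "y \<in> F" if y: "y \<in> carrier G" for y
  proof -
    obtain x where x: "x \<in> F" using sT Tc by (auto simp: F_def)
    then have xc: "x \<in> carrier G" by (simp add: F_def)
    have "(y \<otimes> inv x) \<otimes> x \<in> F" using inv[of "y \<otimes> inv x"] x xc y gen by simp
    then show ?thesis using xc y by (simp add: m_assoc)
  qed
  have "transversal T'"
    unfolding transversal_def indep_def using T'f sep coverF all by (auto simp: F_def)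
  then show thesis by (rule that)
qed

text \<open>Limit of the distance between the lines themselves: \<open>D\<close> still involves the
  lengths of the vectors, whereas \<open>nd\<close> depends only on the classes of its
  arguments.\<close>

definition nd :: "'a \<Rightarrow> 'a \<Rightarrow> real" where "nd x y = D x y * exp (- \<phi> x - \<phi> y)"

lemma nd_close:
  assumes x: "x \<in> carrier G" and y: "y \<in> carrier G" and z: "z \<in> carrier G" and D0: "D x y = 0"
  shows "nd x z = nd y z"
proof -
  have *: "D x z * exp (\<phi> y) \<le> D y z * exp (\<phi> x)" if "x \<in> carrier G" "y \<in> carrier G" "D x y = 0" for x y
  proof -
    have "0 \<le> D y z * exp (\<phi> x)" using D_nonneg[OF that(2) z] by simp
    then show ?thesis using D_ultra[OF that(1,2) z] that(3) by (simp add: max_absorb1)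
  qed
  have "D x z * exp (\<phi> y) = D y z * exp (\<phi> x)"
    using *[OF x y D0] *[OF y x] D0 D_commute[OF x y] by simp
  then have "D x z * exp (- \<phi> x) = D y z * exp (- \<phi> y)"
    by (simp add: exp_minus field_simps)
  then have "D x z * exp (- \<phi> x) * exp (- \<phi> z) = D y z * exp (- \<phi> y) * exp (- \<phi> z)" by simp
  then show ?thesis unfolding nd_def by (simp add: mult.assoc exp_add[symmetric])
qed

lemma nd_commute: "x \<in> carrier G \<Longrightarrow> y \<in> carrier G \<Longrightarrow> nd x y = nd y x"
  unfolding nd_def using D_commute[of x y] by (simp add: algebra_simps)

lemma nd_translate:
  assumes "g \<in> carrier G" "x \<in> carrier G" "y \<in> carrier G"
  shows "nd (g \<otimes> x) (g \<otimes> y) = nd x y * exp (- (\<sigma> g x + \<sigma> g y))"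
  unfolding nd_def \<sigma>_def D_translate[OF assms] by (simp add: mult.assoc exp_add[symmetric])

lemma transversal_perm:
  assumes T: "transversal T" and g: "g \<in> carrier G"
  obtains \<pi> where "bij_betw \<pi> T T" "\<And>x. x \<in> T \<Longrightarrow> D (g \<otimes> x) (\<pi> x) = 0"
proof -
  have Tf: "finite T" and Tc: "\<And>x. x \<in> T \<Longrightarrow> x \<in> carrier G"
    and sep: "\<And>x y. x \<in> T \<Longrightarrow> y \<in> T \<Longrightarrow> D x y = 0 \<Longrightarrow> x = y"
    and cover: "\<And>y. y \<in> carrier G \<Longrightarrow> \<exists>x\<in>T. D x y = 0"
    using T by (auto simp: transversal_def indep_def)
  have "\<forall>x\<in>T. \<exists>z\<in>T. D (g \<otimes> x) z = 0" using cover D_commute g Tc by (metis m_closed)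
  then obtain \<pi> where \<pi>: "\<And>x. x \<in> T \<Longrightarrow> \<pi> x \<in> T" "\<And>x. x \<in> T \<Longrightarrow> D (g \<otimes> x) (\<pi> x) = 0" by metis
  have inj: "inj_on \<pi> T"
  proof (rule inj_onI)
    fix x x' assume x: "x \<in> T" "x' \<in> T" "\<pi> x = \<pi> x'"
    have "D (\<pi> x) (g \<otimes> x') = 0" using \<pi>(2)[OF x(2)] x \<pi>(1) D_commute g Tc by (metis m_closed)
    then have "D (g \<otimes> x) (g \<otimes> x') = 0"
      using D_trans[of "g \<otimes> x" "\<pi> x" "g \<otimes> x'"] \<pi>(2)[OF x(1)] \<pi>(1)[OF x(1)] x(1,2) g Tc by blast
    then show "x = x'" using sep x D_translate[OF g] Tc by simp
  qed
  have "\<pi> ` T = T" using \<pi>(1) Tf inj by (intro endo_inj_surj) auto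
  then have "bij_betw \<pi> T T" using inj by (simp add: bij_betw_def)
  then show thesis using \<pi>(2) by (rule that)
qed

text \<open>Translation by \<open>g\<close> permutes the classes, so the product of
  \<open>nd\<close> over ordered pairs of distinct points is unchanged; by
  \<open>nd_translate\<close> it is also multiplied by the exponential of -2 (card T - 1) times this
  sum.\<close>

lemma transversal_sum_\<sigma>:
  assumes T: "transversal T" and card: "2 \<le> card T" and g: "g \<in> carrier G"
  shows "(\<Sum>x\<in>T. \<sigma> g x) = 0"
proof -
  have Tf: "finite T" and Tc: "\<And>x. x \<in> T \<Longrightarrow> x \<in> carrier G"
    and sep: "\<And>x y. x \<in> T \<Longrightarrow> y \<in> T \<Longrightarrow> x \<noteq> y \<Longrightarrow> D x y \<noteq> 0"
    using T by (auto simp: transversal_def indep_def)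
  obtain \<pi> where \<pi>: "bij_betw \<pi> T T" "\<And>x. x \<in> T \<Longrightarrow> D (g \<otimes> x) (\<pi> x) = 0"
    using transversal_perm[OF T g] by metis
  have \<pi>T: "\<pi> x \<in> T" if "x \<in> T" for x using \<pi>(1) that by (auto simp: bij_betw_def)
  define f where "f x y = (if x = y then 0 else ln (nd x y))" for x y
  define q where "q x y = (if x = y then 0 else \<sigma> g x + \<sigma> g y)" for x y
  have fq: "f (\<pi> x) (\<pi> y) = f x y - q x y" if x: "x \<in> T" and y: "y \<in> T" for x y
  proof (cases "x = y")
    case False
    then have ne: "\<pi> x \<noteq> \<pi> y" using \<pi>(1) x y by (auto simp: bij_betw_def inj_on_def)
    have c: "x \<in> carrier G" "y \<in> carrier G" "\<pi> x \<in> carrier G" "\<pi> y \<in> carrier G" "g \<otimes> x \<in> carrier G" "g \<otimes> y \<in> carrier G"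
      using Tc \<pi>T x y g by auto
    have "nd (\<pi> x) (\<pi> y) = nd (g \<otimes> x) (\<pi> y)"
      using nd_close[OF c(5) c(3) c(4)] \<pi>(2)[OF x] by simp
    also have "\<dots> = nd (\<pi> y) (g \<otimes> x)" by (rule nd_commute[OF c(5,4)])
    also have "\<dots> = nd (g \<otimes> y) (g \<otimes> x)"
      using nd_close[OF c(6) c(4) c(5)] \<pi>(2)[OF y] by simp
    also have "\<dots> = nd (g \<otimes> x) (g \<otimes> y)" by (rule nd_commute[OF c(6,5)])
    also have "\<dots> = nd x y * exp (- (\<sigma> g x + \<sigma> g y))" by (rule nd_translate[OF g c(1,2)])
    finally have eq: "nd (\<pi> x) (\<pi> y) = nd x y * exp (- (\<sigma> g x + \<sigma> g y))" .
    have "nd x y > 0" unfolding nd_def using D_nonneg[OF c(1,2)] sep[OF x y False] by simp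
    then show ?thesis using False ne by (simp add: f_def q_def eq ln_mult)
  qed (simp add: f_def q_def)
  have "(\<Sum>x\<in>T. \<Sum>y\<in>T. f x y) = (\<Sum>x\<in>T. \<Sum>y\<in>T. f (\<pi> x) (\<pi> y))"
    by (subst sum.reindex_bij_betw[OF \<pi>(1), symmetric]) (rule sum.cong[OF refl], rule sum.reindex_bij_betw[OF \<pi>(1), symmetric])
  also have "\<dots> = (\<Sum>x\<in>T. \<Sum>y\<in>T. f x y - q x y)"
    by (intro sum.cong refl fq)
  finally have "(\<Sum>x\<in>T. \<Sum>y\<in>T. q x y) = 0" by (simp add: sum_subtractf)
  moreover have "(\<Sum>y\<in>T. q x y) = real (card T) * \<sigma> g x + (\<Sum>y\<in>T. \<sigma> g y) - 2 * \<sigma> g x" if x: "x \<in> T" for x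
  proof -
    have "q x y = (\<sigma> g x + \<sigma> g y) - (if y = x then 2 * \<sigma> g x else 0)" for y by (auto simp: q_def)
    then have "(\<Sum>y\<in>T. q x y) = (\<Sum>y\<in>T. \<sigma> g x + \<sigma> g y) - (\<Sum>y\<in>T. if y = x then 2 * \<sigma> g x else 0)"
      by (simp only: sum_subtractf)
    then show ?thesis using Tf x by (simp add: sum.distrib)
  qed
  ultimately have "(\<Sum>x\<in>T. real (card T) * \<sigma> g x + (\<Sum>y\<in>T. \<sigma> g y) - 2 * \<sigma> g x) = 0" by simp
  then have "2 * (real (card T) - 1) * (\<Sum>x\<in>T. \<sigma> g x) = 0"
    by (simp add: sum.distrib sum_subtractf sum_distrib_left[symmetric] algebra_simps)
  then show ?thesis using card by simp
qed

text \<open>The group permutes two lines, as monomial matrices do. The stretchings on them are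
  opposite, \<open>\<epsilon>\<close> records whether they are exchanged, and the sign in
  \<open>\<tau>\<close> turns the cocycle into an action on the real line by translations and
  reflections.\<close>

lemma transversal_card_2:
  assumes T: "transversal T" and card: "card T = 2"
  shows "chi \<le> 0"
proof -
  obtain x1 x2 where T2: "T = {x1, x2}" "x1 \<noteq> x2" using card by (auto simp: card_2_iff)
  have c: "x1 \<in> carrier G" "x2 \<in> carrier G" and sep: "D x1 x2 \<noteq> 0"
    and cov: "\<And>y. y \<in> carrier G \<Longrightarrow> D x1 y = 0 \<or> D x2 y = 0"
    using T T2 by (auto simp: transversal_def indep_def)
  have opp: "\<sigma> g x2 = - \<sigma> g x1" if "g \<in> carrier G" for g
    using transversal_sum_\<sigma>[OF T _ that] card T2 by simp
  define \<epsilon> :: "'a \<Rightarrow> real" where "\<epsilon> g = (if D x1 (g \<otimes> x1) = 0 then 1 else - 1)" for g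
  define \<tau> where "\<tau> g = \<epsilon> g * \<sigma> g x1" for g
  have e1: "D x1 (g \<otimes> x1) = 0 \<longleftrightarrow> \<epsilon> g = 1" for g by (simp add: \<epsilon>_def)
  have e2: "D x2 (g \<otimes> x1) = 0" if "\<epsilon> g \<noteq> 1" "g \<in> carrier G" for g
    using that cov[of "g \<otimes> x1"] c by (auto simp: e1)
  have \<sigma>\<epsilon>: "\<sigma> h (g \<otimes> x1) = \<epsilon> g * \<sigma> h x1" if g: "g \<in> carrier G" and h: "h \<in> carrier G" for g h
  proof (cases "\<epsilon> g = 1")
    case True
    then show ?thesis using \<sigma>_close[of h x1 "g \<otimes> x1"] e1[of g] g h c by simp
  next
    case False
    then have "\<sigma> h (g \<otimes> x1) = \<sigma> h x2" using \<sigma>_close[of h x2 "g \<otimes> x1"] e2[OF False g] g h c by simp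
    then show ?thesis using opp[OF h] False by (auto simp: \<epsilon>_def split: if_splits)
  qed
  have \<epsilon>mult: "\<epsilon> (h \<otimes> g) = \<epsilon> h * \<epsilon> g" if g: "g \<in> carrier G" and h: "h \<in> carrier G" for g h
  proof -
    have cc: "h \<otimes> x1 \<in> carrier G" "h \<otimes> x2 \<in> carrier G" "g \<otimes> x1 \<in> carrier G" "(h \<otimes> g) \<otimes> x1 \<in> carrier G" 
      "h \<otimes> (g \<otimes> x1) = (h \<otimes> g) \<otimes> x1"
      using g h c by (auto simp: m_assoc)
    have tr: "D a b = 0 \<Longrightarrow> D (h \<otimes> a) (h \<otimes> b) = 0" if "a \<in> carrier G" "b \<in> carrier G" for a b
      using D_translate[OF h that] by simp
    have sep2: "D (h \<otimes> x1) (h \<otimes> x2) \<noteq> 0" using D_translate[OF h c] sep by simp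
    show ?thesis
    proof (cases "\<epsilon> g = 1")
      case True
      then have "D (h \<otimes> x1) ((h \<otimes> g) \<otimes> x1) = 0" using tr[of x1 "g \<otimes> x1"] e1[of g] c cc by simp
      then have "D x1 (h \<otimes> x1) = 0 \<longleftrightarrow> D x1 ((h \<otimes> g) \<otimes> x1) = 0"
        using D_trans D_commute c cc by metis
      then show ?thesis using True by (simp add: \<epsilon>_def)
    next
      case False
      then have "D (h \<otimes> x2) ((h \<otimes> g) \<otimes> x1) = 0" using tr[of x2 "g \<otimes> x1"] e2[OF False g] c cc by simp
      then have "D x1 (h \<otimes> x2) = 0 \<longleftrightarrow> D x1 ((h \<otimes> g) \<otimes> x1) = 0"
        using D_trans D_commute c cc by metis
      moreover have "D x1 (h \<otimes> x2) = 0 \<longleftrightarrow> D x1 (h \<otimes> x1) \<noteq> 0"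
        using cov[OF cc(1)] cov[OF cc(2)] sep2 D_trans D_commute c cc by metis
      ultimately show ?thesis using False by (auto simp: \<epsilon>_def)
    qed
  qed
  have pm: "\<epsilon> g = 1 \<or> \<epsilon> g = -1" for g by (simp add: \<epsilon>_def)
  have rec: "\<tau> (h \<otimes> g) = \<epsilon> h * \<tau> g + \<tau> h" if g: "g \<in> carrier G" and h: "h \<in> carrier G" for g h
    using pm[of g] by (auto simp: \<tau>_def \<epsilon>mult[OF g h] \<sigma>_mult[OF g h c(1)] \<sigma>\<epsilon>[OF g h] algebra_simps)
  have abs\<tau>: "\<bar>\<tau> g\<bar> = \<bar>\<sigma> g x1\<bar>" for g using pm[of g] by (auto simp: \<tau>_def)
  have d\<tau>: "dominated \<tau>"
    by (rule dominated_le[OF dominated_M]) (use abs_\<sigma>_le c abs\<tau> in simp)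
  have d\<epsilon>: "dominated (\<lambda>g. 1 - \<epsilon> g)"
    by (rule dominated_le[OF dominated_const[of 2]]) (use pm in \<open>force simp: \<epsilon>_def\<close>)
  have d\<epsilon>': "dominated \<epsilon>"
    by (rule dominated_le[OF dominated_const[of 1]]) (simp add: \<epsilon>_def)
  \<comment> \<open>If no step in the support exchanged the two classes, no group element would; but
    \<open>x2 \<otimes> inv x1\<close> carries \<open>x1\<close> to \<open>x2\<close>.\<close>
  have refl: "E 1 \<epsilon> < 1"
  proof (rule ccontr)
    assume "\<not> ?thesis"
    moreover have "E 1 (\<lambda>g. 1 - \<epsilon> g) = 1 - E 1 \<epsilon>"
      by (simp only: E_diff[OF dominated_const d\<epsilon>'] E_const)
    moreover have "0 \<le> E 1 (\<lambda>g. 1 - \<epsilon> g)" by (rule E_nonneg) (simp add: \<epsilon>_def)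
    ultimately have "E 1 (\<lambda>g. 1 - \<epsilon> g) = 0" by linarith
    then have "(\<integral>g. 1 - \<epsilon> g \<partial>measure_pmf m) = 0" by (simp only: conv_pow_1)
    moreover have "integrable (measure_pmf m) (\<lambda>g. 1 - \<epsilon> g)"
      using integrable_dominated[OF d\<epsilon>, of 1] by (simp only: conv_pow_1)
    moreover have "AE g in measure_pmf m. 0 \<le> 1 - \<epsilon> g" by (rule AE_pmfI) (simp add: \<epsilon>_def)
    ultimately have "AE g in measure_pmf m. 1 - \<epsilon> g = 0"
      by (simp add: integral_nonneg_eq_0_iff_AE)
    then have one: "\<epsilon> h = 1" if "h \<in> set_pmf m" for h using that by (auto simp: AE_measure_pmf_iff)
    have \<epsilon>one: "\<epsilon> \<one> = 1" using D_self c by (simp add: \<epsilon>_def)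
    have "\<epsilon> g = 1" if "g \<in> generate G (set_pmf m)" for g
      using that
    proof (induction rule: generate.induct)
      case (inv h)
      then have "h \<in> carrier G" using supp by auto
      then show ?case using \<epsilon>mult[of h "inv h"] \<epsilon>one one[OF inv] by simp
    next
      case (eng h1 h2)
      then show ?case using \<epsilon>mult[of h2 h1] gen by simp
    qed (use \<epsilon>one one in auto)
    then have "\<epsilon> (x2 \<otimes> inv x1) = 1" using gen c by simp
    then have "D x1 x2 = 0" using e1[of "x2 \<otimes> inv x1"] c by (simp add: m_assoc)
    then show False using sep by simp
  qed
  define K where "K = \<phi> x1 + \<phi> x2 - ln (D x1 x2)"
  have M\<tau>: "M g \<le> \<bar>\<tau> g\<bar> + K" if g: "g \<in> carrier G" for g
    using M_le_max_\<sigma>[OF g c sep] opp[OF g] unfolding abs\<tau> K_def by linarith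
  have "chi \<le> 0 + e" if e: "e > 0" for e
  proof -
    obtain C where C: "\<And>n. E n (\<lambda>g. \<bar>\<tau> g\<bar>) \<le> C + real n * e"
      by (rule dihedral_drift[OF d\<tau> pm rec refl e]) (assumption+, rule that)
    have "E n M \<le> (C + K) + real n * e" for n
    proof -
      have "E n M \<le> E n (\<lambda>g. \<bar>\<tau> g\<bar> + K)"
        by (rule E_mono[OF dominated_M dominated_add[OF dominated_abs[OF d\<tau>] dominated_const] M\<tau>])
      also have "\<dots> = E n (\<lambda>g. \<bar>\<tau> g\<bar>) + K"
        by (simp only: E_plus[OF dominated_abs[OF d\<tau>] dominated_const] E_const)
      finally show ?thesis using C[of n] by linarith
    qed
    then have "chi \<le> e" by (rule chi_le)
    then show ?thesis by simp
  qed
  then show ?thesis by (rule field_le_epsilon)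
qed

text \<open>The stretchings add up to zero, so \<open>indep_sum_le\<close> bounds (card T - 2) M g
  by a constant; with at least three points \<open>M\<close> is bounded and cannot grow
  linearly.\<close>

lemma transversal_card_ge3:
  assumes T: "transversal T" and card: "3 \<le> card T"
  shows "chi \<le> 0"
proof -
  obtain C where C: "\<And>g. g \<in> carrier G \<Longrightarrow> (\<Sum>x\<in>T. M g - \<sigma> g x) \<le> 2 * M g + C"
    using indep_sum_le[of T] T by (metis transversal_def)
  have "M g \<le> C" if g: "g \<in> carrier G" for g
  proof -
    have "real (card T) * M g \<le> 2 * M g + C"
      using C[OF g] transversal_sum_\<sigma>[OF T _ g] card by (simp add: sum_subtractf)
    moreover have "3 * M g \<le> real (card T) * M g"
      using M_bounds(1)[OF g] card by (intro mult_right_mono) auto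
    ultimately show ?thesis by linarith
  qed
  then have "E n M \<le> C + real n * 0" for n
    using E_mono[OF dominated_M dominated_const[of C], of n] by simp
  then show ?thesis by (rule chi_le)
qed

lemma orbit_collapses:
  assumes \<gamma>: "\<gamma> < chi" "\<And>n. 1 \<le> n \<Longrightarrow> E n \<phi> \<le> real n * \<gamma>" and chi: "0 < chi" and x: "x \<in> carrier G"
  shows "D x \<one> = 0"
proof -
  obtain T where T: "transversal T" by (rule finite_orbit[OF \<gamma>]) (assumption, rule that)
  have "finite T" "T \<noteq> {}" using T x by (auto simp: transversal_def indep_def)
  then have "card T \<noteq> 0" by simp
  moreover have "card T \<noteq> 2" "\<not> 3 \<le> card T"
    using transversal_card_2[OF T] transversal_card_ge3[OF T] chi by auto
  ultimately have "card T = 1" by linarith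
  then obtain z where "T = {z}" by (auto simp: card_1_singleton_iff)
  then have "z \<in> carrier G" "D z x = 0" "D z \<one> = 0"
    using T x by (auto simp: transversal_def indep_def)
  then show ?thesis using D_trans[of x z \<one>] D_commute[of x z] x by simp
qed

end

text \<open>Two diagonal extractions supply the limits \<open>\<phi>\<close> and \<open>D\<close> of
  a degenerate orbit. Slowness is assumed for each fixed n, so it survives the limit by dominated
  convergence, and \<open>orbit_collapses\<close> applies.\<close>

lemma (in degeneration) slow_directions_almost_invariant:
  assumes v: "\<And>j. norm (v j) = 1" and \<gamma>: "\<gamma> < chi" and chi: "0 < chi"
    and slow: "\<And>n. 1 \<le> n \<Longrightarrow> \<forall>\<^sub>F j in sequentially. E n (\<lambda>g. ln (norm (A j g *v v j))) \<le> real n * (\<gamma> * L j)"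
  obtains r where "strict_mono (r :: nat \<Rightarrow> nat)"
    "\<And>x. x \<in> carrier G \<Longrightarrow> (\<lambda>j. cmod (wedge (A (r j) x *v v (r j)) (v (r j))) powr (1 / L (r j))) \<longlonglongrightarrow> 0"
proof -
  obtain r1 \<phi> where r1: "strict_mono (r1 :: nat \<Rightarrow> nat)"
    and \<phi>1: "\<And>g. g \<in> carrier G \<Longrightarrow> (\<lambda>j. ln (norm (A (r1 j) g *v v (r1 j))) / L (r1 j)) \<longlonglongrightarrow> \<phi> g"
    by (rule direction_subseq[where v=v, OF v]) (rule that)
  let ?w = "\<lambda>j x y. cmod (wedge (A j x *v v j) (A j y *v v j)) powr (1 / L j)"
  let ?f = "\<lambda>j p. ?w (r1 j) (fst p) (snd p) / exp (b (fst p) + b (snd p))"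
  have wb: "?w j x y \<le> exp (b x + b y)" if x: "x \<in> carrier G" and y: "y \<in> carrier G" for j x y
  proof -
    have *: "norm (A j z *v v j) \<le> exp (L j * b z)" if z: "z \<in> carrier G" for z
    proof -
      have "norm (A j z *v v j) \<le> norm (A j z)" using A_vec_bounds(1)[OF z, where j=j and x="v j"] v by simp
      also have "\<dots> = exp (ln (norm (A j z)))" using A_nz[OF z] by simp
      also have "\<dots> \<le> exp (L j * b z)" using A_bound[OF z] by simp
      finally show ?thesis .
    qed
    have "cmod (wedge (A j x *v v j) (A j y *v v j)) \<le> exp (L j * b x) * exp (L j * b y)"
      by (intro order_trans[OF norm_wedge_le] mult_mono * x y) auto
    also have "\<dots> = exp (L j * (b x + b y))" by (simp add: exp_add[symmetric] distrib_left)
    finally have "?w j x y \<le> exp (L j * (b x + b y)) powr (1 / L j)"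
      using L_pos[of j] by (intro powr_mono2) auto
    also have "\<dots> = exp (b x + b y)" using L_pos[of j] by (simp add: powr_def)
    finally show ?thesis .
  qed
  have "norm (?f j p) \<le> 1" if "p \<in> carrier G \<times> carrier G" for j p
    using wb[of "fst p" "snd p" "r1 j"] that by auto
  then obtain r2 where r2: "strict_mono (r2 :: nat \<Rightarrow> nat)"
    and w2: "\<And>p. p \<in> carrier G \<times> carrier G \<Longrightarrow> \<exists>l. (\<lambda>j. ?f (r2 j) p) \<longlonglongrightarrow> l"
    by (rule function_convergent_subsequence[OF countable_SIGMA[OF cnt cnt], of ?f 1]) (assumption, rule that)
  define r where "r j = r1 (r2 j)" for j
  have r: "strict_mono r" using strict_mono_o[OF r1 r2] by (simp add: r_def[abs_def] o_def)
  have \<phi>: "(\<lambda>j. ln (norm (A (r j) g *v v (r j))) / L (r j)) \<longlonglongrightarrow> \<phi> g" if "g \<in> carrier G" for g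
    using LIMSEQ_subseq_LIMSEQ[OF \<phi>1[OF that] r2] by (simp add: r_def o_def)
  define D where "D x y = lim (\<lambda>j. ?w (r j) x y)" for x y
  have D: "(\<lambda>j. ?w (r j) x y) \<longlonglongrightarrow> D x y" if "x \<in> carrier G" "y \<in> carrier G" for x y
  proof -
    have "(x, y) \<in> carrier G \<times> carrier G" using that by simp
    then obtain l where "(\<lambda>j. ?f (r2 j) (x, y)) \<longlonglongrightarrow> l" using w2 by blast
    then have "(\<lambda>j. exp (b x + b y) * ?f (r2 j) (x, y)) \<longlonglongrightarrow> exp (b x + b y) * l" by (rule tendsto_mult_left)
    then have "(\<lambda>j. ?w (r j) x y) \<longlonglongrightarrow> exp (b x + b y) * l" by (simp add: r_def)
    then show ?thesis unfolding D_def by (simp add: limI)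
  qed
  interpret s: degeneration G m b "\<lambda>j. A (r j)" "\<lambda>j. L (r j)" M by (rule subseq[OF r])
  interpret o: degenerate_orbit G m b "\<lambda>j. A (r j)" "\<lambda>j. L (r j)" M "\<lambda>j. v (r j)" \<phi> D
    by unfold_locales (use v \<phi> D in auto)
  have slow\<phi>: "E n \<phi> \<le> real n * \<gamma>" if n: "1 \<le> n" for n
  proof (rule tendsto_le[OF sequentially_bot tendsto_const])
    show "(\<lambda>j. E n (\<lambda>g. ln (norm (A (r j) g *v v (r j))) / L (r j))) \<longlonglongrightarrow> E n \<phi>"
    proof (rule E_dominated_convergence[OF dominated_b _ \<phi>])
      fix g j assume g: "g \<in> carrier G"
      show "\<bar>ln (norm (A (r j) g *v v (r j))) / L (r j)\<bar> \<le> b g"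
        using s.abs_ln_A_vec[OF g o.v_nz[of j], of j] A_bound[OF g, of "r j"] L_pos[of "r j"] v
        by (simp add: abs_div field_simps)
    qed
    have "\<forall>\<^sub>F j in sequentially. E n (\<lambda>g. ln (norm (A (r j) g *v v (r j)))) \<le> real n * (\<gamma> * L (r j))"
      using eventually_subseq[OF r slow[OF n]] .
    then show "\<forall>\<^sub>F j in sequentially. E n (\<lambda>g. ln (norm (A (r j) g *v v (r j))) / L (r j)) \<le> real n * \<gamma>"
      by eventually_elim (use L_pos in \<open>simp add: field_simps\<close>)
  qed
  have "D x \<one> = 0" if "x \<in> carrier G" for x
    by (rule o.orbit_collapses[OF \<gamma> slow\<phi> chi that])
  then show thesis
    using that[OF r] D[OF _ one_closed] by (simp add: A_one)
qed

section \<open>Laurent expansions and word length\<close>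

lemma laurent_at0_unique: "f has_laurent_expansion F \<Longrightarrow> laurent_at0 f = F"
  unfolding laurent_at0_def using has_laurent_expansion_unique by blast

lemma in_M_laurent: "in_M f \<Longrightarrow> f has_laurent_expansion laurent_at0 f"
  using laurent_at0_unique by (force simp: in_M_def meromorphic_on_def)

lemma in_M_mult: "in_M f \<Longrightarrow> in_M g \<Longrightarrow> in_M (\<lambda>t. f t * g t)"
  by (auto simp: in_M_def intro!: holomorphic_intros meromorphic_intros)

lemma in_M_add: "in_M f \<Longrightarrow> in_M g \<Longrightarrow> in_M (\<lambda>t. f t + g t)"
  by (auto simp: in_M_def intro!: holomorphic_intros meromorphic_intros)

lemma in_M_diff: "in_M f \<Longrightarrow> in_M g \<Longrightarrow> in_M (\<lambda>t. f t - g t)"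
  by (auto simp: in_M_def intro!: holomorphic_intros meromorphic_intros)

lemma filterlim_log_inverse_cmod: "filterlim (\<lambda>t::complex. ln (1 / cmod t)) at_top (at 0)"
proof -
  have "filterlim (\<lambda>t::complex. inverse (cmod t)) at_top (at 0)"
    by (intro filterlim_inverse_at_top tendsto_norm_zero tendsto_ident_at)
       (auto simp: eventually_at_filter)
  then show ?thesis
    using filterlim_compose[OF ln_at_top] by (simp add: inverse_eq_divide)
qed

lemma tendsto_inverse_log_cmod: "((\<lambda>t::complex. 1 / ln (1 / cmod t)) \<longlongrightarrow> 0) (at 0)"
  by (intro tendsto_divide_0[OF tendsto_const] filterlim_at_top_imp_at_infinity filterlim_log_inverse_cmod)

lemma eventually_log_gt: "\<forall>\<^sub>F t::complex in at 0. ln (1 / cmod t) > c"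
  using filterlim_log_inverse_cmod by (auto simp: filterlim_at_top_dense)

text \<open>If the leading term is c t^n, the root of |c| tends to 1 and the root of |t| is exp(-1),
  which matches the base e in \<open>abs_na\<close>. The zero germ fits because
  \<open>0 powr\<close> anything is 0.\<close>

lemma root_abs_na_tendsto:
  assumes "in_M f"
  shows "((\<lambda>t. cmod (f t) powr (1 / ln (1 / cmod t))) \<longlongrightarrow> abs_na (laurent_at0 f)) (at 0)"
proof -
  define F where "F = laurent_at0 f"
  have F: "f has_laurent_expansion F" unfolding F_def using assms by (rule in_M_laurent)
  let ?L = "\<lambda>t::complex. ln (1 / cmod t)"
  show ?thesis
  proof (cases "F = 0")
    case True
    then have "\<forall>\<^sub>F t in at 0. f t = 0" using F by (auto simp: has_laurent_expansion_def elim: eventually_mono)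
    then have "\<forall>\<^sub>F t in at 0. cmod (f t) powr (1 / ?L t) = 0" by eventually_elim simp
    then show ?thesis using True by (simp add: F_def[symmetric] abs_na_def tendsto_eventually)
  next
    case False
    define n where "n = fls_subdegree F"
    define c where "c = fls_nth F n"
    have c: "c \<noteq> 0" using False by (simp add: c_def n_def)
    have "((\<lambda>t. if f t = 0 \<and> c * t powi n = 0 then 1 else f t / (c * t powi n)) \<longlongrightarrow> 1) (at 0)"
      using has_laurent_expansion_imp_asymp_equiv_0[OF F] unfolding asymp_equiv_def c_def n_def .
    then have "((\<lambda>t. f t / (c * t powi n)) \<longlongrightarrow> 1) (at 0)"
      by (rule Lim_transform_eventually) (use c in \<open>auto simp: eventually_at_filter\<close>)
    then have r: "((\<lambda>t. cmod (f t / (c * t powi n)) * cmod c) \<longlongrightarrow> cmod 1 * cmod c) (at 0)"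
      by (intro tendsto_intros)
    have "((\<lambda>t. (cmod (f t / (c * t powi n)) * cmod c) powr (1 / ?L t) * exp (- real_of_int n)) \<longlongrightarrow> (cmod 1 * cmod c) powr 0 * exp (- real_of_int n)) (at 0)"
      using c by (intro tendsto_mult tendsto_powr r tendsto_inverse_log_cmod tendsto_const) auto
    moreover have "\<forall>\<^sub>F t in at 0. (cmod (f t / (c * t powi n)) * cmod c) powr (1 / ?L t) * exp (- real_of_int n) = cmod (f t) powr (1 / ?L t)"
      using eventually_log_gt[of 0]
    proof eventually_elim
      case (elim t)
      then have t: "t \<noteq> 0" by auto
      have p: "cmod (t powi n) > 0" using t by simp
      have "ln (cmod (t powi n)) = real_of_int n * ln (cmod t)"
        using t by (simp add: norm_power_int powr_real_of_int'[symmetric] ln_powr)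
      then have e: "cmod (t powi n) powr (1 / ?L t) = exp (- real_of_int n)"
        using p elim t by (simp add: powr_def ln_div field_simps)
      have "cmod (f t) = (cmod (f t / (c * t powi n)) * cmod c) * cmod (t powi n)"
        using c p by (simp add: norm_divide norm_mult)
      then have "cmod (f t) powr (1 / ?L t) = (cmod (f t / (c * t powi n)) * cmod c) powr (1 / ?L t) * cmod (t powi n) powr (1 / ?L t)"
        by (metis powr_mult mult_nonneg_nonneg norm_ge_zero)
      then show ?case by (simp add: e)
    qed
    ultimately have "((\<lambda>t. cmod (f t) powr (1 / ?L t)) \<longlongrightarrow> (cmod 1 * cmod c) powr 0 * exp (- real_of_int n)) (at 0)"
      by (rule Lim_transform_eventually)
    then show ?thesis using c False by (simp add: F_def[symmetric] abs_na_def n_def)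
  qed
qed

lemma norm_na_eq: "norm_na A = max (max (abs_na (A$1$1)) (abs_na (A$1$2))) (max (abs_na (A$2$1)) (abs_na (A$2$2)))"
proof -
  have "{abs_na (A $ i $ j) | i j. True} = {abs_na (A$1$1), abs_na (A$1$2), abs_na (A$2$1), abs_na (A$2$2)}"
  proof -
    have "{f i j | i j. True} = {f 1 1, f 1 2, f 2 1, f (2::2) (2::2)}" for f :: "2 \<Rightarrow> 2 \<Rightarrow> real"
    proof (intro subset_antisym subsetI)
      fix x assume "x \<in> {f i j | i j. True}"
      then obtain i j where "x = f i j" by blast
      then show "x \<in> {f 1 1, f 1 2, f 2 1, f 2 2}" using exhaust_2[of i] exhaust_2[of j] by auto
    qed blast
    from this[of "\<lambda>i j. abs_na (A $ i $ j)"] show ?thesis .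
  qed
  then show ?thesis unfolding norm_na_def by (simp add: max.assoc)
qed

lemma norm_matrix_entries:
  fixes A :: "complex^2^2"
  defines "e \<equiv> max (max (cmod (A$1$1)) (cmod (A$1$2))) (max (cmod (A$2$1)) (cmod (A$2$2)))"
  shows "e \<le> norm A" "norm A \<le> 4 * e"
proof -
  have le: "cmod (A$i$j) \<le> norm A" for i j
    by (meson Finite_Cartesian_Product.norm_nth_le order_trans)
  then show "e \<le> norm A" by (simp add: e_def)
  have l1: "norm x \<le> norm (x$1) + norm (x$2)" for x :: "'c::real_normed_vector^2"
    using L2_set_le_sum[of UNIV "\<lambda>i. norm (x$i)"] by (simp add: norm_vec_def sum_2)
  have "norm A \<le> norm (A$1) + norm (A$2)" by (rule l1)
  also have "\<dots> \<le> (cmod (A$1$1) + cmod (A$1$2)) + (cmod (A$2$1) + cmod (A$2$2))"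
    by (intro add_mono l1)
  also have "\<dots> \<le> 4 * e" unfolding e_def by linarith
  finally show "norm A \<le> 4 * e" .
qed

text \<open>Roots with positive exponent commute with maxima, and the factor 4 between the norm and
  the largest entry disappears in the limit.\<close>

lemma root_norm_na_tendsto:
  fixes rho :: "'a \<Rightarrow> complex \<Rightarrow> complex^2^2"
  assumes "\<And>i j. in_M (\<lambda>t. rho g t $ i $ j)"
  shows "((\<lambda>t. norm (rho g t) powr (1 / ln (1 / cmod t))) \<longlongrightarrow> norm_na (rho_na rho g)) (at 0)"
proof -
  let ?L = "\<lambda>t::complex. ln (1 / cmod t)"
  define a where "a i j t = cmod (rho g t $ i $ j) powr (1 / ?L t)" for i j t
  have a: "(a i j \<longlongrightarrow> abs_na (rho_na rho g $ i $ j)) (at 0)" for i j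
    using root_abs_na_tendsto[OF assms[of i j]] by (simp add: a_def[abs_def] rho_na_def)
  define e where "e t = max (max (a 1 1 t) (a 1 2 t)) (max (a 2 1 t) (a 2 2 t))" for t
  have e: "(e \<longlongrightarrow> norm_na (rho_na rho g)) (at 0)"
    unfolding e_def[abs_def] norm_na_eq by (intro tendsto_max a)
  have "((\<lambda>t. 4 powr (1 / ?L t) * e t) \<longlongrightarrow> 4 powr 0 * norm_na (rho_na rho g)) (at 0)"
    by (intro tendsto_mult tendsto_powr e tendsto_const tendsto_inverse_log_cmod) auto
  then have e4: "((\<lambda>t. 4 powr (1 / ?L t) * e t) \<longlongrightarrow> norm_na (rho_na rho g)) (at 0)" by simp
  have "\<forall>\<^sub>F t in at 0. e t \<le> norm (rho g t) powr (1 / ?L t) \<and> norm (rho g t) powr (1 / ?L t) \<le> 4 powr (1 / ?L t) * e t"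
    using eventually_log_gt[of 0]
  proof eventually_elim
    case (elim t)
    define m where "m = max (max (cmod (rho g t $ 1 $ 1)) (cmod (rho g t $ 1 $ 2))) (max (cmod (rho g t $ 2 $ 1)) (cmod (rho g t $ 2 $ 2)))"
    have mx: "max x y powr (1 / ?L t) = max (x powr (1 / ?L t)) (y powr (1 / ?L t))" if "0 \<le> x" "0 \<le> y" for x y :: real
      using that elim by (auto simp: max_def intro!: powr_mono2 antisym)
    have em: "e t = m powr (1 / ?L t)"
      unfolding e_def m_def a_def by (simp add: mx le_max_iff_disj)
    have m: "0 \<le> m" "m \<le> norm (rho g t)" "norm (rho g t) \<le> 4 * m"
      using norm_matrix_entries[of "rho g t"] by (auto simp: m_def le_max_iff_disj)
    have "norm (rho g t) powr (1 / ?L t) \<le> (4 * m) powr (1 / ?L t)" "m powr (1 / ?L t) \<le> norm (rho g t) powr (1 / ?L t)"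
      using m elim by (auto intro!: powr_mono2)
    then show ?case using m by (simp add: em powr_mult)
  qed
  then show ?thesis
    by (intro tendsto_sandwich[OF _ _ e e4]) (auto elim: eventually_mono)
qed

text \<open>By the identity theorem on the connected punctured disk. This turns information at the
  puncture into vanishing at every parameter.\<close>

lemma in_M_eq_0:
  assumes f: "in_M f" and z: "abs_na (laurent_at0 f) = 0" and t: "t \<in> punctured_disk"
  shows "f t = 0"
proof -
  have "laurent_at0 f = 0" using z by (auto simp: abs_na_def split: if_splits)
  then have "f has_laurent_expansion 0" using in_M_laurent[OF f] by simp
  then have "\<forall>\<^sub>F t in at 0. f t = 0" by (auto simp: has_laurent_expansion_def elim: eventually_mono)
  then obtain d where d: "d > 0" "\<And>t. t \<noteq> 0 \<Longrightarrow> cmod t < d \<Longrightarrow> f t = 0"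
    by (auto simp: eventually_at dist_norm)
  let ?U = "ball 0 (min d 1) - {0::complex}"
  have ne: "?U \<noteq> {}"
  proof -
    have "complex_of_real (min d 1 / 2) \<in> ?U" using d(1) by (auto simp: norm_divide)
    then show ?thesis by blast
  qed
  show ?thesis
  proof (rule analytic_continuation_open[of ?U punctured_disk f "\<lambda>_. 0"])
    show "connected punctured_disk"
      unfolding punctured_disk_def by (rule connected_punctured_ball) simp
    show "f holomorphic_on punctured_disk" using f by (simp add: in_M_def)
  qed (use d t ne in \<open>auto simp: punctured_disk_def\<close>)
qed

section \<open>Word length in a finitely generated group\<close>

context group
begin

lemma foldr_mult_closed: "set xs \<subseteq> carrier G \<Longrightarrow> foldr (\<otimes>) xs \<one> \<in> carrier G"
  by (induction xs) auto

lemma foldr_mult_append: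
  "set xs \<subseteq> carrier G \<Longrightarrow> set ys \<subseteq> carrier G \<Longrightarrow> foldr (\<otimes>) (xs @ ys) \<one> = foldr (\<otimes>) xs \<one> \<otimes> foldr (\<otimes>) ys \<one>"
  by (induction xs) (auto simp: foldr_mult_closed m_assoc)

lemma generate_words:
  assumes S: "S \<subseteq> carrier G" "\<forall>s\<in>S. inv s \<in> S" and g: "g \<in> generate G S"
  shows "\<exists>xs. set xs \<subseteq> S \<and> g = foldr (\<otimes>) xs \<one>"
  using g
proof (induction rule: generate.induct)
  case one
  then show ?case by (intro exI[of _ "[]"]) simp
next
  case (incl h)
  then show ?case using S by (intro exI[of _ "[h]"]) auto
next
  case (inv h)
  then show ?case using S by (intro exI[of _ "[inv h]"]) auto
next
  case (eng h1 h2)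
  then obtain xs ys where "set xs \<subseteq> S" "h1 = foldr (\<otimes>) xs \<one>" "set ys \<subseteq> S" "h2 = foldr (\<otimes>) ys \<one>" by auto
  then show ?case using S by (intro exI[of _ "xs @ ys"]) (auto simp: foldr_mult_append simp del: foldr_append)
qed

lemma word_length_word:
  assumes S: "S \<subseteq> carrier G" "\<forall>s\<in>S. inv s \<in> S" and g: "g \<in> generate G S"
  obtains xs where "length xs = word_length G S g" "set xs \<subseteq> S" "g = foldr (\<otimes>) xs \<one>"
proof -
  have "\<exists>n xs. length xs = n \<and> set xs \<subseteq> S \<and> g = foldr (\<lambda>x y. x \<otimes> y) xs \<one>"
    using generate_words[OF assms] by auto
  from LeastI_ex[OF this] show thesis using that unfolding word_length_def by blast
qed

lemma word_length_mult:
  assumes S: "S \<subseteq> carrier G" "\<forall>s\<in>S. inv s \<in> S" and g: "g \<in> generate G S" and h: "h \<in> generate G S"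
  shows "word_length G S (g \<otimes> h) \<le> word_length G S g + word_length G S h"
proof -
  obtain xs where xs: "length xs = word_length G S g" "set xs \<subseteq> S" "g = foldr (\<otimes>) xs \<one>"
    using word_length_word[OF S g] by blast
  obtain ys where ys: "length ys = word_length G S h" "set ys \<subseteq> S" "h = foldr (\<otimes>) ys \<one>"
    using word_length_word[OF S h] by blast
  have "g \<otimes> h = foldr (\<otimes>) (xs @ ys) \<one>" using xs ys S by (subst foldr_mult_append) auto
  then show ?thesis
    unfolding word_length_def[of G S "g \<otimes> h"] using xs ys
    by (intro Least_le exI[of _ "xs @ ys"]) (auto simp del: foldr_append)
qed

lemma countable_generate:
  assumes S: "S \<subseteq> carrier G" "\<forall>s\<in>S. inv s \<in> S" and "finite S"
  shows "countable (generate G S)"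
proof (rule countable_subset)
  show "generate G S \<subseteq> (\<lambda>xs. foldr (\<otimes>) xs \<one>) ` lists S"
    using generate_words[OF S] by (force simp: lists_eq_set)
  show "countable ((\<lambda>xs. foldr (\<otimes>) xs \<one>) ` lists S)"
    using assms by (intro countable_image countable_lists countable_finite)
qed

end

section \<open>Convergence of the Lyapunov exponent\<close>

text \<open>Choose one n at which the average of \<open>M\<close> is already below \<open>y\<close>,
  and let j tend to infinity with this n fixed.\<close>

lemma (in degeneration) lyapunov_ratio_lt:
  assumes lam: "\<And>j n. 1 \<le> n \<Longrightarrow> l j \<le> E n (\<lambda>g. ln (norm (A j g))) / real n" and y: "chi < y"
  shows "\<forall>\<^sub>F j in sequentially. l j / L j < y"
proof -
  have "\<forall>\<^sub>F n in sequentially. E n M / real n < y" using chi_lim y by (rule order_tendstoD)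
  then obtain N where "\<And>n. N \<le> n \<Longrightarrow> E n M / real n < y" by (auto simp: eventually_sequentially)
  then have "E (Suc N) M / real (Suc N) < y" by (meson le_SucI order_refl)
  then obtain n where n: "1 \<le> n" "E n M / real n < y" using that by force
  have "(\<lambda>j. E n (\<lambda>g. ln (norm (A j g)) / L j)) \<longlonglongrightarrow> E n M"
  proof (rule E_dominated_convergence[OF dominated_b _ A_lim])
    fix g j assume g: "g \<in> carrier G"
    show "\<bar>ln (norm (A j g)) / L j\<bar> \<le> b g"
      using A_bound[OF g, of j] ln_A_ge0[OF g, of j] L_pos[of j] by (simp add: field_simps)
  qed
  then have "(\<lambda>j. E n (\<lambda>g. ln (norm (A j g)) / L j) / real n) \<longlonglongrightarrow> E n M / real n"
    using n by (intro tendsto_divide tendsto_const) auto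
  then have "\<forall>\<^sub>F j in sequentially. E n (\<lambda>g. ln (norm (A j g)) / L j) / real n < y"
    using n(2) by (rule order_tendstoD)
  then show ?thesis
  proof eventually_elim
    case (elim j)
    have "l j / L j \<le> (E n (\<lambda>g. ln (norm (A j g))) / real n) / L j"
      by (rule divide_right_mono[OF lam[OF n(1)] less_imp_le[OF L_pos]])
    also have "\<dots> = E n (\<lambda>g. ln (norm (A j g)) / L j) / real n" by (simp add: mult.commute)
    finally show ?case using elim by linarith
  qed
qed

locale degenerating_rep = group G for G :: "('a, 'b) monoid_scheme" (structure) +
  fixes S :: "'a set" and m :: "'a pmf" and rho :: "'a \<Rightarrow> complex \<Rightarrow> complex^2^2"
  assumes finS: "finite S" and SG: "S \<subseteq> carrier G" and Sinv: "\<forall>s\<in>S. inv s \<in> S"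
    and genS: "generate G S = carrier G"
    and mG: "set_pmf m \<subseteq> carrier G" and genm: "generate G (set_pmf m) = carrier G"
    and mom: "integrable (measure_pmf m) (\<lambda>g. real (word_length G S g))"
    and rep: "SL2M_rep G rho"
begin

abbreviation \<Lambda> :: "complex \<Rightarrow> real" where "\<Lambda> t \<equiv> ln (1 / cmod t)"

definition M :: "'a \<Rightarrow> real" where "M g = ln (norm_na (rho_na rho g))"

lemma rho_in_M: "g \<in> carrier G \<Longrightarrow> in_M (\<lambda>t. rho g t $ i $ j)"
  using rep by (simp add: SL2M_rep_def)

lemma rho_det: "g \<in> carrier G \<Longrightarrow> t \<in> punctured_disk \<Longrightarrow> det (rho g t) = 1"
  using rep by (simp add: SL2M_rep_def)

lemma rho_mult: "g \<in> carrier G \<Longrightarrow> h \<in> carrier G \<Longrightarrow> t \<in> punctured_disk \<Longrightarrow> rho (g \<otimes> h) t = rho g t ** rho h t"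
  using rep by (simp add: SL2M_rep_def)

lemma eventually_punctured_disk: "\<forall>\<^sub>F t in at 0. t \<in> punctured_disk"
  unfolding punctured_disk_def by (rule eventually_at_in_open) auto

text \<open>Determinant 1 keeps the norms at least 1, hence also the limit of their roots, so the
  logarithm is continuous there.\<close>

lemma ln_norm_rho_tendsto:
  assumes g: "g \<in> carrier G"
  shows "((\<lambda>t. ln (norm (rho g t)) / \<Lambda> t) \<longlongrightarrow> M g) (at 0)"
proof -
  let ?f = "\<lambda>t. norm (rho g t) powr (1 / \<Lambda> t)"
  have lim: "(?f \<longlongrightarrow> norm_na (rho_na rho g)) (at 0)"
    by (rule root_norm_na_tendsto) (rule rho_in_M[OF g])
  have ev: "\<forall>\<^sub>F t in at 0. 1 \<le> norm (rho g t) \<and> 0 < \<Lambda> t"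
    using eventually_punctured_disk eventually_log_gt[of 0]
    by eventually_elim (use norm_matrix_ge_1 rho_det[OF g] in blast)
  have "\<forall>\<^sub>F t in at 0. 1 \<le> ?f t"
    using ev by eventually_elim (simp add: ge_one_powr_ge_zero)
  then have "1 \<le> norm_na (rho_na rho g)"
    by (intro tendsto_lowerbound[OF lim]) auto
  then have "((\<lambda>t. ln (?f t)) \<longlongrightarrow> M g) (at 0)"
    unfolding M_def by (intro tendsto_ln lim) auto
  then show ?thesis
    by (rule Lim_transform_eventually) (use ev in \<open>auto elim!: eventually_mono simp: ln_powr\<close>)
qed

text \<open>A neighbourhood of 0 depending on \<open>g\<close> would be useless for expectations. It
  is chosen for the finitely many generators, and submultiplicativity extends the bound to
  words.\<close>

lemma uniform_bound:
  obtains C r where "0 \<le> C" "0 < r" "\<And>t. t \<noteq> 0 \<Longrightarrow> cmod t < r \<Longrightarrow> t \<in> punctured_disk \<and> 0 < \<Lambda> t"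
    "\<And>t g. t \<noteq> 0 \<Longrightarrow> cmod t < r \<Longrightarrow> g \<in> carrier G \<Longrightarrow> ln (norm (rho g t)) \<le> \<Lambda> t * (C * real (word_length G S g) + 1)"
proof -
  define C where "C = (\<Sum>s\<in>S. \<bar>M s\<bar> + 1)"
  have C: "M s + 1 \<le> C" if "s \<in> S" for s
  proof -
    have "\<bar>M s\<bar> + 1 \<le> C" unfolding C_def by (rule member_le_sum) (use that finS in auto)
    then show ?thesis by linarith
  qed
  have C0: "0 \<le> C" unfolding C_def by (rule sum_nonneg) auto
  have "\<forall>\<^sub>F t in at 0. ln (norm (rho s t)) / \<Lambda> t < M s + 1" if "s \<in> S" for s
    using ln_norm_rho_tendsto[of s] that SG by (intro order_tendstoD(2)) auto
  then have "\<forall>\<^sub>F t in at 0. \<forall>s\<in>S. ln (norm (rho s t)) / \<Lambda> t < M s + 1"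
    using finS by (simp add: eventually_ball_finite)
  then have "\<forall>\<^sub>F t in at 0. (\<forall>s\<in>S. ln (norm (rho s t)) / \<Lambda> t < M s + 1) \<and> t \<in> punctured_disk \<and> 1 < \<Lambda> t"
    using eventually_punctured_disk eventually_log_gt[of 1] by eventually_elim blast
  then obtain r where r: "r > 0" and ev: "\<And>t. t \<noteq> 0 \<Longrightarrow> cmod t < r \<Longrightarrow>
      (\<forall>s\<in>S. ln (norm (rho s t)) / \<Lambda> t < M s + 1) \<and> t \<in> punctured_disk \<and> 1 < \<Lambda> t"
    by (auto simp: eventually_at dist_norm)
  have bd: "ln (norm (rho g t)) \<le> \<Lambda> t * (C * real (word_length G S g) + 1)"
    if t: "t \<noteq> 0" "cmod t < r" and g: "g \<in> carrier G" for t g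
  proof -
    have tp: "t \<in> punctured_disk" and L1: "1 < \<Lambda> t" using ev[OF t] by auto
    have gen: "ln (norm (rho s t)) \<le> \<Lambda> t * C" if "s \<in> S" for s
    proof -
      have "ln (norm (rho s t)) / \<Lambda> t \<le> C" using ev[OF t] C[OF that] that by force
      then show ?thesis using L1 by (simp add: field_simps)
    qed
    have words: "ln (norm (rho (foldr (\<otimes>) xs \<one>) t)) \<le> \<Lambda> t * (C * real (length xs) + 1)" if "set xs \<subseteq> S" for xs
      using that
    proof (induction xs)
      \<comment> \<open>The summand 1 in the weight pays for the empty word, since the norm of the
        identity matrix exceeds 1.\<close>
      case Nil
      have "invertible (rho \<one> t)" using rho_det[OF one_closed tp] by (simp add: invertible_det_nz)
      then obtain B where B: "B ** rho \<one> t = mat 1" by (auto simp: invertible_def)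
      have "B ** (rho \<one> t ** rho \<one> t) = B ** rho \<one> t" using rho_mult[OF one_closed one_closed tp] by simp
      then have "rho \<one> t = mat 1" by (simp add: matrix_mul_assoc B)
      moreover have "norm (mat 1 :: complex^2^2) \<le> 2"
        using norm_le_columns[of "mat 1"] by (simp add: norm_axis_1)
      moreover have "norm (mat 1 :: complex^2^2) \<ge> 1"
        by (rule norm_matrix_ge_1) simp
      ultimately have "ln (norm (rho \<one> t)) \<le> ln 2" by (metis ln_mono less_le_trans zero_less_one)
      also have "\<dots> \<le> 1" using ln_le_minus_one[of 2] by simp
      finally show ?case using L1 by simp
    next
      case (Cons s xs)
      let ?p = "foldr (\<otimes>) xs \<one>"
      have c: "s \<in> carrier G" "?p \<in> carrier G" using Cons.prems SG foldr_mult_closed by auto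
      have n1: "1 \<le> norm (rho s t)" "1 \<le> norm (rho ?p t)" "1 \<le> norm (rho (s \<otimes> ?p) t)"
        using norm_matrix_ge_1 rho_det c tp m_closed by blast+
      have "norm (rho (s \<otimes> ?p) t) \<le> norm (rho s t) * norm (rho ?p t)"
        unfolding rho_mult[OF c tp] by (rule norm_matrix_mult_le)
      then have "ln (norm (rho (s \<otimes> ?p) t)) \<le> ln (norm (rho s t) * norm (rho ?p t))"
        using n1 by (intro ln_mono) auto
      also have "\<dots> = ln (norm (rho s t)) + ln (norm (rho ?p t))"
        using n1 by (auto simp: ln_mult)
      also have "\<dots> \<le> \<Lambda> t * C + \<Lambda> t * (C * real (length xs) + 1)"
        using gen Cons by (intro add_mono) auto
      finally show ?case by (simp add: algebra_simps)
    qed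
    obtain xs where "length xs = word_length G S g" "set xs \<subseteq> S" "g = foldr (\<otimes>) xs \<one>"
      using word_length_word[OF SG Sinv, of g] g genS by auto
    then show ?thesis using words[of xs] by simp
  qed
  show thesis
  proof (rule that[OF C0 r _ bd])
    fix t :: complex assume "t \<noteq> 0" "cmod t < r"
    then have "t \<in> punctured_disk" "1 < \<Lambda> t" using ev by blast+
    then show "t \<in> punctured_disk \<and> 0 < \<Lambda> t" by linarith
  qed
qed

lemma lyapunov_degeneration: "((\<lambda>t. lyap G m rho t / \<Lambda> t) \<longlongrightarrow> lyap_na G m rho) (at 0)"
proof -
  obtain C r where C: "0 \<le> C" and r: "0 < r"
    and small: "\<And>t. t \<noteq> 0 \<Longrightarrow> cmod t < r \<Longrightarrow> t \<in> punctured_disk \<and> 0 < \<Lambda> t"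
    and bound: "\<And>t g. t \<noteq> 0 \<Longrightarrow> cmod t < r \<Longrightarrow> g \<in> carrier G \<Longrightarrow> ln (norm (rho g t)) \<le> \<Lambda> t * (C * real (word_length G S g) + 1)"
    by (rule uniform_bound) (rule that)
  define b where "b g = C * real (word_length G S g) + 1" for g
  interpret W: weighted_walk G m b
  proof unfold_locales
    show "b (g \<otimes> h) \<le> b g + b h" if "g \<in> carrier G" "h \<in> carrier G" for g h
    proof -
      have "real (word_length G S (g \<otimes> h)) \<le> real (word_length G S g) + real (word_length G S h)"
        using word_length_mult[OF SG Sinv, of g h] that genS by simp
      from mult_left_mono[OF this C] show ?thesis by (simp add: b_def algebra_simps)
    qed
  qed (use mG mom C in \<open>auto simp: b_def[abs_def]\<close>)
  \<comment> \<open>\<open>lyap\<close> is defined by \<open>lim\<close>, so convergence must be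
    established before its value can be used.\<close>
  have lyap: "(\<lambda>n. W.E n (\<lambda>g. ln (norm (rho g t))) / real n) \<longlonglongrightarrow> lyap G m rho t"
     "0 \<le> lyap G m rho t" "\<And>n. 1 \<le> n \<Longrightarrow> lyap G m rho t \<le> W.E n (\<lambda>g. ln (norm (rho g t))) / real n"
    if t: "t \<noteq> 0" "cmod t < r" for t
  proof -
    have tp: "t \<in> punctured_disk" "0 < \<Lambda> t" using small[OF t] by auto
    have n1: "1 \<le> norm (rho g t)" if "g \<in> carrier G" for g
      using norm_matrix_ge_1 rho_det[OF that tp(1)] by blast
    have dom: "W.dominated (\<lambda>g. ln (norm (rho g t)))"
      by (rule W.dominatedI[of _ "\<Lambda> t"]) (use bound[OF t] n1 in \<open>auto simp: b_def\<close>)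
    have sub: "ln (norm (rho (h \<otimes> g) t)) \<le> ln (norm (rho h t)) + ln (norm (rho g t))"
      if "g \<in> carrier G" "h \<in> carrier G" for g h
    proof -
      have "norm (rho (h \<otimes> g) t) \<le> norm (rho h t) * norm (rho g t)"
        unfolding rho_mult[OF that(2,1) tp(1)] by (rule norm_matrix_mult_le)
      then have "ln (norm (rho (h \<otimes> g) t)) \<le> ln (norm (rho h t) * norm (rho g t))"
        using n1[of "h \<otimes> g"] that by (intro ln_mono) auto
      moreover have "rho g t \<noteq> 0" "rho h t \<noteq> 0" using n1[OF that(1)] n1[OF that(2)] by auto
      ultimately show ?thesis by (simp add: ln_mult)
    qed
    have nn: "0 \<le> ln (norm (rho g t))" if "g \<in> carrier G" for g using n1[OF that] by simp
    obtain l where l: "(\<lambda>n. W.E n (\<lambda>g. ln (norm (rho g t))) / real n) \<longlonglongrightarrow> l" "l \<ge> 0"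
      "\<And>n. n \<ge> 1 \<Longrightarrow> l \<le> W.E n (\<lambda>g. ln (norm (rho g t))) / real n"
      by (rule W.E_ratio_tendsto[OF dom sub nn]) (assumption+, rule that)
    have "lyap G m rho t = l" unfolding lyap_def by (rule limI[OF l(1)])
    with l show "(\<lambda>n. W.E n (\<lambda>g. ln (norm (rho g t))) / real n) \<longlonglongrightarrow> lyap G m rho t"
     "0 \<le> lyap G m rho t" "\<And>n. 1 \<le> n \<Longrightarrow> lyap G m rho t \<le> W.E n (\<lambda>g. ln (norm (rho g t))) / real n" by simp_all
  qed
  have deg: "degeneration G m b (\<lambda>j g. rho g (t j)) (\<lambda>j. \<Lambda> (t j)) M"
    if t: "\<And>j. t j \<noteq> 0" "\<And>j. cmod (t j) < r" and lim: "t \<longlonglongrightarrow> 0" for t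
  proof -
    have at0: "filterlim t (at 0) sequentially" using lim t(1) by (intro filterlim_atI) auto
    show ?thesis
    proof unfold_locales
      show "countable (carrier G)" using countable_generate[OF SG Sinv finS] genS by simp
      show "filterlim (\<lambda>j. \<Lambda> (t j)) at_top sequentially"
        by (rule filterlim_compose[OF filterlim_log_inverse_cmod at0])
      show "(\<lambda>j. ln (norm (rho g (t j))) / \<Lambda> (t j)) \<longlonglongrightarrow> M g" if "g \<in> carrier G" for g
        by (rule filterlim_compose[OF ln_norm_rho_tendsto[OF that] at0])
      show "ln (norm (rho g (t j))) \<le> \<Lambda> (t j) * b g" if "g \<in> carrier G" for j g
        using bound[OF t that] by (simp add: b_def)
    qed (use genm small[OF t] rho_det rho_mult in auto)
  qed
  have pick: "\<exists>t. (\<forall>j. t j \<noteq> 0 \<and> cmod (t j) < r \<and> \<not> Q (t j)) \<and> t \<longlonglongrightarrow> 0"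
    if "\<not> (\<forall>\<^sub>F t in at 0. Q t)" for Q :: "complex \<Rightarrow> bool"
  proof -
    have "\<exists>t. t \<noteq> 0 \<and> cmod t < r / real (Suc j) \<and> \<not> Q t" for j
    proof (rule ccontr)
      assume H: "\<not> ?thesis"
      have "0 < r / real (Suc j)" using r by simp
      moreover have "\<And>t. t \<noteq> 0 \<Longrightarrow> dist t 0 < r / real (Suc j) \<Longrightarrow> Q t" using H by (auto simp: dist_norm)
      ultimately have "\<forall>\<^sub>F t in at 0. Q t" unfolding eventually_at by blast
      with that show False by contradiction
    qed
    then obtain t where t: "\<And>j. t j \<noteq> 0" "\<And>j. cmod (t j) < r / real (Suc j)" "\<And>j. \<not> Q (t j)" by metis
    have "(\<lambda>j. r / real (Suc j)) \<longlonglongrightarrow> 0" by (rule LIMSEQ_Suc[OF lim_const_over_n])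
    then have "t \<longlonglongrightarrow> 0"
      by (rule Lim_null_comparison[rotated]) (intro always_eventually allI less_imp_le t(2))
    moreover have "cmod (t j) < r" for j
    proof -
      have "r / real (Suc j) \<le> r" using r by (simp add: divide_le_eq)
      with t(2)[of j] show ?thesis by linarith
    qed
    ultimately show ?thesis using t by blast
  qed
  show ?thesis
  proof (rule order_tendstoI)
    fix y assume y: "lyap_na G m rho < y"
    show "\<forall>\<^sub>F t in at 0. lyap G m rho t / \<Lambda> t < y"
    proof (rule ccontr)
      assume "\<not> ?thesis"
      from pick[OF this] obtain t where t: "\<And>j. t j \<noteq> 0" "\<And>j. cmod (t j) < r"
        and no: "\<And>j. \<not> lyap G m rho (t j) / \<Lambda> (t j) < y" and lim: "t \<longlonglongrightarrow> 0" by blast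
      interpret d: degeneration G m b "\<lambda>j g. rho g (t j)" "\<lambda>j. \<Lambda> (t j)" M by (rule deg[OF t lim])
      have "d.chi = lyap_na G m rho" unfolding d.chi_def by (simp add: lyap_na_def M_def[abs_def])
      then have "\<forall>\<^sub>F j in sequentially. lyap G m rho (t j) / \<Lambda> (t j) < y"
        using d.lyapunov_ratio_lt[OF lyap(3)[OF t]] y by simp
      then show False using no by (simp add: eventually_sequentially)
    qed
  next
    fix y assume y: "y < lyap_na G m rho"
    show "\<forall>\<^sub>F t in at 0. y < lyap G m rho t / \<Lambda> t"
    proof (rule ccontr)
      assume "\<not> ?thesis"
      from pick[OF this] obtain t where t: "\<And>j. t j \<noteq> 0" "\<And>j. cmod (t j) < r"
        and no: "\<And>j. \<not> y < lyap G m rho (t j) / \<Lambda> (t j)" and lim: "t \<longlonglongrightarrow> 0" by blast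
      interpret d: degeneration G m b "\<lambda>j g. rho g (t j)" "\<lambda>j. \<Lambda> (t j)" M by (rule deg[OF t lim])
      have chi: "d.chi = lyap_na G m rho" unfolding d.chi_def by (simp add: lyap_na_def M_def[abs_def])
      have tp: "t j \<in> punctured_disk" for j using small[OF t] by blast
      have le: "lyap G m rho (t j) \<le> y * \<Lambda> (t j)" for j
        using no[of j] d.L_pos[of j] by (simp add: not_less field_simps)
      \<comment> \<open>Ensures that \<open>d.chi\<close>, being larger than \<open>y\<close>, is
        positive.\<close>
      have y0: "0 \<le> y"
        using lyap(2)[OF t, of 0] no[of 0] d.L_pos[of 0] by (smt (verit) divide_nonneg_pos)
      define invariant where "invariant j v \<longleftrightarrow> norm v = 1 \<and> (\<forall>g\<in>carrier G. wedge (rho g (t j) *v v) v = 0)" for j v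
      show False
      \<comment> \<open>If infinitely many parameters admit an invariant line, the reducible case
        applies along them. Otherwise an invariant line is produced for every parameter, against
        finiteness.\<close>
      proof (cases "infinite {j. \<exists>v. invariant j v}")
        case True
        then obtain k :: "nat \<Rightarrow> nat" where k: "strict_mono k" "\<And>j. \<exists>v. invariant (k j) v"
          using infinite_enumerate[OF True] by auto
        then obtain v where v: "\<And>j. invariant (k j) (v j)" by metis
        interpret s: degeneration G m b "\<lambda>j g. rho g (t (k j))" "\<lambda>j. \<Lambda> (t (k j))" M
          by (rule d.subseq[OF k(1)])
        have "s.chi \<le> y"
          by (rule s.chi_le_invariant_line[of v "\<lambda>j. lyap G m rho (t (k j))"])
             (use v lyap(1)[OF t] le in \<open>auto simp: invariant_def\<close>)
        then show False using y unfolding s.chi_def by (simp add: lyap_na_def M_def[abs_def])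
      next
        case False
        \<comment> \<open>Strictly between \<open>y\<close> and \<open>d.chi\<close>: the bad
          directions need a rate above the exponents, the collapse of their orbit a rate below
          \<open>d.chi\<close>.\<close>
        define z where "z = (y + d.chi) / 2"
        have z: "y < z" "z < d.chi" using y chi by (auto simp: z_def)
        \<comment> \<open>Taking j as the time horizon makes every fixed n admissible for all large
          j.\<close>
        have "\<exists>v. norm v = 1 \<and> (\<forall>n. 1 \<le> n \<longrightarrow> n \<le> j \<longrightarrow> W.E n (\<lambda>g. ln (norm (rho g (t j) *v v))) < real n * (z * \<Lambda> (t j)))" for j
        proof -
          have lt: "lyap G m rho (t j) < z * \<Lambda> (t j)"
            using le[of j] z(1) d.L_pos[of j] by (smt (verit) mult_strict_right_mono)
          obtain v where "norm v = 1" "\<And>n. 1 \<le> n \<Longrightarrow> n \<le> j \<Longrightarrow> W.E n (\<lambda>g. ln (norm (rho g (t j) *v v))) < real n * (z * \<Lambda> (t j))"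
            by (rule W.bad_direction_exists[of "\<lambda>g. rho g (t j)", OF d.A_det d.A_mult d.dominated_ln_A lyap(1)[OF t] lt, where K=j])
               (assumption+, rule that)
          then show ?thesis by blast
        qed
        then obtain v where v: "\<And>j. norm (v j) = 1"
          and slow: "\<And>j n. 1 \<le> n \<Longrightarrow> n \<le> j \<Longrightarrow> W.E n (\<lambda>g. ln (norm (rho g (t j) *v v j))) < real n * (z * \<Lambda> (t j))"
          by metis
        obtain k where k: "strict_mono (k :: nat \<Rightarrow> nat)"
          and close: "\<And>x. x \<in> carrier G \<Longrightarrow> (\<lambda>j. cmod (wedge (rho x (t (k j)) *v v (k j)) (v (k j))) powr (1 / \<Lambda> (t (k j)))) \<longlonglongrightarrow> 0"
        proof (rule d.slow_directions_almost_invariant[of v z, OF v z(2)])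
          show "0 < d.chi" using y0 z by linarith
          show "\<forall>\<^sub>F j in sequentially. W.E n (\<lambda>g. ln (norm (rho g (t j) *v v j))) \<le> real n * (z * \<Lambda> (t j))" if "1 \<le> n" for n
            by (rule eventually_sequentiallyI[of n]) (use slow[OF that] in \<open>auto intro: less_imp_le\<close>)
        qed (rule that)
        interpret s: degeneration G m b "\<lambda>j g. rho g (t (k j))" "\<lambda>j. \<Lambda> (t (k j))" M
          by (rule d.subseq[OF k])
        have at0: "filterlim (\<lambda>j. t (k j)) (at 0) sequentially"
          using LIMSEQ_subseq_LIMSEQ[OF lim k] t(1) by (intro filterlim_atI) (auto simp: o_def)
        have comm: "det (rho g u ** rho h u - rho h u ** rho g u) = 0"
          if g: "g \<in> carrier G" and h: "h \<in> carrier G" and u: "u \<in> punctured_disk" for g h u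
        proof -
          let ?F = "\<lambda>u. det (rho g u ** rho h u - rho h u ** rho g u)"
          have F: "in_M ?F"
            unfolding det_2 vector_minus_component matrix_matrix_mult_def vec_lambda_beta sum_2
            by (intro in_M_diff in_M_mult in_M_add rho_in_M g h)
          let ?A = "\<lambda>j. rho g (t (k j))" and ?B = "\<lambda>j. rho h (t (k j))" and ?w = "\<lambda>j. v (k j)" and ?e = "\<lambda>j. 1 / \<Lambda> (t (k j))"
          \<comment> \<open>Each term of the commutator estimate contains a wedge whose root tends
            to 0, while the norms contribute finite factors; hence the right-hand side is 0.\<close>
          have "abs_na (laurent_at0 ?F) \<le> max (exp (M g) * exp (M h) * (exp (M h) * 0)) (exp (M g) * exp (M h) * (exp (M g) * 0))"
          proof (rule root_limit_le_max[OF s.L_top])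
            show "cmod (?F (t (k j))) \<le> 8 * (norm (?A j) * norm (?B j) * (norm (?B j) * cmod (wedge (?A j *v ?w j) (?w j)))
               + norm (?A j) * norm (?B j) * (norm (?A j) * cmod (wedge (?B j *v ?w j) (?w j))))" for j
              using norm_commutator_det_le[OF v[of "k j"], of "?A j" "?B j"] by (simp add: algebra_simps)
            show "(\<lambda>j. cmod (?F (t (k j))) powr ?e j) \<longlonglongrightarrow> abs_na (laurent_at0 ?F)"
              by (rule filterlim_compose[OF root_abs_na_tendsto[OF F] at0])
            show "(\<lambda>j. (norm (?A j) * norm (?B j) * (norm (?B j) * cmod (wedge (?A j *v ?w j) (?w j)))) powr ?e j)
                \<longlonglongrightarrow> exp (M g) * exp (M h) * (exp (M h) * 0)"
              unfolding powr_mult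
              by (intro tendsto_mult s.root_norm_lim close g h)
            show "(\<lambda>j. (norm (?A j) * norm (?B j) * (norm (?A j) * cmod (wedge (?B j *v ?w j) (?w j)))) powr ?e j)
                \<longlonglongrightarrow> exp (M g) * exp (M h) * (exp (M g) * 0)"
              unfolding powr_mult
              by (intro tendsto_mult s.root_norm_lim close g h)
          qed auto
          then have "abs_na (laurent_at0 ?F) \<le> 0" by simp
          moreover have "0 \<le> abs_na (laurent_at0 ?F)" by (simp add: abs_na_def)
          ultimately have "abs_na (laurent_at0 ?F) = 0" by (rule antisym)
          then show ?thesis by (rule in_M_eq_0[OF F _ u])
        qed
        have "\<exists>v. invariant j v" for j
        proof -
          obtain w where "norm w = 1" "\<And>X. X \<in> (\<lambda>g. rho g (t j)) ` carrier G \<Longrightarrow> wedge (X *v w) w = 0"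
          proof (rule invariant_line_exists[of "(\<lambda>g. rho g (t j)) ` carrier G"])
            fix X Y assume "X \<in> (\<lambda>g. rho g (t j)) ` carrier G" "Y \<in> (\<lambda>g. rho g (t j)) ` carrier G"
            then obtain g h where gh: "g \<in> carrier G" "h \<in> carrier G" "X = rho g (t j)" "Y = rho h (t j)" by auto
            show "X ** Y \<in> (\<lambda>g. rho g (t j)) ` carrier G"
              unfolding gh(3,4) rho_mult[OF gh(1,2) tp, symmetric] using gh by auto
            show "det (X ** Y - Y ** X) = 0" unfolding gh(3,4) by (rule comm[OF gh(1,2) tp])
          qed (use rho_det tp that in auto)
          then show ?thesis unfolding invariant_def by auto
        qed
        then show False using False by simp
      qed
    qed
  qed
qed

end

theorem theoremA:
  fixes G :: "('a, 'b) monoid_scheme" and S :: "'a set" and m :: "'a pmf"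
    and rho :: "'a \<Rightarrow> complex \<Rightarrow> complex^2^2"
  assumes "group G"
    and "finite S" and "S \<subseteq> carrier G" and "\<forall>s\<in>S. inv\<^bsub>G\<^esub> s \<in> S"
    and "generate G S = carrier G"
    and "set_pmf m \<subseteq> carrier G"
    and "generate G (set_pmf m) = carrier G"
    and "\<exists>\<delta>>0. integrable (measure_pmf m) (\<lambda>g. real (word_length G S g) powr (1 + \<delta>))"
    and "SL2M_rep G rho"
  shows "((\<lambda>t. lyap G m rho t / ln (1 / cmod t)) \<longlongrightarrow> lyap_na G m rho) (at 0)"
proof -
  obtain \<delta> where \<delta>: "\<delta> > 0" "integrable (measure_pmf m) (\<lambda>g. real (word_length G S g) powr (1 + \<delta>))"
    using assms(8) by blast
  have "integrable (measure_pmf m) (\<lambda>g. real (word_length G S g))"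
  proof (rule Bochner_Integration.integrable_bound[where f="\<lambda>g. real (word_length G S g) powr (1 + \<delta>)"])
    \<comment> \<open>Lengths are integers: a positive one is at least 1 and does not decrease under
      the power, and length 0 is trivial.\<close>
    have "real n \<le> real n powr (1 + \<delta>)" for n :: nat
    proof (cases "n = 0")
      case False
      then have "real n powr 1 \<le> real n powr (1 + \<delta>)" using \<delta> by (intro powr_mono) auto
      then show ?thesis using False by simp
    qed simp
    then show "AE g in measure_pmf m. norm (real (word_length G S g)) \<le> norm (real (word_length G S g) powr (1 + \<delta>))"
      by simp
  qed (use \<delta> in auto)
  then interpret degenerating_rep G S m rho
    using assms by (intro degenerating_rep.intro degenerating_rep_axioms.intro)
  show ?thesis by (rule lyapunov_degeneration)
qed

end
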